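(* Let $d\geq4$, $t_0>1$ and $r_0\in(0,1)$. There is a constant $C\in(0,\infty)$ (depending only on $d,t_0,r_0$) such that for all $t\geq t_0$ and all $r\in(0,r_0)$, $$\mathrm{E}\Big[\mathrm{cap}\big(W^{0,r}_{[0,t]}\big)^2\Big]\leq C\times\begin{cases}t^2\,r^{2(d-4)}&\text{if } d\geq5,\\[2pt]\Big(\dfrac{t}{\log(tr^{-2})}\Big)^2&\text{if } d=4.\end{cases}$$
   Context: $B^0$ is a standard Brownian motion in $\mathbb{R}^d$ started at $0$, with expectation $\mathrm{E}$, and $W^{0,r}_{[0,t]}=\bigcup_{0\le s\le t}\mathcal{B}(B^0_s,r)$ is the Wiener sausage of radius $r$, where $\mathcal{B}(z,r)$ is the open Euclidean ball. For a bounded Borel set $A\subseteq\mathbb{R}^d$, the Newtonian capacity is $\mathrm{cap}(A)=\big[\inf_\nu\int_A\int_A G(x,y)\,\nu(\mathrm{d}x)\,\nu(\mathrm{d}y)\big]^{-1}$, the infimum being over all probability measures $\nu$ on $A$, with $G(x,y)=\frac{\Gamma(d/2-1)}{2\pi^{d/2}\|x-y\|^{d-2}}$. *)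

theory Defs
  imports "HOL-Probability.Probability"
begin

text \<open>Only times \<open>t \<ge> 0\<close> matter; \<open>B\<close> is unconstrained at negative times. The density of an
  increment is that of independent centred normal coordinates of variance \<open>t - s\<close>
  (\<^const>\<open>normal_density\<close> takes the standard deviation).\<close>

locale standard_brownian_motion = prob_space M
  for M :: "'w measure" and B :: "real \<Rightarrow> 'w \<Rightarrow> 'a::euclidean_space" +
  assumes measurable: "\<And>t. 0 \<le> t \<Longrightarrow> B t \<in> borel_measurable M"
    and start: "AE \<omega> in M. B 0 \<omega> = 0"
    and continuous_paths: "AE \<omega> in M. continuous_on {0..} (\<lambda>t. B t \<omega>)"
    and gaussian_increments: "\<And>s t. 0 \<le> s \<Longrightarrow> s < t \<Longrightarrow>
      distributed M lborel (\<lambda>\<omega>. B t \<omega> - B s \<omega>)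
        (\<lambda>x. ennreal (\<Prod>b\<in>Basis. normal_density 0 (sqrt (t - s)) (x \<bullet> b)))"
    and indep_increments: "\<And>(n::nat) \<tau>. 0 \<le> \<tau> 0 \<Longrightarrow> (\<And>i. i < n \<Longrightarrow> \<tau> i < \<tau> (Suc i)) \<Longrightarrow>
      indep_vars (\<lambda>_. borel) (\<lambda>i \<omega>. B (\<tau> (Suc i)) \<omega> - B (\<tau> i) \<omega>) {..<n}"

definition wiener_sausage ::
  "(real \<Rightarrow> 'a::euclidean_space) \<Rightarrow> real \<Rightarrow> real \<Rightarrow> 'a set" where
  "wiener_sausage w r t = (\<Union>s\<in>{0..t}. ball (w s) r)"

text \<open>The diagonal is treated separately, as division by zero would otherwise give
  \<open>G x x = 0\<close> instead of \<open>\<infinity>\<close>. The formula is meant for dimension at least 3.\<close>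

definition newton_kernel :: "'a::euclidean_space \<Rightarrow> 'a \<Rightarrow> ennreal" where
  "newton_kernel x y =
    (if x = y then \<infinity>
     else ennreal (Gamma (DIM('a) / 2 - 1) /
            (2 * pi powr (DIM('a) / 2) * norm (x - y) ^ (DIM('a) - 2))))"

text \<open>A probability measure on the Borel set \<open>A\<close> is represented by a Borel probability measure on
  the whole space that gives \<open>A\<close> full mass. Energies are valued in \<open>[0, \<infinity>]\<close>, with \<open>1 / \<infinity> = 0\<close>; the
  infimum over no measures at all (\<open>A = {}\<close>) is \<open>\<infinity>\<close>, so that the empty set has capacity 0.\<close>

definition prob_measures_on :: "'a::euclidean_space set \<Rightarrow> 'a measure set" where
  "prob_measures_on A = {\<nu>. prob_space \<nu> \<and> sets \<nu> = sets borel \<and> emeasure \<nu> A = 1}"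

definition newton_capacity :: "'a::euclidean_space set \<Rightarrow> ennreal" where
  "newton_capacity A =
    inverse (INF \<nu>\<in>prob_measures_on A. \<integral>\<^sup>+x\<in>A. (\<integral>\<^sup>+y\<in>A. newton_kernel x y \<partial>\<nu>) \<partial>\<nu>)"

end

theory Submission imports Defs begin

text \<open>Cut \<open>[0, t]\<close> into \<open>N\<close> pieces of length \<open>v = r\<^sup>2\<close>. Over a piece starting at time \<open>i v\<close> the sausage lies
  in a ball around \<open>B (i v)\<close> whose radius \<open>r + X i\<close> has moments of order \<open>r\<close>, so by subadditivity
  the capacity is at most \<open>\<Sum>i<N. C (r + X i)\<^bsup>d-2\<^esup>\<close>; this suffices for \<open>d \<ge> 5\<close>.

  For \<open>d = 4\<close> a logarithm must be gained. The kernel \<open>g(x) = \<integral>\<^bsub>0\<^esub>\<^bsup>1/v\<^esup> exp (-s |x|\<^sup>2) ds \<le> 1 / |x|\<^sup>2\<close>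
  is bounded and positive definite, so if \<open>\<Sum>j<2 N. g (x - B (j v)) \<ge> u\<close> on \<open>A\<close>, then Cauchy--Schwarz for
  energies gives \<open>cap A \<le> C \<Gamma> / u\<^sup>2\<close> with \<open>\<Gamma> = \<Sum>i j. g (B (i v) - B (j v))\<close>, and \<open>E \<Gamma>\<^sup>2\<close> has order
  \<open>(N log N / v)\<^sup>2\<close>. Because \<open>g(x) \<ge> 1 / (v + |x|\<^sup>2)\<close>, one may take \<open>u\<close> of order \<open>log N / v\<close> on every
  piece for which \<open>\<Sum>m\<le>N. |B ((i + m) v) - B (i v)|\<^sup>2 / m\<^sup>2\<close> is at most a multiple of \<open>v log N\<close> and \<open>X i\<close> is
  not too large. An exponential moment shows that the other pieces are so rare that covering them by
  balls costs no more.\<close>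

section \<open>Capacity bounds\<close>

text \<open>The step \<open>r ^ 2\<close> is the diffusive time scale of a ball of radius
  \<open>r\<close>: a piece costs about \<open>r ^ (d - 2)\<close>, and \<open>t / r ^ 2\<close>
  pieces cost \<open>t * r ^ (d - 4)\<close>. For d = 4 this is t, too large by a logarithm. The
  gain comes from the path seeing itself: after m steps the squared displacement is of order
  \<open>m * v\<close>, so the potential at a point of the path is a harmonic sum
  \<open>u = log N / v\<close>, and \<open>\<Gamma> / u ^ 2 = (N * log N / v) / (log N / v) ^ 2 = N
  * v / log N\<close>. The Newton kernel would make \<open>\<Gamma>\<close> infinite on the
  diagonal. Since 1 / |x|^2 is the integral of exp (-s |x|^2) over all s > 0, stopping at s = 1 / v
  removes the singularity below scale r and still leaves a mixture of Gaussians, hence a positive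
  definite kernel. The obstacle is that the potential must be large on the whole set, not just on
  average. Exceptional pieces are paid for by balls, which is affordable if they contribute
  \<open>v ^ 2 / (log N) ^ 2\<close> to the mean of squares. In dimension four the exponential
  moment is at most \<open>exp (2 * harm N)\<close>; the threshold \<open>48 * v * harm N\<close>
  gains \<open>exp (- 3 * harm N)\<close>, and the remaining \<open>exp (- harm N)\<close> beats
  every power of \<open>harm N\<close>.\<close>

definition newton_const :: "'a::euclidean_space itself \<Rightarrow> real" where
  "newton_const _ = Gamma (DIM('a) / 2 - 1) / (2 * pi powr (DIM('a) / 2))"

lemma newton_const_pos:
  assumes "DIM('a::euclidean_space) \<ge> 3"
  shows "newton_const TYPE('a) > 0"
  using assms by (auto simp: newton_const_def intro!: divide_pos_pos Gamma_real_pos)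

lemma newton_kernel_ge:
  fixes x y :: "'a::euclidean_space"
  assumes "DIM('a) \<ge> 3" "norm (x - y) \<le> R" "R > 0"
  shows "ennreal (newton_const TYPE('a) / R ^ (DIM('a) - 2)) \<le> newton_kernel x y"
proof (cases "x = y")
  case False
  have "newton_const TYPE('a) / R ^ (DIM('a) - 2)
      \<le> newton_const TYPE('a) / norm (x - y) ^ (DIM('a) - 2)"
    using newton_const_pos[OF assms(1)] assms False
    by (intro divide_left_mono power_mono mult_pos_pos zero_less_power) auto
  then show ?thesis
    using False unfolding newton_kernel_def newton_const_def by (simp add: ennreal_leI)
qed (simp add: newton_kernel_def)

lemma measurable_newton_kernel [measurable]:
  "(\<lambda>(x :: 'a::euclidean_space, y). newton_kernel x y) \<in> borel_measurable (borel \<Otimes>\<^sub>M borel)"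
  unfolding newton_kernel_def by measurable

definition energy :: "'a::euclidean_space measure \<Rightarrow> 'a set \<Rightarrow> ennreal" where
  "energy \<nu> A = (\<integral>\<^sup>+x\<in>A. (\<integral>\<^sup>+y\<in>A. newton_kernel x y \<partial>\<nu>) \<partial>\<nu>)"

text \<open>Quantifying over all finite measures and all Borel subsets makes this form of
  \<open>cap A \<le> c\<close> hereditary and free of normalisations.\<close>

definition capacity_bound :: "'a::euclidean_space set \<Rightarrow> real \<Rightarrow> bool" where
  "capacity_bound A c \<longleftrightarrow> 0 \<le> c \<and> (\<forall>\<nu> A'. finite_measure \<nu> \<longrightarrow> sets \<nu> = sets borel \<longrightarrow>
     A' \<in> sets borel \<longrightarrow> A' \<subseteq> A \<longrightarrow> (emeasure \<nu> A')\<^sup>2 \<le> ennreal c * energy \<nu> A')"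

lemma ennreal_inverse_antimono: "a \<le> b \<Longrightarrow> inverse b \<le> inverse (a :: ennreal)"
  by (cases a rule: ennreal_cases; cases b rule: ennreal_cases; cases "a = 0")
     (auto simp: inverse_ennreal less_le top_unique intro!: ennreal_leI le_imp_inverse_le)

lemma newton_capacity_le:
  fixes A :: "'a::euclidean_space set"
  assumes "capacity_bound A c" "A \<in> sets borel"
  shows "newton_capacity A \<le> ennreal c"
proof -
  have "inverse (ennreal c) \<le> energy \<nu> A" if "\<nu> \<in> prob_measures_on A" for \<nu>
  proof -
    from that interpret prob_space \<nu> by (simp add: prob_measures_on_def)
    have "finite_measure \<nu>" by unfold_locales
    then have "(emeasure \<nu> A)\<^sup>2 \<le> ennreal c * energy \<nu> A"
      using assms that unfolding capacity_bound_def prob_measures_on_def by blast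
    then have "1 \<le> ennreal c * energy \<nu> A"
      using that by (simp add: prob_measures_on_def)
    \<comment> \<open>For \<open>c = 0\<close> the right-hand side is 0 even at infinite energy, as
      \<open>0 * \<infinity> = 0\<close>; hence no probability measure lives on \<open>A\<close> in
      that case.\<close>
    moreover have c: "0 < c"
    proof (rule ccontr)
      assume "\<not> 0 < c"
      then have "ennreal c = 0" by (simp add: ennreal_neg)
      then show False using calculation by simp
    qed
    ultimately have "inverse (ennreal c) * 1 \<le> inverse (ennreal c) * (ennreal c * energy \<nu> A)"
      by (intro mult_left_mono) auto
    also have "\<dots> = energy \<nu> A"
      using c by (simp add: mult.assoc[symmetric] inverse_ennreal ennreal_mult[symmetric])
    finally show ?thesis by simp
  qed
  then have "inverse (ennreal c) \<le> (INF \<nu>\<in>prob_measures_on A. energy \<nu> A)"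
    by (rule INF_greatest)
  then have "newton_capacity A \<le> inverse (inverse (ennreal c))"
    unfolding newton_capacity_def energy_def[symmetric] by (rule ennreal_inverse_antimono)
  then show ?thesis
    using assms(1) by (cases "c = 0") (simp_all add: capacity_bound_def inverse_ennreal)
qed

text \<open>The squares \<open>D i \<times> D i\<close> are disjoint parts of
  \<open>A \<times> A\<close> and the kernel is nonnegative, so only the interaction between
  different pieces is dropped.\<close>

lemma sum_energy_le:
  fixes A :: "'a::euclidean_space set"
  assumes "finite_measure \<nu>" and sets[measurable_cong]: "sets \<nu> = sets borel"
    and [measurable]: "\<And>i. i \<in> I \<Longrightarrow> D i \<in> sets borel" "A \<in> sets borel"
    and "finite I" and disj: "disjoint_family_on D I" and sub: "\<And>i. i \<in> I \<Longrightarrow> D i \<subseteq> A"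
  shows "(\<Sum>i\<in>I. energy \<nu> (D i)) \<le> energy \<nu> A"
proof -
  interpret finite_measure \<nu> by fact
  have ind: "(\<Sum>i\<in>I. indicator (D i) y * indicator (D i) x) \<le> (indicator A y * indicator A x :: ennreal)"
    for x y
  proof (cases "\<exists>i\<in>I. x \<in> D i \<and> y \<in> D i")
    case True
    then obtain i where i: "i \<in> I" "x \<in> D i" "y \<in> D i" by auto
    have "indicator (D j) y * indicator (D j) x = (0::ennreal)" if "j \<in> I - {i}" for j
    proof -
      have "D i \<inter> D j = {}" using disj i(1) that by (auto simp: disjoint_family_on_def)
      then show ?thesis using i(2,3) by (cases "x \<in> D j") auto
    qed
    then have "(\<Sum>j\<in>I - {i}. indicator (D j) y * indicator (D j) x) = (0::ennreal)"
      by (intro sum.neutral) blast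
    then have "(\<Sum>j\<in>I. indicator (D j) y * indicator (D j) x) = (indicator (D i) y * indicator (D i) x :: ennreal)"
      using \<open>finite I\<close> i(1) by (subst sum.remove[of I i]) (simp_all del: sum_mult_indicator mult_eq_0_iff sum_eq_0_iff)
    also have "\<dots> \<le> indicator A y * indicator A x"
      using i sub by (auto simp: indicator_def)
    finally show ?thesis .
  next
    case False
    then have "(\<Sum>i\<in>I. indicator (D i) y * indicator (D i) x) = (0::ennreal)"
      by (intro sum.neutral) (auto simp: indicator_def)
    then show ?thesis by simp
  qed
  have "(\<Sum>i\<in>I. energy \<nu> (D i)) =
      (\<integral>\<^sup>+x. (\<integral>\<^sup>+y. (\<Sum>i\<in>I. newton_kernel x y * indicator (D i) y * indicator (D i) x) \<partial>\<nu>) \<partial>\<nu>)"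
    unfolding energy_def
    by (subst nn_integral_sum nn_integral_multc[symmetric], simp, measurable)+ (simp add: nn_integral_sum nn_integral_multc)
  also have "\<dots> = (\<integral>\<^sup>+x. (\<integral>\<^sup>+y. newton_kernel x y * (\<Sum>i\<in>I. indicator (D i) y * indicator (D i) x) \<partial>\<nu>) \<partial>\<nu>)"
    by (simp add: sum_distrib_left mult.assoc)
  also have "\<dots> \<le> (\<integral>\<^sup>+x. (\<integral>\<^sup>+y. newton_kernel x y * (indicator A y * indicator A x) \<partial>\<nu>) \<partial>\<nu>)"
    by (intro nn_integral_mono mult_left_mono ind) auto
  also have "\<dots> = energy \<nu> A"
    unfolding energy_def by (simp add: nn_integral_multc mult.assoc[symmetric])
  finally show ?thesis .
qed

text \<open>Cauchy--Schwarz for the products \<open>sqrt (c i) * sqrt (e i)\<close>, with infinite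
  total energy treated apart.\<close>

lemma sum_square_le_ennreal:
  fixes a :: "'i \<Rightarrow> ennreal"
  assumes "finite I" "\<And>i. i \<in> I \<Longrightarrow> 0 \<le> c i" "\<And>i. i \<in> I \<Longrightarrow> a i \<noteq> \<infinity>"
    and le: "\<And>i. i \<in> I \<Longrightarrow> (a i)\<^sup>2 \<le> ennreal (c i) * e i"
  shows "(\<Sum>i\<in>I. a i)\<^sup>2 \<le> ennreal (\<Sum>i\<in>I. c i) * (\<Sum>i\<in>I. e i)"
proof (cases "(\<Sum>i\<in>I. e i) = \<infinity>")
  case True
  show ?thesis
  proof (cases "(\<Sum>i\<in>I. c i) = 0")
    case c0: True
    \<comment> \<open>As \<open>0 * \<infinity> = 0\<close>, infinite energy is no help when all
      constants vanish; the hypothesis then forces every \<open>a i\<close> to be 0.\<close>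
    have "a i = 0" if "i \<in> I" for i
    proof -
      have "c i = 0" using c0 that assms(1,2) by (simp add: sum_nonneg_eq_0_iff)
      then show ?thesis using le[OF that] by simp
    qed
    then show ?thesis by simp
  next
    case False
    then have "0 < (\<Sum>i\<in>I. c i)" using assms(2) by (simp add: less_le sum_nonneg)
    then show ?thesis using True by (simp add: ennreal_mult_top)
  qed
next
  case False
  then have fin: "e i \<noteq> \<infinity>" if "i \<in> I" for i
    using that \<open>finite I\<close> by auto
  define a' where "a' i = enn2real (a i)" for i
  define e' where "e' i = enn2real (e i)" for i
  have a': "a i = ennreal (a' i)" if "i \<in> I" for i
    using assms(3)[OF that] by (simp add: a'_def ennreal_enn2real_if)
  have e': "e i = ennreal (e' i)" if "i \<in> I" for i
    using fin[OF that] by (simp add: e'_def ennreal_enn2real_if)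
  have nonneg: "0 \<le> a' i" "0 \<le> e' i" for i by (simp_all add: a'_def e'_def)
  have le': "a' i \<le> sqrt (c i) * sqrt (e' i)" if "i \<in> I" for i
  proof -
    have "ennreal ((a' i)\<^sup>2) \<le> ennreal (c i * e' i)"
      using le[OF that] a'[OF that] e'[OF that] assms(2)[OF that] nonneg
      by (simp add: ennreal_power ennreal_mult)
    then have "(a' i)\<^sup>2 \<le> c i * e' i"
      using nonneg assms(2)[OF that] by (subst (asm) ennreal_le_iff) auto
    then show ?thesis
      by (simp add: real_le_rsqrt real_sqrt_mult[symmetric])
  qed
  have "(\<Sum>i\<in>I. a' i)\<^sup>2 \<le> (\<Sum>i\<in>I. sqrt (c i) * sqrt (e' i))\<^sup>2"
    using le' nonneg by (intro power_mono sum_mono sum_nonneg) auto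
  also have "\<dots> \<le> (\<Sum>i\<in>I. (sqrt (c i))\<^sup>2) * (\<Sum>i\<in>I. (sqrt (e' i))\<^sup>2)"
    by (rule Cauchy_Schwarz_ineq_sum)
  also have "\<dots> = (\<Sum>i\<in>I. c i) * (\<Sum>i\<in>I. e' i)"
    using assms(2) nonneg by (simp add: less_imp_le)
  finally have *: "(\<Sum>i\<in>I. a' i)\<^sup>2 \<le> (\<Sum>i\<in>I. c i) * (\<Sum>i\<in>I. e' i)" .
  have "(\<Sum>i\<in>I. a i)\<^sup>2 = ennreal ((\<Sum>i\<in>I. a' i)\<^sup>2)"
    using a' nonneg by (simp add: sum_ennreal ennreal_power[symmetric] sum_nonneg)
  also have "\<dots> \<le> ennreal ((\<Sum>i\<in>I. c i) * (\<Sum>i\<in>I. e' i))"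
    using * by (rule ennreal_leI)
  also have "\<dots> = ennreal (\<Sum>i\<in>I. c i) * (\<Sum>i\<in>I. e i)"
    using e' nonneg assms(2) by (simp add: sum_ennreal ennreal_mult sum_nonneg less_imp_le)
  finally show ?thesis .
qed

text \<open>Heredity pays off here: \<open>A'\<close> is cut into disjoint
  \<open>D i \<subseteq> A i\<close>, and the same \<open>\<nu>\<close> is tested on every
  \<open>D i\<close>. Cauchy--Schwarz adds the constants and \<open>sum_energy_le\<close> adds the
  energies, so no equilibrium measure is involved.\<close>

lemma capacity_bound_UN:
  fixes A :: "nat \<Rightarrow> 'a::euclidean_space set"
  assumes "\<And>i. i < n \<Longrightarrow> capacity_bound (A i) (c i)" "\<And>i. i < n \<Longrightarrow> A i \<in> sets borel"
  shows "capacity_bound (\<Union>i<n. A i) (\<Sum>i<n. c i)"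
  unfolding capacity_bound_def
proof (intro conjI allI impI)
  have c: "0 \<le> c i" if "i < n" for i using assms(1)[OF that] by (simp add: capacity_bound_def)
  then show "0 \<le> (\<Sum>i<n. c i)" by (intro sum_nonneg) auto
  fix \<nu> :: "'a measure" and A'
  assume \<nu>: "finite_measure \<nu>" "sets \<nu> = sets borel" and A': "A' \<in> sets borel" "A' \<subseteq> (\<Union>i<n. A i)"
  interpret finite_measure \<nu> by fact
  define D where "D i = A' \<inter> disjointed A i" for i
  have D_borel: "D i \<in> sets borel" if "i < n" for i
    unfolding D_def disjointed_def using A' assms(2) that
    by (intro sets.Int sets.Diff sets.finite_UN) auto
  have D_sub: "D i \<subseteq> A i" for i by (auto simp: D_def disjointed_def)
  have D_disj: "disjoint_family_on D {..<n}"
    using disjoint_family_disjointed[of A] by (auto simp: disjoint_family_on_def D_def)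
  have D_un: "(\<Union>i<n. D i) = A'"
    using A'(2) finite_UN_disjointed_eq[of A n] by (auto simp: D_def atLeast0LessThan)
  have "(emeasure \<nu> A')\<^sup>2 = (\<Sum>i<n. emeasure \<nu> (D i))\<^sup>2"
    using D_borel \<nu>(2) D_disj by (subst sum_emeasure) (auto simp: D_un)
  also have "\<dots> \<le> ennreal (\<Sum>i<n. c i) * (\<Sum>i<n. energy \<nu> (D i))"
    using c D_borel D_sub assms(1) \<nu>
    by (intro sum_square_le_ennreal) (auto simp: capacity_bound_def)
  also have "\<dots> \<le> ennreal (\<Sum>i<n. c i) * energy \<nu> A'"
    using D_borel D_disj A' \<nu> by (intro mult_left_mono sum_energy_le) (auto simp flip: D_def, auto simp: D_def)
  finally show "(emeasure \<nu> A')\<^sup>2 \<le> ennreal (\<Sum>i<n. c i) * energy \<nu> A'" .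
qed

lemma capacity_bound_Un:
  fixes A1 :: "'a::euclidean_space set"
  assumes "capacity_bound A1 c1" "capacity_bound A2 c2" "A1 \<in> sets borel" "A2 \<in> sets borel"
  shows "capacity_bound (A1 \<union> A2) (c1 + c2)"
proof -
  have "(\<Union>i<2. (if i = (0::nat) then A1 else A2)) = A1 \<union> A2"
    by (auto simp: numeral_2_eq_2 lessThan_Suc)
  moreover have "(\<Sum>i<2. (if i = (0::nat) then c1 else c2)) = c1 + c2"
    by (auto simp: numeral_2_eq_2 lessThan_Suc)
  ultimately show ?thesis
    using capacity_bound_UN[of 2 "\<lambda>i. if i = (0::nat) then A1 else A2" "\<lambda>i. if i = (0::nat) then c1 else c2"] assms
    by auto
qed

lemma capacity_bound_subset: "capacity_bound A c \<Longrightarrow> B \<subseteq> A \<Longrightarrow> capacity_bound B c"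
  unfolding capacity_bound_def by (meson order_trans)

lemma capacity_bound_empty: "capacity_bound {} 0"
  by (simp add: capacity_bound_def)

lemma emeasure_square_eq:
  assumes "finite_measure \<nu>" "A' \<in> sets \<nu>"
  shows "(\<integral>\<^sup>+x. (\<integral>\<^sup>+y. k * indicator A' y \<partial>\<nu>) * indicator A' x \<partial>\<nu>) = k * (emeasure \<nu> A')\<^sup>2"
  using assms by (simp add: nn_integral_cmult nn_integral_multc power2_eq_square mult.assoc)

text \<open>Two points of the ball are less than \<open>2 * R\<close> apart, which bounds the kernel
  from below. The loss against the exact capacity is the harmless factor
  \<open>2 ^ (DIM('a) - 2)\<close>.\<close>

lemma capacity_bound_ball:
  fixes z :: "'a::euclidean_space"
  assumes "DIM('a) \<ge> 3" "R > 0"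
  shows "capacity_bound (ball z R) ((2 * R) ^ (DIM('a) - 2) / newton_const TYPE('a))"
  unfolding capacity_bound_def
proof (intro conjI allI impI)
  let ?c = "(2 * R) ^ (DIM('a) - 2) / newton_const TYPE('a)"
  have c: "0 < ?c" using newton_const_pos[OF assms(1)] assms(2) by simp
  then show "0 \<le> ?c" by simp
  fix \<nu> :: "'a measure" and A'
  assume \<nu>: "finite_measure \<nu>" "sets \<nu> = sets borel" and A': "A' \<in> sets borel" "A' \<subseteq> ball z R"
  have "ennreal (1 / ?c) * (emeasure \<nu> A')\<^sup>2
      = (\<integral>\<^sup>+x\<in>A'. (\<integral>\<^sup>+y\<in>A'. ennreal (1 / ?c) \<partial>\<nu>) \<partial>\<nu>)"
    using \<nu> A' by (simp add: emeasure_square_eq)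
  also have "\<dots> = (\<integral>\<^sup>+x\<in>A'. (\<integral>\<^sup>+y\<in>A'. ennreal (1 / ?c) * indicator A' x \<partial>\<nu>) \<partial>\<nu>)"
    by (intro nn_integral_cong) (auto simp: indicator_def)
  also have "\<dots> \<le> (\<integral>\<^sup>+x\<in>A'. (\<integral>\<^sup>+y\<in>A'. newton_kernel x y \<partial>\<nu>) \<partial>\<nu>)"
  proof (rule nn_integral_mono, rule mult_right_mono, rule nn_integral_mono)
    fix x y :: 'a
    have "ennreal (1 / ?c) \<le> newton_kernel x y" if "x \<in> A'" "y \<in> A'"
    proof -
      have "dist x y < 2 * R"
        using that A'(2) dist_triangle_less_add[of x z R y R] by (auto simp: dist_commute subset_eq)
      then show ?thesis
        using newton_kernel_ge[OF assms(1), of x y "2 * R"] assms(2) by (simp add: dist_norm)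
    qed
    then show "ennreal (1 / ?c) * indicator A' x * indicator A' y \<le> newton_kernel x y * indicator A' y"
      by (auto simp: indicator_def)
  qed auto
  finally have "ennreal ?c * (ennreal (1 / ?c) * (emeasure \<nu> A')\<^sup>2) \<le> ennreal ?c * energy \<nu> A'"
    unfolding energy_def by (intro mult_left_mono) auto
  moreover have "ennreal ?c * (ennreal (1 / ?c) * (emeasure \<nu> A')\<^sup>2) = (emeasure \<nu> A')\<^sup>2"
  proof -
    have "ennreal ?c * ennreal (1 / ?c) = ennreal (?c * (1 / ?c))"
      using c by (intro ennreal_mult[symmetric]) (simp_all only: less_imp_le zero_le_divide_1_iff)
    also have "?c * (1 / ?c) = 1" using c by (metis less_irrefl nonzero_mult_div_cancel_left times_divide_eq_right mult.right_neutral)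
    finally show ?thesis by (simp add: mult.assoc[symmetric] del: ennreal_1) simp
  qed
  ultimately show "(emeasure \<nu> A')\<^sup>2 \<le> ennreal ?c * energy \<nu> A'" by simp
qed

section \<open>Gaussian integrals\<close>

definition gauss :: "real \<Rightarrow> 'a::euclidean_space measure" where
  "gauss v = density lborel (\<lambda>x. ennreal (\<Prod>b\<in>Basis. normal_density 0 (sqrt v) (x \<bullet> b)))"

lemma sets_gauss [simp, measurable_cong]: "sets (gauss v) = sets borel"
  by (simp add: gauss_def)

lemma space_gauss [simp]: "space (gauss v) = UNIV"
  by (simp add: gauss_def)

lemma exp_normsq_eq_prod:
  fixes x :: "'a::euclidean_space"
  shows "exp (a * (norm x)\<^sup>2) = (\<Prod>b\<in>Basis. exp (a * (x \<bullet> b)\<^sup>2))"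
proof -
  have "(norm x)\<^sup>2 = (\<Sum>b\<in>Basis. (x \<bullet> b)\<^sup>2)"
    unfolding power2_norm_eq_inner by (subst euclidean_inner) (simp add: power2_eq_square)
  then show ?thesis by (simp add: exp_sum[symmetric] sum_distrib_left)
qed

text \<open>Completing the square leaves a constant times a normal density of variance
  \<open>v / w\<close> with \<open>w = 1 - 2 * a * v\<close>. Both signs of \<open>a\<close> occur
  later: negative for the cutoff kernel, positive for moments.\<close>

lemma nn_integral_exp_square_normal_density:
  assumes "v > 0" "2 * a * v < 1"
  shows "(\<integral>\<^sup>+x. ennreal (exp (a * (y + x)\<^sup>2) * normal_density 0 (sqrt v) x) \<partial>lborel)
       = ennreal (1 / sqrt (1 - 2 * a * v) * exp (a * y\<^sup>2 / (1 - 2 * a * v)))"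
proof -
  define w where "w = 1 - 2 * a * v"
  have w: "w > 0" using assms by (simp add: w_def)
  have eq: "exp (a * (y + x)\<^sup>2) * normal_density 0 (sqrt v) x
      = (1 / sqrt w * exp (a * y\<^sup>2 / w)) * normal_density (2 * a * v * y / w) (sqrt (v / w)) x" for x
  proof -
    have "a * (y + x)\<^sup>2 - x\<^sup>2 / (2 * v) = a * y\<^sup>2 / w - (x - 2 * a * v * y / w)\<^sup>2 / (2 * (v / w))"
    proof -
      have "(x - 2 * a * v * y / w)\<^sup>2 / (2 * (v / w)) = (w * x - 2 * a * v * y)\<^sup>2 / (2 * v * w)"
        using w assms by (simp add: field_simps power2_eq_square)
      also have "(w * x - 2 * a * v * y)\<^sup>2 = w * (w * x\<^sup>2 - 4 * a * v * x * y) + 4 * a\<^sup>2 * v\<^sup>2 * y\<^sup>2"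
        by (simp add: power2_eq_square algebra_simps)
      also have "\<dots> / (2 * v * w) = (w * x\<^sup>2 - 4 * a * v * x * y) / (2 * v) + 2 * a\<^sup>2 * v * y\<^sup>2 / w"
        using w assms by (simp add: field_simps power2_eq_square)
      also have "2 * a\<^sup>2 * v * y\<^sup>2 / w = a * y\<^sup>2 / w - a * y\<^sup>2"
        using w by (simp add: field_simps) (simp add: w_def power2_eq_square algebra_simps)
      also have "(w * x\<^sup>2 - 4 * a * v * x * y) / (2 * v) = x\<^sup>2 / (2 * v) - a * x\<^sup>2 - 2 * a * x * y"
        using assms by (simp add: w_def field_simps)
      finally show ?thesis by (simp add: power2_eq_square algebra_simps)
    qed
    moreover have "1 / sqrt (2 * pi * v) = 1 / sqrt w * (1 / sqrt (2 * pi * (v / w)))"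
      using w assms by (simp add: real_sqrt_mult real_sqrt_divide)
    ultimately show ?thesis
      using w assms
      by (simp add: normal_density_def exp_add[symmetric] real_sqrt_pow2 mult.assoc mult.left_commute
          diff_conv_add_uminus[symmetric] del: real_sqrt_divide real_sqrt_mult)
  qed
  have "(\<integral>\<^sup>+x. ennreal (exp (a * (y + x)\<^sup>2) * normal_density 0 (sqrt v) x) \<partial>lborel)
      = (\<integral>\<^sup>+x. ennreal (1 / sqrt w * exp (a * y\<^sup>2 / w)) *
          ennreal (normal_density (2 * a * v * y / w) (sqrt (v / w)) x) \<partial>lborel)"
    unfolding eq using w by (subst ennreal_mult') auto
  also have "\<dots> = ennreal (1 / sqrt w * exp (a * y\<^sup>2 / w)) *
      (\<integral>\<^sup>+x. ennreal (normal_density (2 * a * v * y / w) (sqrt (v / w)) x) \<partial>lborel)"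
    by (rule nn_integral_cmult) measurable
  also have "(\<integral>\<^sup>+x. ennreal (normal_density (2 * a * v * y / w) (sqrt (v / w)) x) \<partial>lborel) = 1"
    using w assms by (simp add: nn_integral_eq_integral)
  finally show ?thesis by (simp add: w_def)
qed

lemma nn_integral_exp_normsq_gauss:
  fixes y :: "'a::euclidean_space"
  assumes "v > 0" "2 * a * v < 1"
  shows "(\<integral>\<^sup>+x. ennreal (exp (a * (norm (y + x))\<^sup>2)) \<partial>gauss v)
       = ennreal ((1 / sqrt (1 - 2 * a * v)) ^ DIM('a) * exp (a * (norm y)\<^sup>2 / (1 - 2 * a * v)))"
proof -
  define w where "w = 1 - 2 * a * v"
  have w: "w > 0" using assms by (simp add: w_def)
  have "(\<integral>\<^sup>+x. ennreal (exp (a * (norm (y + x))\<^sup>2)) \<partial>gauss v) =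
    (\<integral>\<^sup>+x. (\<Prod>b\<in>Basis. ennreal (exp (a * (y \<bullet> b + x \<bullet> b)\<^sup>2) * normal_density 0 (sqrt v) (x \<bullet> b))) \<partial>lborel)"
    unfolding gauss_def
    by (subst nn_integral_density)
       (auto simp: exp_normsq_eq_prod inner_add_left prod_ennreal prod.distrib prod_nonneg
         ennreal_mult[symmetric] mult.commute intro!: nn_integral_cong)
  also have "\<dots> = (\<Prod>b\<in>(Basis::'a set).
      (\<integral>\<^sup>+x. ennreal (exp (a * (y \<bullet> b + x)\<^sup>2) * normal_density 0 (sqrt v) x) \<partial>lborel))"
    by (rule nn_integral_lborel_prod) auto
  also have "\<dots> = (\<Prod>b\<in>(Basis::'a set). ennreal (1 / sqrt w * exp (a / w * (y \<bullet> b)\<^sup>2)))"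
    using assms by (simp add: nn_integral_exp_square_normal_density w_def)
  also have "\<dots> = ennreal ((1 / sqrt w) ^ DIM('a) * exp (a / w * (norm y)\<^sup>2))"
    using w by (subst prod_ennreal) (simp_all only: prod.distrib exp_normsq_eq_prod prod_constant, simp)
  finally show ?thesis by (simp add: w_def)
qed

lemma prob_space_gauss:
  assumes "v > 0"
  shows "prob_space (gauss v :: 'a::euclidean_space measure)"
proof
  show "emeasure (gauss v :: 'a measure) (space (gauss v)) = 1"
    using nn_integral_exp_normsq_gauss[of v 0 "0 :: 'a"] assms by simp
qed

lemma nn_integral_exp_normsq_lborel:
  assumes "s > 0"
  shows "(\<integral>\<^sup>+x. ennreal (exp (- s * (norm (x::'a::euclidean_space))\<^sup>2)) \<partial>lborel)
    = ennreal (sqrt (pi / s) ^ DIM('a))"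
proof -
  have eq: "exp (- s * x\<^sup>2) = sqrt (pi / s) * normal_density 0 (sqrt (1 / (2 * s))) x" for x
  proof -
    have "sqrt (pi / s) * (1 / sqrt (2 * pi * (1 / (2 * s)))) = 1" using assms by simp
    moreover have "(sqrt (1 / (2 * s)))\<^sup>2 = 1 / (2 * s)" using assms by simp
    ultimately show ?thesis
      using assms by (simp only: normal_density_def mult.assoc[symmetric]) (simp add: mult.commute)
  qed
  have "(\<integral>\<^sup>+x. ennreal (exp (- s * (norm (x::'a))\<^sup>2)) \<partial>lborel) =
    (\<integral>\<^sup>+(x::'a). (\<Prod>b\<in>Basis. ennreal (exp (- s * (x \<bullet> b)\<^sup>2))) \<partial>lborel)"
    unfolding exp_normsq_eq_prod by (simp add: prod_ennreal)
  also have "\<dots> = (\<Prod>b\<in>(Basis::'a set). (\<integral>\<^sup>+x. ennreal (exp (- s * x\<^sup>2)) \<partial>lborel))"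
    by (rule nn_integral_lborel_prod) auto
  also have "(\<integral>\<^sup>+x. ennreal (exp (- s * x\<^sup>2)) \<partial>lborel) = ennreal (sqrt (pi / s))"
  proof -
    have "(\<integral>\<^sup>+x. ennreal (exp (- s * x\<^sup>2)) \<partial>lborel) =
      ennreal (sqrt (pi / s)) * (\<integral>\<^sup>+x. ennreal (normal_density 0 (sqrt (1 / (2 * s))) x) \<partial>lborel)"
      unfolding eq using assms by (simp add: ennreal_mult' nn_integral_cmult)
    also have "(\<integral>\<^sup>+x. ennreal (normal_density 0 (sqrt (1 / (2 * s))) x) \<partial>lborel) = 1"
      using assms by (simp add: nn_integral_eq_integral)
    finally show ?thesis by simp
  qed
  finally show ?thesis using assms by (simp add: ennreal_power)
qed

text \<open>One term of the exponential series gives \<open>u ^ q \<le> fact q * exp u\<close> for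
  \<open>u = (norm x)^2 / (4 * v)\<close>. With this scaling \<open>1 - 2 * a * v\<close> is 1/2, so
  each coordinate contributes a factor \<open>sqrt 2\<close>.\<close>

lemma nn_integral_norm_power_gauss_le:
  assumes "v > 0"
  shows "(\<integral>\<^sup>+x. ennreal (norm (x::'a::euclidean_space) ^ (2 * q)) \<partial>gauss v)
    \<le> ennreal (fact q * 4 ^ q * sqrt 2 ^ DIM('a) * v ^ q)"
proof -
  have le: "norm x ^ (2 * q) \<le> fact q * (4 * v) ^ q * exp (1 / (4 * v) * (norm (0 + x))\<^sup>2)" for x :: 'a
  proof -
    define u where "u = (norm x)\<^sup>2 / (4 * v)"
    have u: "u \<ge> 0" using assms by (simp add: u_def)
    have "(\<Sum>n\<in>{q}. u ^ n /\<^sub>R fact n) \<le> (\<Sum>n. u ^ n /\<^sub>R fact n)"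
      using u by (intro sum_le_suminf summable_exp_generic) auto
    then have "u ^ q / fact q \<le> exp u" by (simp add: exp_def divide_inverse mult.commute)
    then have "u ^ q \<le> fact q * exp u" by (simp add: field_simps)
    then have "(4 * v) ^ q * u ^ q \<le> (4 * v) ^ q * (fact q * exp u)"
      using assms by (intro mult_left_mono) auto
    moreover have "norm x ^ (2 * q) = (4 * v) ^ q * u ^ q"
    proof -
      have "(norm x)\<^sup>2 = 4 * v * u" using assms by (simp add: u_def)
      then show ?thesis by (simp only: power_mult power_mult_distrib)
    qed
    moreover have "exp u = exp (1 / (4 * v) * (norm (0 + x))\<^sup>2)" by (simp add: u_def)
    ultimately show ?thesis by (simp add: mult.assoc mult.left_commute)
  qed
  have "(\<integral>\<^sup>+x. ennreal (norm (x::'a) ^ (2 * q)) \<partial>gauss v)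
     \<le> (\<integral>\<^sup>+x. ennreal (fact q * (4 * v) ^ q) * ennreal (exp (1 / (4 * v) * (norm (0 + x :: 'a))\<^sup>2)) \<partial>gauss v)"
    using assms le by (intro nn_integral_mono) (simp add: ennreal_mult[symmetric] ennreal_leI)
  also have "\<dots> = ennreal (fact q * (4 * v) ^ q) * ennreal ((1 / sqrt (1 - 1 / 2)) ^ DIM('a))"
    using assms by (subst nn_integral_cmult, simp, subst nn_integral_exp_normsq_gauss) auto
  also have "\<dots> = ennreal (fact q * 4 ^ q * sqrt 2 ^ DIM('a) * v ^ q)"
  proof -
    have "1 / sqrt (1 - 1 / 2) = sqrt 2" by (simp add: real_sqrt_divide)
    moreover have "fact q * (4 * v) ^ q * sqrt 2 ^ DIM('a) = fact q * 4 ^ q * sqrt 2 ^ DIM('a) * v ^ q"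
      by (simp add: power_mult_distrib)
    ultimately show ?thesis
      using assms by (simp only:) (subst ennreal_mult[symmetric], auto)
  qed
  finally show ?thesis .
qed

section \<open>A positive definite minorant of the Newton kernel in dimension four\<close>

text \<open>The kernel factors through \<open>h\<close>, so \<open>\<nu>\<close> and the point
  masses at the \<open>p j\<close> have images \<open>F\<close> and \<open>P\<close> in L^2 of
  \<open>\<kappa>\<close>. By Fubini the three quantities are the inner products of \<open>F\<close>
  with \<open>P\<close>, \<open>P\<close> with \<open>P\<close> and \<open>F\<close> with
  \<open>F\<close>.\<close>

lemma Cauchy_Schwarz_positive_definite:
  fixes h :: "'b \<Rightarrow> 'a \<Rightarrow> ennreal"
  assumes "sigma_finite_measure \<kappa>" "sigma_finite_measure \<nu>"
    and [measurable]: "(\<lambda>(a, x). h a x) \<in> borel_measurable (\<kappa> \<Otimes>\<^sub>M \<nu>)"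
    and p: "\<And>j. j < n \<Longrightarrow> p j \<in> space \<nu>"
    and k: "\<And>x y. k x y = (\<integral>\<^sup>+a. h a x * h a y \<partial>\<kappa>)"
  shows "(\<integral>\<^sup>+x. (\<Sum>j<n. k x (p j)) \<partial>\<nu>)\<^sup>2
    \<le> (\<Sum>i<n. \<Sum>j<n. k (p i) (p j)) * (\<integral>\<^sup>+x. (\<integral>\<^sup>+y. k x y \<partial>\<nu>) \<partial>\<nu>)"
proof -
  interpret \<kappa>: sigma_finite_measure \<kappa> by fact
  interpret \<nu>: sigma_finite_measure \<nu> by fact
  interpret pair_sigma_finite \<kappa> \<nu> ..
  have [measurable]: "(\<lambda>a. h a (p j)) \<in> borel_measurable \<kappa>" if "j < n" for j
    using p[OF that] by measurable
  have [measurable]: "(\<lambda>x. h a x) \<in> borel_measurable \<nu>" if "a \<in> space \<kappa>" for a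
    using that by measurable
  have [measurable]: "(\<lambda>a. h a x) \<in> borel_measurable \<kappa>" if "x \<in> space \<nu>" for x
    using that by measurable
  define F where "F a = (\<integral>\<^sup>+x. h a x \<partial>\<nu>)" for a
  define P where "P a = (\<Sum>j<n. h a (p j))" for a
  have [measurable]: "F \<in> borel_measurable \<kappa>" "P \<in> borel_measurable \<kappa>"
    unfolding F_def P_def by measurable
  have FP: "(\<integral>\<^sup>+a. F a * P a \<partial>\<kappa>) = (\<integral>\<^sup>+x. (\<Sum>j<n. k x (p j)) \<partial>\<nu>)"
  proof -
    have "(\<integral>\<^sup>+a. F a * P a \<partial>\<kappa>) = (\<integral>\<^sup>+a. (\<integral>\<^sup>+x. (\<Sum>j<n. h a x * h a (p j)) \<partial>\<nu>) \<partial>\<kappa>)"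
      unfolding F_def P_def
      by (intro nn_integral_cong) (simp add: sum_distrib_left[symmetric] nn_integral_multc)
    also have "\<dots> = (\<integral>\<^sup>+x. (\<integral>\<^sup>+a. (\<Sum>j<n. h a x * h a (p j)) \<partial>\<kappa>) \<partial>\<nu>)"
      by (rule Fubini'[symmetric]) measurable
    also have "\<dots> = (\<integral>\<^sup>+x. (\<Sum>j<n. k x (p j)) \<partial>\<nu>)"
      unfolding k by (intro nn_integral_cong nn_integral_sum) simp
    finally show ?thesis .
  qed
  have PP: "(\<integral>\<^sup>+a. (P a)\<^sup>2 \<partial>\<kappa>) = (\<Sum>i<n. \<Sum>j<n. k (p i) (p j))"
    unfolding P_def k power2_eq_square sum_product
    by (subst nn_integral_sum) (auto intro!: sum.cong nn_integral_sum)
  have FF: "(\<integral>\<^sup>+a. (F a)\<^sup>2 \<partial>\<kappa>) = (\<integral>\<^sup>+x. (\<integral>\<^sup>+y. k x y \<partial>\<nu>) \<partial>\<nu>)"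
  proof -
    have "(\<integral>\<^sup>+a. (F a)\<^sup>2 \<partial>\<kappa>) = (\<integral>\<^sup>+a. (\<integral>\<^sup>+x. (\<integral>\<^sup>+y. h a x * h a y \<partial>\<nu>) \<partial>\<nu>) \<partial>\<kappa>)"
      unfolding F_def power2_eq_square
      by (intro nn_integral_cong) (simp add: nn_integral_multc nn_integral_cmult)
    also have "\<dots> = (\<integral>\<^sup>+x. (\<integral>\<^sup>+a. (\<integral>\<^sup>+y. h a x * h a y \<partial>\<nu>) \<partial>\<kappa>) \<partial>\<nu>)"
      by (rule Fubini'[symmetric]) measurable
    also have "\<dots> = (\<integral>\<^sup>+x. (\<integral>\<^sup>+y. k x y \<partial>\<nu>) \<partial>\<nu>)"
      unfolding k by (intro nn_integral_cong Fubini'[symmetric]) measurable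
    finally show ?thesis .
  qed
  show ?thesis
    using Cauchy_Schwarz_nn_integral[of F \<kappa> P] by (simp add: FP PP FF mult.commute)
qed

text \<open>Closed form of the integral of exp (-s |x|^2) over s from 0 to 1 / v; the value at 0 is
  the continuous extension.\<close>

definition cutoff_kernel :: "real \<Rightarrow> 'a::euclidean_space \<Rightarrow> real" where
  "cutoff_kernel v x = (if x = 0 then 1 / v else (1 - exp (- (norm x)\<^sup>2 / v)) / (norm x)\<^sup>2)"

lemma measurable_cutoff_kernel [measurable]: "cutoff_kernel v \<in> borel_measurable borel"
  unfolding cutoff_kernel_def by measurable

lemma cutoff_kernel_minus [simp]: "cutoff_kernel v (- x) = cutoff_kernel v x"
  by (simp add: cutoff_kernel_def)

lemma cutoff_kernel_commute: "cutoff_kernel v (x - y) = cutoff_kernel v (y - x)"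
  using cutoff_kernel_minus[of v "x - y"] by simp

lemma cutoff_kernel_nonneg: "v > 0 \<Longrightarrow> 0 \<le> cutoff_kernel v x"
  by (simp add: cutoff_kernel_def)

lemma cutoff_kernel_le: 
  assumes "v > 0"
  shows "cutoff_kernel v x \<le> 1 / v"
proof (cases "x = 0")
  case False
  have "1 - exp (- ((norm x)\<^sup>2 / v)) \<le> (norm x)\<^sup>2 / v"
    using exp_ge_add_one_self[of "- ((norm x)\<^sup>2 / v)"] by linarith
  then show ?thesis
    using False assms by (simp add: cutoff_kernel_def field_simps)
qed (simp add: cutoff_kernel_def)

text \<open>Only a constant factor is lost, both sides being comparable to the minimum of 1 / v and
  1 / |x|^2. The rational minorant is easier to bound below along a path.\<close>

lemma cutoff_kernel_ge:
  assumes "v > 0"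
  shows "1 / (v + (norm x)\<^sup>2) \<le> cutoff_kernel v x"
proof (cases "x = 0")
  case False
  define u where "u = (norm x)\<^sup>2 / v"
  have u: "u > 0" using False assms by (simp add: u_def)
  have "exp (- u) \<le> 1 / (1 + u)"
    using exp_ge_add_one_self[of u] u by (simp add: exp_minus field_simps)
  then have "u / (1 + u) \<le> 1 - exp (- u)" using u by (simp add: field_simps)
  then have "u / (1 + u) / (norm x)\<^sup>2 \<le> (1 - exp (- u)) / (norm x)\<^sup>2"
    by (intro divide_right_mono) auto
  moreover have "u / (1 + u) / (norm x)\<^sup>2 = 1 / (v + (norm x)\<^sup>2)"
  proof -
    have "u / (1 + u) = (norm x)\<^sup>2 * (1 / (v + (norm x)\<^sup>2))"
      using assms by (simp add: u_def field_simps)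
    then show ?thesis using False by simp
  qed
  ultimately show ?thesis using False by (simp add: cutoff_kernel_def u_def)
qed (simp add: cutoff_kernel_def)

lemma cutoff_kernel_le_newton_kernel:
  fixes x y :: "'a::euclidean_space"
  assumes "DIM('a) = 4"
  shows "ennreal (newton_const TYPE('a) * cutoff_kernel v (x - y)) \<le> newton_kernel x y"
proof (cases "x = y")
  case False
  have "newton_const TYPE('a) * cutoff_kernel v (x - y) \<le> newton_const TYPE('a) * (1 / (norm (x - y))\<^sup>2)"
    using False newton_const_pos[where 'a='a] assms
    by (intro mult_left_mono) (auto simp: cutoff_kernel_def intro!: divide_right_mono)
  then show ?thesis
    using False assms unfolding newton_kernel_def newton_const_def by (simp add: ennreal_leI)
qed (simp add: newton_kernel_def)

text \<open>Factorising the Gaussians needs \<open>s > 0\<close>, while the fundamental theorem of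
  calculus is applied on closed intervals.\<close>

lemma nn_integral_open_Icc:
  fixes f :: "real \<Rightarrow> ennreal"
  shows "(\<integral>\<^sup>+s\<in>{0<..b}. f s \<partial>lborel) = (\<integral>\<^sup>+s\<in>{0..b}. f s \<partial>lborel)"
  by (intro nn_integral_cong_AE, use AE_lborel_singleton[of 0] in eventually_elim)
     (auto simp: indicator_def)

lemma cutoff_kernel_eq_nn_integral:
  assumes "v > 0"
  shows "ennreal (cutoff_kernel v x) = (\<integral>\<^sup>+s\<in>{0<..1 / v}. ennreal (exp (- s * (norm x)\<^sup>2)) \<partial>lborel)"
proof (cases "x = 0")
  case True
  then show ?thesis using assms by (simp add: cutoff_kernel_def)
next
  case False
  define a where "a = (norm x)\<^sup>2"
  have a: "a > 0" using False by (simp add: a_def)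
  have "(\<integral>\<^sup>+s. ennreal (exp (- s * a)) * indicator {0..1 / v} s \<partial>lborel)
      = ennreal (- exp (- (1 / v) * a) / a - (- exp (- 0 * a) / a))"
    using a assms by (intro nn_integral_FTC_Icc) (auto intro!: derivative_eq_intros)
  also have "\<dots> = ennreal (cutoff_kernel v x)"
    using False a by (simp add: cutoff_kernel_def a_def[symmetric] diff_divide_distrib)
  finally show ?thesis by (simp add: nn_integral_open_Icc a_def)
qed

text \<open>Up to a constant, a Gaussian is the convolution of a sharper one with itself.
  Translating \<open>z\<close> by the midpoint of \<open>x\<close> and \<open>y\<close> separates
  the variables through the parallelogram identity.\<close>

lemma nn_integral_exp_normsq_convolution:
  fixes x y :: "'a::euclidean_space"
  assumes "s > 0"
  shows "(\<integral>\<^sup>+z. ennreal (exp (- 2 * s * (norm (x - z))\<^sup>2) * exp (- 2 * s * (norm (y - z))\<^sup>2)) \<partial>lborel)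
    = ennreal (sqrt (pi / (4 * s)) ^ DIM('a) * exp (- s * (norm (x - y))\<^sup>2))"
proof -
  define m where "m = (1 / 2) *\<^sub>R (x + y)"
  have parallelogram: "2 * (norm (x - (m + z)))\<^sup>2 + 2 * (norm (y - (m + z)))\<^sup>2 = (norm (x - y))\<^sup>2 + 4 * (norm z)\<^sup>2" for z
    unfolding m_def power2_norm_eq_inner
    by (simp add: algebra_simps inner_commute inner_simps)
  have "(\<integral>\<^sup>+z. ennreal (exp (- 2 * s * (norm (x - z))\<^sup>2) * exp (- 2 * s * (norm (y - z))\<^sup>2)) \<partial>lborel)
    = (\<integral>\<^sup>+z. ennreal (exp (- 2 * s * (norm (x - z))\<^sup>2) * exp (- 2 * s * (norm (y - z))\<^sup>2)) \<partial>distr lborel borel ((+) m))"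
    by (simp add: lborel_distr_plus)
  also have "\<dots> = (\<integral>\<^sup>+z. ennreal (exp (- 2 * s * (norm (x - (m + z)))\<^sup>2) * exp (- 2 * s * (norm (y - (m + z)))\<^sup>2)) \<partial>lborel)"
    by (subst nn_integral_distr) auto
  also have "\<dots> = (\<integral>\<^sup>+z. ennreal (exp (- s * (norm (x - y))\<^sup>2)) * ennreal (exp (- (4 * s) * (norm (z :: 'a))\<^sup>2)) \<partial>lborel)"
  proof (intro nn_integral_cong)
    fix z :: 'a
    have "- 2 * s * (norm (x - (m + z)))\<^sup>2 + - 2 * s * (norm (y - (m + z)))\<^sup>2
      = - s * (2 * (norm (x - (m + z)))\<^sup>2 + 2 * (norm (y - (m + z)))\<^sup>2)" by (simp add: algebra_simps)
    also have "\<dots> = - s * (norm (x - y))\<^sup>2 + - (4 * s) * (norm z)\<^sup>2"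
      unfolding parallelogram by (simp add: algebra_simps)
    finally show "ennreal (exp (- 2 * s * (norm (x - (m + z)))\<^sup>2) * exp (- 2 * s * (norm (y - (m + z)))\<^sup>2))
      = ennreal (exp (- s * (norm (x - y))\<^sup>2)) * ennreal (exp (- (4 * s) * (norm z)\<^sup>2))"
      by (simp only: exp_add[symmetric] ennreal_mult[symmetric] exp_ge_zero)
  qed
  also have "\<dots> = ennreal (exp (- s * (norm (x - y))\<^sup>2)) * ennreal (sqrt (pi / (4 * s)) ^ DIM('a))"
    using assms nn_integral_exp_normsq_lborel[of "4 * s", where 'a='a] by (simp add: nn_integral_cmult)
  finally show ?thesis using assms by (simp add: ennreal_mult mult.commute)
qed

text \<open>Each exp (-s |x - y|^2) is such a convolution, so the kernel factors over the pairs
  \<open>(s, z)\<close>; the weight \<open>1 / sqrt (c s)\<close> in \<open>h\<close> cancels the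
  constant of the convolution.\<close>

lemma cutoff_kernel_positive_definite:
  fixes \<nu> :: "'a::euclidean_space measure"
  assumes "finite_measure \<nu>" and [measurable_cong]: "sets \<nu> = sets borel" and v: "v > 0"
  shows "(\<integral>\<^sup>+x. (\<Sum>j<n. ennreal (cutoff_kernel v (x - p j))) \<partial>\<nu>)\<^sup>2
    \<le> (\<Sum>i<n. \<Sum>j<n. ennreal (cutoff_kernel v (p i - p j))) *
       (\<integral>\<^sup>+x. (\<integral>\<^sup>+y. ennreal (cutoff_kernel v (x - y)) \<partial>\<nu>) \<partial>\<nu>)"
proof -
  interpret finite_measure \<nu> by fact
  define c where "c s = sqrt (pi / (4 * s)) ^ DIM('a)" for s
  have c: "c s > 0" if "s > 0" for s using that by (simp add: c_def)
  define h where "h a x = (case a of (s, z) \<Rightarrow>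
      ennreal (1 / sqrt (c s) * exp (- 2 * s * (norm (x - z))\<^sup>2)) * indicator {0<..1 / v} s)" for a :: "real \<times> 'a" and x
  have [measurable]: "c \<in> borel_measurable borel" unfolding c_def by measurable
  have meas: "(\<lambda>(a, x). h a x) \<in> borel_measurable ((lborel \<Otimes>\<^sub>M lborel) \<Otimes>\<^sub>M \<nu>)"
    unfolding h_def by measurable
  have k: "ennreal (cutoff_kernel v (x - y)) = (\<integral>\<^sup>+a. h a x * h a y \<partial>(lborel \<Otimes>\<^sub>M lborel))" for x y
  proof -
    have [measurable]: "(\<lambda>a. h a x) \<in> borel_measurable (lborel \<Otimes>\<^sub>M lborel)" for x
      unfolding h_def by measurable
    have "(\<integral>\<^sup>+a. h a x * h a y \<partial>(lborel \<Otimes>\<^sub>M lborel)) = (\<integral>\<^sup>+s. (\<integral>\<^sup>+z. h (s, z) x * h (s, z) y \<partial>lborel) \<partial>lborel)"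
      by (rule lborel.nn_integral_fst[symmetric]) measurable
    also have "\<dots> = (\<integral>\<^sup>+s. ennreal (exp (- s * (norm (x - y))\<^sup>2)) * indicator {0<..1 / v} s \<partial>lborel)"
    proof (intro nn_integral_cong)
      fix s :: real
      show "(\<integral>\<^sup>+z. h (s, z) x * h (s, z) y \<partial>lborel) = ennreal (exp (- s * (norm (x - y))\<^sup>2)) * indicator {0<..1 / v} s"
      proof (cases "s \<in> {0<..1 / v}")
        case True
        then have s: "s > 0" by simp
        have "(\<integral>\<^sup>+z. h (s, z) x * h (s, z) y \<partial>lborel) = (\<integral>\<^sup>+z. ennreal (1 / c s) *
          ennreal (exp (- 2 * s * (norm (x - z))\<^sup>2) * exp (- 2 * s * (norm (y - z))\<^sup>2)) \<partial>lborel)"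
          using True c[OF s]
          by (intro nn_integral_cong) (simp add: h_def ennreal_mult[symmetric] real_sqrt_mult[symmetric] field_simps)
        also have "\<dots> = ennreal (1 / c s) * ennreal (c s * exp (- s * (norm (x - y))\<^sup>2))"
          unfolding c_def
          by (subst nn_integral_cmult, measurable, subst nn_integral_exp_normsq_convolution) (use s in auto)
        also have "\<dots> = ennreal (exp (- s * (norm (x - y))\<^sup>2))"
          using c[OF s] by (simp add: ennreal_mult[symmetric])
        finally show ?thesis using True by simp
      qed (simp add: h_def)
    qed
    finally show ?thesis using cutoff_kernel_eq_nn_integral[OF v] by simp
  qed
  show ?thesis
  proof (rule Cauchy_Schwarz_positive_definite[OF _ _ meas _ k])
    show "sigma_finite_measure (lborel \<Otimes>\<^sub>M lborel :: (real \<times> 'a) measure)"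
      unfolding lborel_prod by (rule lborel.sigma_finite_measure_axioms)
    show "sigma_finite_measure \<nu>" by unfold_locales
  qed (use sets_eq_imp_space_eq[OF assms(2)] in auto)
qed

text \<open>Integrating the potential against \<open>\<nu>\<close> restricted to \<open>A'\<close>
  gives at least \<open>u\<close> times the mass. The square of this integral is at most
  \<open>\<Gamma>\<close> times the cutoff energy, which the Newton energy dominates after division
  by \<open>newton_const\<close>.\<close>

lemma capacity_bound_potential:
  fixes p :: "nat \<Rightarrow> 'a::euclidean_space"
  assumes d: "DIM('a) = 4" and v: "v > 0" and u: "u > 0" and n: "n > 0"
    and pot: "\<And>x. x \<in> A \<Longrightarrow> u \<le> (\<Sum>j<n. 1 / (v + (norm (x - p j))\<^sup>2))"
  shows "capacity_bound A ((\<Sum>i<n. \<Sum>j<n. cutoff_kernel v (p i - p j)) / (newton_const TYPE('a) * u\<^sup>2))"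
  unfolding capacity_bound_def
proof (intro conjI allI impI)
  define \<Gamma> where "\<Gamma> = (\<Sum>i<n. \<Sum>j<n. cutoff_kernel v (p i - p j))"
  define c where "c = newton_const TYPE('a)"
  have c: "c > 0" using newton_const_pos[where 'a='a] d by (simp add: c_def)
  have "0 < cutoff_kernel v (p 0 - p 0)" using v by (simp add: cutoff_kernel_def)
  also have "\<dots> \<le> (\<Sum>j<n. cutoff_kernel v (p 0 - p j))"
    using n v by (intro member_le_sum) (auto simp: cutoff_kernel_nonneg)
  also have "\<dots> \<le> \<Gamma>"
    unfolding \<Gamma>_def using n v
    by (intro member_le_sum[of 0 _ "\<lambda>i. \<Sum>j<n. cutoff_kernel v (p i - p j)"])
       (auto simp: cutoff_kernel_nonneg intro!: sum_nonneg)
  finally have \<Gamma>: "\<Gamma> > 0" .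
  show "0 \<le> \<Gamma> / (c * u\<^sup>2)" using \<Gamma> c u by simp
  fix \<nu> :: "'a measure" and A'
  assume \<nu>: "finite_measure \<nu>" and sets[measurable_cong]: "sets \<nu> = sets borel"
    and A'[measurable]: "A' \<in> sets borel" and A'_sub: "A' \<subseteq> A"
  interpret finite_measure \<nu> by fact
  define \<nu>' where "\<nu>' = density \<nu> (indicator A')"
  have "finite_measure \<nu>'"
    unfolding \<nu>'_def by (rule finite_measureI) (simp add: emeasure_density sets_eq_imp_space_eq[OF sets] flip: sets)
  have sets'[measurable_cong]: "sets \<nu>' = sets borel" by (simp add: \<nu>'_def sets)
  have "(ennreal u * emeasure \<nu> A')\<^sup>2 \<le> (\<integral>\<^sup>+x. (\<Sum>j<n. ennreal (cutoff_kernel v (x - p j))) \<partial>\<nu>')\<^sup>2"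
  proof (intro power_mono)
    have "ennreal u * emeasure \<nu> A' = (\<integral>\<^sup>+x. indicator A' x * ennreal u \<partial>\<nu>)"
      by (subst nn_integral_multc) (simp_all add: mult.commute sets)
    also have "\<dots> \<le> (\<integral>\<^sup>+x. indicator A' x * (\<Sum>j<n. ennreal (cutoff_kernel v (x - p j))) \<partial>\<nu>)"
    proof (intro nn_integral_mono)
      fix x
      have "ennreal u \<le> (\<Sum>j<n. ennreal (cutoff_kernel v (x - p j)))" if "x \<in> A'"
      proof -
        have "u \<le> (\<Sum>j<n. 1 / (v + (norm (x - p j))\<^sup>2))" using that A'_sub pot by auto
        also have "\<dots> \<le> (\<Sum>j<n. cutoff_kernel v (x - p j))"
          using v by (intro sum_mono cutoff_kernel_ge)
        finally show ?thesis using v by (simp add: sum_ennreal cutoff_kernel_nonneg ennreal_leI)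
      qed
      then show "indicator A' x * ennreal u \<le> indicator A' x * (\<Sum>j<n. ennreal (cutoff_kernel v (x - p j)))"
        by (auto simp: indicator_def)
    qed
    also have "\<dots> = (\<integral>\<^sup>+x. (\<Sum>j<n. ennreal (cutoff_kernel v (x - p j))) \<partial>\<nu>')"
      unfolding \<nu>'_def by (subst nn_integral_density) auto
    finally show "ennreal u * emeasure \<nu> A' \<le> (\<integral>\<^sup>+x. (\<Sum>j<n. ennreal (cutoff_kernel v (x - p j))) \<partial>\<nu>')" .
  qed auto
  also have "\<dots> \<le> (\<Sum>i<n. \<Sum>j<n. ennreal (cutoff_kernel v (p i - p j))) *
       (\<integral>\<^sup>+x. (\<integral>\<^sup>+y. ennreal (cutoff_kernel v (x - y)) \<partial>\<nu>') \<partial>\<nu>')"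
    by (rule cutoff_kernel_positive_definite) fact+
  also have "(\<Sum>i<n. \<Sum>j<n. ennreal (cutoff_kernel v (p i - p j))) = ennreal \<Gamma>"
    using v by (simp add: \<Gamma>_def sum_ennreal cutoff_kernel_nonneg sum_nonneg)
  also have "(\<integral>\<^sup>+x. (\<integral>\<^sup>+y. ennreal (cutoff_kernel v (x - y)) \<partial>\<nu>') \<partial>\<nu>')
      \<le> (\<integral>\<^sup>+x. (\<integral>\<^sup>+y. ennreal (1 / c) * newton_kernel x y \<partial>\<nu>') \<partial>\<nu>')"
  proof (intro nn_integral_mono)
    fix x y :: 'a
    have "ennreal (cutoff_kernel v (x - y)) = ennreal (1 / c) * ennreal (c * cutoff_kernel v (x - y))"
      using c v by (simp add: ennreal_mult[symmetric] cutoff_kernel_nonneg)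
    also have "\<dots> \<le> ennreal (1 / c) * newton_kernel x y"
      unfolding c_def using d by (intro mult_left_mono cutoff_kernel_le_newton_kernel) auto
    finally show "ennreal (cutoff_kernel v (x - y)) \<le> ennreal (1 / c) * newton_kernel x y" .
  qed
  also have "\<dots> = ennreal (1 / c) * energy \<nu> A'"
    unfolding energy_def \<nu>'_def
  proof -
    have "(\<integral>\<^sup>+x. (\<integral>\<^sup>+y. ennreal (1 / c) * newton_kernel x y \<partial>density \<nu> (indicator A')) \<partial>density \<nu> (indicator A'))
      = (\<integral>\<^sup>+x. indicator A' x * (\<integral>\<^sup>+y. indicator A' y * (ennreal (1 / c) * newton_kernel x y) \<partial>\<nu>) \<partial>\<nu>)"
      by (simp add: nn_integral_density)
    also have "\<dots> = (\<integral>\<^sup>+x. ennreal (1 / c) * ((\<integral>\<^sup>+y\<in>A'. newton_kernel x y \<partial>\<nu>) * indicator A' x) \<partial>\<nu>)"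
      by (intro nn_integral_cong) (simp add: nn_integral_cmult[symmetric] mult_ac)
    also have "\<dots> = ennreal (1 / c) * (\<integral>\<^sup>+x\<in>A'. (\<integral>\<^sup>+y\<in>A'. newton_kernel x y \<partial>\<nu>) \<partial>\<nu>)"
      by (rule nn_integral_cmult) measurable
    finally show "(\<integral>\<^sup>+x. (\<integral>\<^sup>+y. ennreal (1 / c) * newton_kernel x y \<partial>density \<nu> (indicator A')) \<partial>density \<nu> (indicator A'))
      = ennreal (1 / c) * (\<integral>\<^sup>+x\<in>A'. (\<integral>\<^sup>+y\<in>A'. newton_kernel x y \<partial>\<nu>) \<partial>\<nu>)" .
  qed
  finally have *: "(ennreal u * emeasure \<nu> A')\<^sup>2 \<le> ennreal \<Gamma> * (ennreal (1 / c) * energy \<nu> A')"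
    by (simp add: mult_left_mono)
  have "(emeasure \<nu> A')\<^sup>2 = ennreal (1 / u\<^sup>2) * (ennreal u * emeasure \<nu> A')\<^sup>2"
    using u by (simp add: power_mult_distrib ennreal_power mult.assoc[symmetric] ennreal_mult[symmetric])
  also have "\<dots> \<le> ennreal (1 / u\<^sup>2) * (ennreal \<Gamma> * (ennreal (1 / c) * energy \<nu> A'))"
    by (intro mult_left_mono *) auto
  also have "\<dots> = ennreal (\<Gamma> / (c * u\<^sup>2)) * energy \<nu> A'"
  proof -
    have "\<Gamma> / (c * u\<^sup>2) = 1 / u\<^sup>2 * (\<Gamma> * (1 / c))" by simp
    then show ?thesis using u c \<Gamma> by (simp only: ennreal_mult zero_le_divide_1_iff less_imp_le mult_nonneg_nonneg zero_le_power2 mult.assoc)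
  qed
  finally show "(emeasure \<nu> A')\<^sup>2 \<le> ennreal (\<Gamma> / (c * u\<^sup>2)) * energy \<nu> A'" .
qed

text \<open>Discarding the exponential in \<open>y\<close> makes the bound uniform in the shift, so
  that a last increment can be integrated out whatever came before. In dimension four the remaining
  integrand \<open>1 / (1 + 2 * s * w) ^ 2\<close> has the antiderivative
  \<open>s / (1 + 2 * s * w)\<close>.\<close>

lemma nn_integral_cutoff_kernel_gauss_le:
  fixes y :: "'a::euclidean_space"
  assumes d: "DIM('a) = 4" and v: "v > 0" and w: "w > 0"
  shows "(\<integral>\<^sup>+x. ennreal (cutoff_kernel v (y + x)) \<partial>gauss w) \<le> ennreal (1 / (v + 2 * w))"
proof -
  interpret prob_space "gauss w :: 'a measure" using w by (rule prob_space_gauss)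
  interpret pair_sigma_finite lborel "gauss w :: 'a measure" ..
  have "(\<integral>\<^sup>+x. ennreal (cutoff_kernel v (y + x)) \<partial>gauss w) =
    (\<integral>\<^sup>+x. (\<integral>\<^sup>+s\<in>{0<..1 / v}. ennreal (exp (- s * (norm (y + x))\<^sup>2)) \<partial>lborel) \<partial>gauss w)"
    using v by (simp add: cutoff_kernel_eq_nn_integral)
  also have "\<dots> = (\<integral>\<^sup>+s. (\<integral>\<^sup>+x. ennreal (exp (- s * (norm (y + x))\<^sup>2)) * indicator {0<..1 / v} s \<partial>gauss w) \<partial>lborel)"
    by (rule Fubini') measurable
  also have "\<dots> \<le> (\<integral>\<^sup>+s. ennreal (1 / (1 + 2 * s * w)\<^sup>2) * indicator {0<..1 / v} s \<partial>lborel)"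
  proof (intro nn_integral_mono)
    fix s :: real
    show "(\<integral>\<^sup>+x. ennreal (exp (- s * (norm (y + x))\<^sup>2)) * indicator {0<..1 / v} s \<partial>gauss w)
      \<le> ennreal (1 / (1 + 2 * s * w)\<^sup>2) * indicator {0<..1 / v} s"
    proof (cases "s \<in> {0<..1 / v}")
      case True
      then have s: "s > 0" by simp
      then have sw: "0 < 1 + 2 * s * w" using w by (simp add: add_pos_pos)
      have "sqrt (1 + 2 * s * w) ^ 4 = ((sqrt (1 + 2 * s * w))\<^sup>2)\<^sup>2"
        by (simp flip: power_mult)
      also have "\<dots> = (1 + 2 * s * w)\<^sup>2" using sw by simp
      finally have "sqrt (1 + 2 * s * w) ^ 4 = (1 + 2 * s * w)\<^sup>2" .
      then have "(1 / sqrt (1 - 2 * - s * w)) ^ DIM('a) = 1 / (1 + 2 * s * w)\<^sup>2"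
        using d by (simp add: power_divide)
      moreover have "exp (- s * (norm y)\<^sup>2 / (1 - 2 * - s * w)) \<le> 1"
        using s sw by simp
      ultimately have "(1 / sqrt (1 - 2 * - s * w)) ^ DIM('a) * exp (- s * (norm y)\<^sup>2 / (1 - 2 * - s * w))
          \<le> 1 / (1 + 2 * s * w)\<^sup>2"
        by (simp only:) (rule mult_left_le, auto)
      moreover have "2 * - s * w < 1" using mult_pos_pos[OF s w] by simp
      ultimately show ?thesis
        using True nn_integral_exp_normsq_gauss[OF w, of "- s" y] by (simp add: ennreal_leI)
    qed simp
  qed
  also have "\<dots> = (\<integral>\<^sup>+s. ennreal (1 / (1 + 2 * s * w)\<^sup>2) * indicator {0..1 / v} s \<partial>lborel)"
    by (rule nn_integral_open_Icc)
  also have "\<dots> = ennreal ((1 / v) / (1 + 2 * (1 / v) * w) - 0 / (1 + 2 * 0 * w))"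
  proof (rule nn_integral_FTC_Icc[where F = "\<lambda>s. s / (1 + 2 * s * w)"])
    fix s :: real assume "s \<in> {0..1 / v}"
    then have s: "0 \<le> s" by simp
    have "0 < 1 + 2 * s * w" using s w by (simp add: add_pos_nonneg)
    then have "((\<lambda>s. s / (1 + 2 * s * w)) has_real_derivative
        (1 * (1 + 2 * s * w) - s * (0 + (2 * 1) * w)) / ((1 + 2 * s * w) * (1 + 2 * s * w))) (at s)"
      by (intro DERIV_divide DERIV_ident DERIV_add DERIV_const DERIV_cmult_right DERIV_cmult) simp
    then show "((\<lambda>s. s / (1 + 2 * s * w)) has_real_derivative 1 / (1 + 2 * s * w)\<^sup>2) (at s)"
      by (simp add: power2_eq_square)
  qed (use v in auto)
  also have "\<dots> = ennreal (1 / (v * (1 + 2 * (1 / v) * w)))" by simp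
  also have "v * (1 + 2 * (1 / v) * w) = v + 2 * w" using v by (simp add: distrib_left)
  finally show ?thesis .
qed

section \<open>Increments of Brownian motion\<close>

lemma product_nn_integral_lessThan_Suc:
  fixes M :: "nat \<Rightarrow> 'a measure"
  assumes "product_sigma_finite M" and "f \<in> borel_measurable (Pi\<^sub>M {..<Suc n} M)"
  shows "integral\<^sup>N (Pi\<^sub>M {..<Suc n} M) f
    = (\<integral>\<^sup>+x. (\<integral>\<^sup>+y. f (x(n := y)) \<partial>(M n)) \<partial>(Pi\<^sub>M {..<n} M))"
  using product_sigma_finite.product_nn_integral_insert[of M "{..<n}" n f] assms by (simp add: lessThan_Suc)

context standard_brownian_motion
begin

lemma measurable_increment:
  assumes "0 \<le> s" "s < t"
  shows "(\<lambda>\<omega>. B t \<omega> - B s \<omega>) \<in> borel_measurable M"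
  using measurable[of s] measurable[of t] assms by simp

lemma distr_increment:
  assumes "0 \<le> s" "s < t"
  shows "distr M borel (\<lambda>\<omega>. B t \<omega> - B s \<omega>) = gauss (t - s)"
proof -
  have "distr M borel (\<lambda>\<omega>. B t \<omega> - B s \<omega>) = distr M lborel (\<lambda>\<omega>. B t \<omega> - B s \<omega>)"
    by (rule distr_cong) auto
  then show ?thesis
    using distributed_distr_eq_density[OF gaussian_increments[OF assms]] by (simp add: gauss_def)
qed

lemma nn_integral_increment:
  assumes "0 \<le> s" "s < t" "f \<in> borel_measurable borel"
  shows "(\<integral>\<^sup>+\<omega>. f (B t \<omega> - B s \<omega>) \<partial>M) = (\<integral>\<^sup>+x. f x \<partial>gauss (t - s))"
  using assms by (simp add: nn_integral_distr measurable_increment flip: distr_increment)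

text \<open>The one place where independence of increments enters: expectations become integrals
  over a product of Gaussian laws, whose coordinates can be peeled off from the last one.\<close>

lemma nn_integral_increments:
  assumes \<tau>: "0 \<le> \<tau> 0" "\<And>i. i < n \<Longrightarrow> \<tau> (Suc i) - \<tau> i = w i" and w: "\<And>i. 0 < w i" and n: "n > 0"
    and f: "f \<in> borel_measurable (Pi\<^sub>M {..<n} (\<lambda>_. borel))"
  shows "(\<integral>\<^sup>+\<omega>. f (\<lambda>i\<in>{..<n}. B (\<tau> (Suc i)) \<omega> - B (\<tau> i) \<omega>) \<partial>M)
    = (\<integral>\<^sup>+x. f x \<partial>(Pi\<^sub>M {..<n} (\<lambda>i. gauss (w i))))"
proof -
  have \<tau>_less: "\<tau> i < \<tau> (Suc i)" if "i < n" for i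
    using \<tau>(2)[OF that] w[of i] by linarith
  have \<tau>_nonneg: "0 \<le> \<tau> i" if "i \<le> n" for i
    using that
  proof (induction i)
    case (Suc i)
    then show ?case using \<tau>_less[of i] by force
  qed (use \<tau> in simp)
  have rv: "(\<lambda>\<omega>. B (\<tau> (Suc i)) \<omega> - B (\<tau> i) \<omega>) \<in> borel_measurable M" if "i \<in> {..<n}" for i
    using that \<tau>_less \<tau>_nonneg by (intro measurable_increment) auto
  have "distr M (Pi\<^sub>M {..<n} (\<lambda>_. borel)) (\<lambda>\<omega>. \<lambda>i\<in>{..<n}. B (\<tau> (Suc i)) \<omega> - B (\<tau> i) \<omega>)
    = Pi\<^sub>M {..<n} (\<lambda>i. distr M borel (\<lambda>\<omega>. B (\<tau> (Suc i)) \<omega> - B (\<tau> i) \<omega>))"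
    using indep_increments[of \<tau> n] \<tau>(1) \<tau>_less rv n
    by (subst indep_vars_iff_distr_eq_PiM'[symmetric]) auto
  also have "\<dots> = Pi\<^sub>M {..<n} (\<lambda>i. gauss (w i))"
    using \<tau> \<tau>_less \<tau>_nonneg by (intro PiM_cong) (auto simp: distr_increment)
  finally have "(\<integral>\<^sup>+x. f x \<partial>(Pi\<^sub>M {..<n} (\<lambda>i. gauss (w i)))) =
    (\<integral>\<^sup>+x. f x \<partial>distr M (Pi\<^sub>M {..<n} (\<lambda>_. borel)) (\<lambda>\<omega>. \<lambda>i\<in>{..<n}. B (\<tau> (Suc i)) \<omega> - B (\<tau> i) \<omega>))"
    by simp
  also have "\<dots> = (\<integral>\<^sup>+\<omega>. f (\<lambda>i\<in>{..<n}. B (\<tau> (Suc i)) \<omega> - B (\<tau> i) \<omega>) \<partial>M)"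
    using rv f by (subst nn_integral_distr) (auto intro!: measurable_restrict)
  finally show ?thesis by simp
qed

lemma nn_integral_two_increments:
  assumes "0 \<le> s" "s < t" "t < u"
    and [measurable]: "(\<lambda>(x, y). f x y) \<in> borel_measurable (borel \<Otimes>\<^sub>M borel)"
  shows "(\<integral>\<^sup>+\<omega>. f (B t \<omega> - B s \<omega>) (B u \<omega> - B t \<omega>) \<partial>M)
    = (\<integral>\<^sup>+x. (\<integral>\<^sup>+y. f x y \<partial>gauss (u - t)) \<partial>gauss (t - s))"
proof -
  define w where "w i = (if i = (0::nat) then t - s else u - t)" for i
  define \<tau> where "\<tau> i = (if i = (0::nat) then s else if i = 1 then t else u)" for i
  have w: "0 < w i" for i using assms by (simp add: w_def)
  interpret product_sigma_finite "\<lambda>i. gauss (w i) :: 'a measure"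
    using prob_space_imp_sigma_finite[OF prob_space_gauss[OF w, where 'a='a]] by (simp add: product_sigma_finite_def)
  have meas: "(\<lambda>z. f (z 0) (z (Suc 0))) \<in> borel_measurable (Pi\<^sub>M {..<Suc (Suc 0)} (\<lambda>i. gauss (w i) :: 'a measure))"
    by measurable
  have meas': "(\<lambda>z. \<integral>\<^sup>+y. f (z 0) y \<partial>gauss (w 1)) \<in> borel_measurable (Pi\<^sub>M {..<Suc 0} (\<lambda>i. gauss (w i) :: 'a measure))"
  proof -
    interpret g: prob_space "gauss (w 1) :: 'a measure" by (rule prob_space_gauss[OF w])
    show ?thesis by measurable
  qed
  have "(\<integral>\<^sup>+\<omega>. f (B t \<omega> - B s \<omega>) (B u \<omega> - B t \<omega>) \<partial>M)
    = (\<integral>\<^sup>+\<omega>. (\<lambda>z. f (z 0) (z (Suc 0))) (\<lambda>i\<in>{..<Suc (Suc 0)}. B (\<tau> (Suc i)) \<omega> - B (\<tau> i) \<omega>) \<partial>M)"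
    by (simp add: \<tau>_def)
  also have "\<dots> = (\<integral>\<^sup>+z. f (z 0) (z (Suc 0)) \<partial>(Pi\<^sub>M {..<Suc (Suc 0)} (\<lambda>i. gauss (w i))))"
    using assms w by (intro nn_integral_increments) (auto simp: \<tau>_def w_def)
  also have "\<dots> = (\<integral>\<^sup>+z. (\<integral>\<^sup>+y. f (z 0) y \<partial>gauss (w 1)) \<partial>(Pi\<^sub>M {..<Suc 0} (\<lambda>i. gauss (w i))))"
    by (subst product_nn_integral_lessThan_Suc[OF product_sigma_finite_axioms meas]) simp
  also have "\<dots> = (\<integral>\<^sup>+x. (\<integral>\<^sup>+y. f x y \<partial>gauss (w 1)) \<partial>gauss (w 0))"
    by (subst product_nn_integral_lessThan_Suc[OF product_sigma_finite_axioms meas']) (simp add: PiM_empty)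
  finally show ?thesis by (simp add: w_def)
qed

end

section \<open>Exponential moment of the weighted squared displacements\<close>

lemma harm_eq_sum_real: "harm n = (\<Sum>m=1..n. 1 / real m)"
  by (simp add: harm_def inverse_eq_divide)

text \<open>For \<open>u = 1 / (2 * m) \<le> 1 / 2\<close> one has
  \<open>(1 - u) * (1 + 2 * u) \<ge> 1\<close>. The left-hand side is the factor produced by
  integrating out the m-th step of the walk; the exponents on the right add up to a harmonic
  number.\<close>

lemma inverse_sqrt_power_le:
  assumes "m \<ge> (1::nat)"
  shows "(1 / sqrt (1 - 1 / (2 * real m))) ^ d \<le> exp (real d / 2 * (1 / real m))"
proof -
  define u where "u = 1 / (2 * real m)"
  have u: "0 < u" "u \<le> 1 / 2" using assms by (auto simp: u_def field_simps)
  have "1 \<le> (1 - u) * (1 + 2 * u)"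
  proof -
    have "0 \<le> u * (1 - 2 * u)" using u by simp
    then show ?thesis by (simp add: algebra_simps)
  qed
  also have "\<dots> \<le> (1 - u) * exp (2 * u)"
    using u by (intro mult_left_mono exp_ge_add_one_self) auto
  also have "\<dots> = (1 - u) * (exp u)\<^sup>2"
    by (simp add: exp_double)
  finally have "sqrt 1 \<le> sqrt ((1 - u) * (exp u)\<^sup>2)" by (rule real_sqrt_le_mono)
  then have "1 \<le> sqrt (1 - u) * exp u" by (simp add: real_sqrt_mult)
  then have "1 / sqrt (1 - u) \<le> exp u" using u by (simp add: field_simps)
  then have "(1 / sqrt (1 - u)) ^ d \<le> exp u ^ d" using u by (intro power_mono) auto
  also have "\<dots> = exp (real d * u)" by (simp add: exp_of_nat_mult)
  finally show ?thesis by (simp add: u_def)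
qed

text \<open>The exponent is chosen so that integrating out the last step reproduces it with one step
  less: \<open>1 / (16 n\<^sup>2) + 1 / (2 (2 n + 1)) \<le> 1 / (4 n)\<close>.\<close>

lemma nn_integral_exp_weighted_walk:
  fixes v :: real
  assumes v: "v > 0"
  shows "(\<integral>\<^sup>+x. ennreal (exp ((\<Sum>m=1..<n. 1 / (16 * v) * (norm (\<Sum>k<m. x k))\<^sup>2 / (real m)\<^sup>2)
      + (norm (\<Sum>k<n. x k))\<^sup>2 / (4 * v * real n)))
     \<partial>(Pi\<^sub>M {..<n} (\<lambda>_. gauss v :: 'a::euclidean_space measure))) \<le> ennreal (exp (DIM('a) / 2 * harm n))"
proof (induction n)
  case 0
  show ?case by (simp add: PiM_empty harm_def)
next
  case (Suc n)
  interpret product_sigma_finite "\<lambda>_. gauss v :: 'a measure"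
    using prob_space_imp_sigma_finite[OF prob_space_gauss[OF v]] by (simp add: product_sigma_finite_def)
  define S where "S m x = (\<Sum>k<m. x k)" for m :: nat and x :: "nat \<Rightarrow> 'a"
  define U where "U n x = (\<Sum>m=1..<n. 1 / (16 * v) * (norm (S m x))\<^sup>2 / (real m)\<^sup>2)" for n x
  have S_meas [measurable]: "S m \<in> borel_measurable (Pi\<^sub>M {..<k} (\<lambda>_. gauss v))" if "m \<le> k" for m k
  proof -
    have "S m \<in> borel_measurable (Pi\<^sub>M {..<k} (\<lambda>_. borel))"
      unfolding S_def using that by (intro borel_measurable_sum measurable_component_singleton) auto
    then show ?thesis by simp
  qed
  have U_meas [measurable]: "U m \<in> borel_measurable (Pi\<^sub>M {..<k} (\<lambda>_. gauss v))" if "m \<le> Suc k" for m k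
    unfolding U_def
  proof (intro borel_measurable_sum)
    fix j assume "j \<in> {1..<m}"
    then have [measurable]: "S j \<in> borel_measurable (Pi\<^sub>M {..<k} (\<lambda>_. gauss v))"
      using that by (intro S_meas) auto
    show "(\<lambda>x. 1 / (16 * v) * (norm (S j x))\<^sup>2 / (real j)\<^sup>2) \<in> borel_measurable (Pi\<^sub>M {..<k} (\<lambda>_. gauss v))"
      by measurable
  qed
  have S_upd: "S m (x(n := y)) = S m x" if "m \<le> n" for m x y
    unfolding S_def using that by (intro sum.cong) auto
  have S_Suc: "S (Suc n) (x(n := y)) = S n x + y" for x y
    using S_upd[of n x y] by (simp add: S_def)
  have U_upd: "U (Suc n) (x(n := y)) = U (Suc n) x" for x y
    unfolding U_def by (intro sum.cong) (auto simp: S_upd)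
  define a where "a = 1 / (4 * v * real (Suc n))"
  have a: "2 * a * v = 1 / (2 * real (Suc n))" using v by (simp add: a_def)
  also have "\<dots> < 1" by simp
  finally have a1: "2 * a * v < 1" .
  define K where "K = (1 / sqrt (1 - 1 / (2 * real (Suc n)))) ^ DIM('a)"
  have K: "0 \<le> K" by (simp add: K_def)
  have exponent: "U (Suc n) x + a * (norm (S n x))\<^sup>2 / (1 - 2 * a * v)
      \<le> U n x + (norm (S n x))\<^sup>2 / (4 * v * real n)" for x
  \<comment> \<open>For \<open>n = 0\<close> both sides are 0: \<open>S 0\<close> is an empty sum,
    and the term with denominator 0 vanishes by convention.\<close>
  proof (cases "n = 0")
    case True
    then show ?thesis by (simp add: U_def S_def)
  next
    case False
    then have U: "U (Suc n) x = U n x + 1 / (16 * v) * (norm (S n x))\<^sup>2 / (real n)\<^sup>2"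
      by (simp add: U_def)
    have "1 - 2 * a * v = (2 * real n + 1) / (2 * real (Suc n))"
      unfolding a by (simp add: field_simps)
    moreover have "1 / (4 * v * N) / (b / (2 * N)) = 1 / (2 * v * b)" if "N > 0" "b > 0" for N b
      using v that by (simp add: field_simps)
    ultimately have "a / (1 - 2 * a * v) = 1 / (2 * v * (2 * real n + 1))"
      by (simp only: a_def)
    moreover have "1 / (16 * v) / (real n)\<^sup>2 + 1 / (2 * v * (2 * real n + 1)) \<le> 1 / (4 * v * real n)"
    proof -
      have n: "real n \<ge> 1" using False by simp
      have "1 / (16 * v) / (real n)\<^sup>2 + 1 / (2 * v * (2 * real n + 1))
        = ((2 * real n + 1) + 8 * (real n)\<^sup>2) / (16 * v * (real n)\<^sup>2 * (2 * real n + 1))"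
      proof -
        have "1 / (16 * v) / N\<^sup>2 + 1 / (2 * v * q) = (q + 8 * N\<^sup>2) / (16 * v * N\<^sup>2 * q)"
          if "N > 0" "q > 0" for N q :: real
          using v that by (simp add: field_simps power2_eq_square)
        then show ?thesis using n by simp
      qed
      also have "\<dots> \<le> (4 * real n * (2 * real n + 1)) / (16 * v * (real n)\<^sup>2 * (2 * real n + 1))"
        using v n by (intro divide_right_mono) (auto simp: power2_eq_square algebra_simps)
      also have "\<dots> = 1 / (4 * v * real n)"
      proof -
        have *: "4 * N * q / (16 * v * N\<^sup>2 * q) = 1 / (4 * v * N)" if "N > 0" "q > 0" for N q :: real
          using v that by (simp add: field_simps power2_eq_square)
        show ?thesis using n by (intro *) auto
      qed
      finally show ?thesis .
    qed
    ultimately have "(1 / (16 * v) / (real n)\<^sup>2 + a / (1 - 2 * a * v)) * (norm (S n x))\<^sup>2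
        \<le> 1 / (4 * v * real n) * (norm (S n x))\<^sup>2"
      by (intro mult_right_mono) auto
    then show ?thesis unfolding U by (simp add: algebra_simps)
  qed
  have "(\<integral>\<^sup>+x. ennreal (exp (U (Suc n) x + (norm (S (Suc n) x))\<^sup>2 / (4 * v * real (Suc n))))
      \<partial>(Pi\<^sub>M {..<Suc n} (\<lambda>_. gauss v)))
    = (\<integral>\<^sup>+x. (\<integral>\<^sup>+y. ennreal (exp (U (Suc n) (x(n := y)) + (norm (S (Suc n) (x(n := y))))\<^sup>2 / (4 * v * real (Suc n))))
      \<partial>gauss v) \<partial>(Pi\<^sub>M {..<n} (\<lambda>_. gauss v)))"
    by (rule product_nn_integral_lessThan_Suc[OF product_sigma_finite_axioms]) measurable
  also have "\<dots> = (\<integral>\<^sup>+x. (\<integral>\<^sup>+y. ennreal (exp (U (Suc n) x)) * ennreal (exp (a * (norm (S n x + y))\<^sup>2))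
      \<partial>gauss v) \<partial>(Pi\<^sub>M {..<n} (\<lambda>_. gauss v)))"
    by (simp add: U_upd S_Suc exp_add a_def ennreal_mult del: of_nat_Suc)
  also have "\<dots> = (\<integral>\<^sup>+x. ennreal (exp (U (Suc n) x)) *
      ennreal (K * exp (a * (norm (S n x))\<^sup>2 / (1 - 2 * a * v))) \<partial>(Pi\<^sub>M {..<n} (\<lambda>_. gauss v)))"
  proof -
    have "(\<integral>\<^sup>+y. ennreal (exp (U (Suc n) x)) * ennreal (exp (a * (norm (S n x + y))\<^sup>2)) \<partial>gauss v)
      = ennreal (exp (U (Suc n) x)) * ennreal (K * exp (a * (norm (S n x))\<^sup>2 / (1 - 2 * a * v)))" for x
      unfolding K_def a[symmetric] using v a1
      by (subst nn_integral_cmult, simp) (simp only: nn_integral_exp_normsq_gauss)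
    then show ?thesis by simp
  qed
  also have "\<dots> \<le> (\<integral>\<^sup>+x. ennreal K * ennreal (exp (U n x + (norm (S n x))\<^sup>2 / (4 * v * real n)))
      \<partial>(Pi\<^sub>M {..<n} (\<lambda>_. gauss v)))"
  proof (intro nn_integral_mono)
    fix x
    have "exp (U (Suc n) x) * (K * exp (a * (norm (S n x))\<^sup>2 / (1 - 2 * a * v)))
      = K * exp (U (Suc n) x + a * (norm (S n x))\<^sup>2 / (1 - 2 * a * v))" by (simp add: exp_add)
    also have "\<dots> \<le> K * exp (U n x + (norm (S n x))\<^sup>2 / (4 * v * real n))"
      using exponent[of x] K by (intro mult_left_mono) auto
    finally show "ennreal (exp (U (Suc n) x)) * ennreal (K * exp (a * (norm (S n x))\<^sup>2 / (1 - 2 * a * v)))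
      \<le> ennreal K * ennreal (exp (U n x + (norm (S n x))\<^sup>2 / (4 * v * real n)))"
      using K by (simp add: ennreal_mult[symmetric] ennreal_leI)
  qed
  also have "\<dots> = ennreal K * (\<integral>\<^sup>+x. ennreal (exp (U n x + (norm (S n x))\<^sup>2 / (4 * v * real n)))
      \<partial>(Pi\<^sub>M {..<n} (\<lambda>_. gauss v)))"
    by (rule nn_integral_cmult) measurable
  also have "\<dots> \<le> ennreal (exp (DIM('a) / 2 * (1 / real (Suc n)))) * ennreal (exp (DIM('a) / 2 * harm n))"
    using Suc.IH inverse_sqrt_power_le[of "Suc n" "DIM('a)"]
    unfolding U_def S_def K_def by (intro mult_mono ennreal_leI) auto
  also have "\<dots> = ennreal (exp (DIM('a) / 2 * harm (Suc n)))"
    by (simp add: ennreal_mult[symmetric] exp_add[symmetric] harm_Suc inverse_eq_divide algebra_simps del: of_nat_Suc)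
  finally show ?case unfolding U_def S_def .
qed

context standard_brownian_motion
begin

text \<open>The squared displacement after \<open>m\<close> steps has mean
  \<open>DIM('a) * m * v\<close>, so the weights make every scale of \<open>m\<close> contribute
  equally and the total is typically of order \<open>v * harm n\<close>.\<close>

definition walk_energy :: "real \<Rightarrow> nat \<Rightarrow> nat \<Rightarrow> 'w \<Rightarrow> real" where
  "walk_energy v i n \<omega> = (\<Sum>m=1..n. (norm (B (real (i + m) * v) \<omega> - B (real i * v) \<omega>))\<^sup>2 / (real m)\<^sup>2)"

lemma measurable_walk_energy [measurable]:
  assumes "v > 0"
  shows "walk_energy v i n \<in> borel_measurable M"
proof -
  have [measurable]: "B (real k * v) \<in> borel_measurable M" for k
    using assms by (intro measurable) simp
  show ?thesis unfolding walk_energy_def by measurable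
qed

text \<open>Partial sums of the increments telescope to displacements. The last summand of the walk
  energy is absorbed into the larger endpoint term of \<open>F\<close>, as
  \<open>1 / (16 * v * n ^ 2) \<le> 1 / (4 * v * n)\<close>.\<close>

lemma nn_integral_exp_walk_energy_le:
  assumes v: "v > 0" and n: "n > 0"
  shows "(\<integral>\<^sup>+\<omega>. ennreal (exp (walk_energy v i n \<omega> / (16 * v))) \<partial>M) \<le> ennreal (exp (DIM('a) / 2 * harm n))"
proof -
  define \<tau> where "\<tau> k = real (i + k) * v" for k
  define F where "F x = ennreal (exp ((\<Sum>m=1..<n. 1 / (16 * v) * (norm (\<Sum>k<m. x k))\<^sup>2 / (real m)\<^sup>2)
      + (norm (\<Sum>k<n. x k))\<^sup>2 / (4 * v * real n)))" for x :: "nat \<Rightarrow> 'a"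
  have [measurable]: "(\<lambda>x. \<Sum>k<m. x k) \<in> borel_measurable (Pi\<^sub>M {..<n} (\<lambda>_. borel :: 'a measure))" if "m \<le> n" for m
    using that by (intro borel_measurable_sum measurable_component_singleton) auto
  have F: "F \<in> borel_measurable (Pi\<^sub>M {..<n} (\<lambda>_. borel))" unfolding F_def by measurable
  have "(\<integral>\<^sup>+\<omega>. ennreal (exp (walk_energy v i n \<omega> / (16 * v))) \<partial>M)
    \<le> (\<integral>\<^sup>+\<omega>. F (\<lambda>k\<in>{..<n}. B (\<tau> (Suc k)) \<omega> - B (\<tau> k) \<omega>) \<partial>M)"
  proof (intro nn_integral_mono)
    fix \<omega>
    define D where "D m = norm (B (\<tau> m) \<omega> - B (\<tau> 0) \<omega>)" for m
    have sum: "(\<Sum>k<m. (\<lambda>k\<in>{..<n}. B (\<tau> (Suc k)) \<omega> - B (\<tau> k) \<omega>) k) = B (\<tau> m) \<omega> - B (\<tau> 0) \<omega>"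
      if "m \<le> n" for m
    proof -
      have "(\<Sum>k<m. (\<lambda>k\<in>{..<n}. B (\<tau> (Suc k)) \<omega> - B (\<tau> k) \<omega>) k) = (\<Sum>k<m. B (\<tau> (Suc k)) \<omega> - B (\<tau> k) \<omega>)"
        using that by (intro sum.cong) auto
      then show ?thesis by (simp add: sum_lessThan_telescope[of "\<lambda>k. B (\<tau> k) \<omega>"])
    qed
    have F_eq: "F (\<lambda>k\<in>{..<n}. B (\<tau> (Suc k)) \<omega> - B (\<tau> k) \<omega>)
      = ennreal (exp ((\<Sum>m=1..<n. 1 / (16 * v) * (D m)\<^sup>2 / (real m)\<^sup>2) + (D n)\<^sup>2 / (4 * v * real n)))"
    proof -
      have "(\<Sum>m=1..<n. 1 / (16 * v) * (norm (\<Sum>k<m. (\<lambda>k\<in>{..<n}. B (\<tau> (Suc k)) \<omega> - B (\<tau> k) \<omega>) k))\<^sup>2 / (real m)\<^sup>2)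
        = (\<Sum>m=1..<n. 1 / (16 * v) * (D m)\<^sup>2 / (real m)\<^sup>2)"
        by (intro sum.cong refl) (simp only: sum D_def atLeastLessThan_iff less_imp_le)
      then show ?thesis unfolding F_def by (simp only: sum[OF order_refl] D_def)
    qed
    have "walk_energy v i n \<omega> / (16 * v) = (\<Sum>m=1..n. 1 / (16 * v) * (D m)\<^sup>2 / (real m)\<^sup>2)"
      by (simp add: walk_energy_def \<tau>_def D_def sum_divide_distrib mult.commute)
    also have "\<dots> = (\<Sum>m=1..<n. 1 / (16 * v) * (D m)\<^sup>2 / (real m)\<^sup>2) + 1 / (16 * v) * (D n)\<^sup>2 / (real n)\<^sup>2"
    proof -
      have "{1..n} = insert n {1..<n}" using n by auto
      then show ?thesis by simp
    qed
    also have "1 / (16 * v) * (D n)\<^sup>2 / (real n)\<^sup>2 \<le> (D n)\<^sup>2 / (4 * v * real n)"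
    proof -
      have "4 * v * real n \<le> 16 * v * (real n)\<^sup>2"
        using v n by (simp add: power2_eq_square)
      then have "(D n)\<^sup>2 / (16 * v * (real n)\<^sup>2) \<le> (D n)\<^sup>2 / (4 * v * real n)"
        using v n by (intro divide_left_mono) auto
      then show ?thesis by simp
    qed
    finally show "ennreal (exp (walk_energy v i n \<omega> / (16 * v))) \<le> F (\<lambda>k\<in>{..<n}. B (\<tau> (Suc k)) \<omega> - B (\<tau> k) \<omega>)"
      unfolding F_eq by (intro ennreal_leI) simp
  qed
  also have "\<dots> = (\<integral>\<^sup>+x. F x \<partial>(Pi\<^sub>M {..<n} (\<lambda>_. gauss v)))"
    using v n F by (intro nn_integral_increments) (auto simp: \<tau>_def algebra_simps)
  also have "\<dots> \<le> ennreal (exp (DIM('a) / 2 * harm n))"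
    unfolding F_def by (rule nn_integral_exp_weighted_walk[OF v])
  finally show ?thesis .
qed

end

section \<open>Oscillation of the path\<close>

text \<open>A dyadic point of level \<open>Suc l\<close> is reached from one of level
  \<open>l\<close> by at most one increment of level \<open>Suc l\<close>, so a geometric series
  bounds the distance from \<open>f a\<close>. Continuity extends this from dyadic points,
  \<open>q l\<close> being the rounding down of \<open>u\<close> to level \<open>l\<close>.\<close>

lemma dyadic_chaining:
  fixes f :: "real \<Rightarrow> 'a::real_normed_vector"
  assumes cont: "continuous_on {a..a + h} f" and h: "h > 0" and \<rho>: "0 < \<rho>" "\<rho> < 1" and R: "R \<ge> 0"
    and step: "\<And>l m. m < 2 ^ l \<Longrightarrow>
      norm (f (a + h * real (Suc m) / 2 ^ l) - f (a + h * real m / 2 ^ l)) \<le> R * \<rho> ^ l"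
    and s: "s \<in> {a..a + h}"
  shows "norm (f s - f a) \<le> R / (1 - \<rho>)"
proof -
  have dyadic: "norm (f (a + h * real m / 2 ^ l) - f a) \<le> (\<Sum>k\<le>l. R * \<rho> ^ k)" if "m \<le> 2 ^ l" for l m
    using that
  proof (induction l arbitrary: m)
    case 0
    then have "m = 0 \<or> m = 1" by auto
    then show ?case using step[of 0 0] R by auto
  next
    case (Suc l)
    have even: "norm (f (a + h * real (2 * j) / 2 ^ Suc l) - f a) \<le> (\<Sum>k\<le>l. R * \<rho> ^ k)" if "2 * j \<le> 2 ^ Suc l" for j
    proof -
      have "a + h * real (2 * j) / 2 ^ Suc l = a + h * real j / 2 ^ l" by simp
      then show ?thesis using Suc.IH[of j] that by simp
    qed
    show ?case
    proof (cases "even m")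
      case True
      then obtain j where "m = 2 * j" by blast
      then have "norm (f (a + h * real m / 2 ^ Suc l) - f a) \<le> (\<Sum>k\<le>l. R * \<rho> ^ k)"
        using even[of j] Suc.prems by simp
      also have "\<dots> \<le> (\<Sum>k\<le>Suc l. R * \<rho> ^ k)" using R \<rho> by simp
      finally show ?thesis .
    next
      case False
      then obtain j where m: "m = Suc (2 * j)" by (metis oddE Suc_eq_plus1)
      have "f (a + h * real m / 2 ^ Suc l) - f a =
        (f (a + h * real (Suc (2 * j)) / 2 ^ Suc l) - f (a + h * real (2 * j) / 2 ^ Suc l)) +
        (f (a + h * real (2 * j) / 2 ^ Suc l) - f a)" by (simp add: m)
      then have "norm (f (a + h * real m / 2 ^ Suc l) - f a)
        \<le> norm (f (a + h * real (Suc (2 * j)) / 2 ^ Suc l) - f (a + h * real (2 * j) / 2 ^ Suc l)) +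
          norm (f (a + h * real (2 * j) / 2 ^ Suc l) - f a)" by (metis norm_triangle_ineq)
      also have "\<dots> \<le> R * \<rho> ^ Suc l + (\<Sum>k\<le>l. R * \<rho> ^ k)"
        using m Suc.prems by (intro add_mono step even) auto
      finally show ?thesis by simp
    qed
  qed
  have geometric: "(\<Sum>k\<le>l. R * \<rho> ^ k) \<le> R / (1 - \<rho>)" for l
  proof -
    have "(\<Sum>k\<le>l. \<rho> ^ k) \<le> (\<Sum>k. \<rho> ^ k)"
      using \<rho> by (intro sum_le_suminf summable_geometric) auto
    also have "\<dots> = 1 / (1 - \<rho>)" using \<rho> by (intro suminf_geometric) auto
    finally have "R * (\<Sum>k\<le>l. \<rho> ^ k) \<le> R * (1 / (1 - \<rho>))" using R by (rule mult_left_mono)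
    then show ?thesis by (simp add: sum_distrib_left)
  qed
  define u where "u = (s - a) / h"
  have u: "0 \<le> u" "u \<le> 1" "s = a + h * u" using s h by (auto simp: u_def field_simps)
  define q where "q l = real (nat \<lfloor>u * 2 ^ l\<rfloor>) / 2 ^ l" for l :: nat
  have q_bounds: "q l \<le> u" "u - (1 / 2) ^ l \<le> q l" "0 \<le> q l" for l
  proof -
    have nn: "0 \<le> u * 2 ^ l" using u by simp
    have "real (nat \<lfloor>u * 2 ^ l\<rfloor>) = of_int \<lfloor>u * 2 ^ l\<rfloor>" using nn by simp
    then have "real (nat \<lfloor>u * 2 ^ l\<rfloor>) \<le> u * 2 ^ l" "u * 2 ^ l - 1 \<le> real (nat \<lfloor>u * 2 ^ l\<rfloor>)"
      by linarith+
    then show "q l \<le> u" "u - (1 / 2) ^ l \<le> q l" "0 \<le> q l"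
      unfolding q_def by (auto simp: pos_divide_le_eq pos_le_divide_eq left_diff_distrib power_one_over simp del: of_nat_nat)
  qed
  have "q \<longlonglongrightarrow> u"
  proof (rule tendsto_sandwich)
    show "\<forall>\<^sub>F l in sequentially. u - (1 / 2) ^ l \<le> q l" "\<forall>\<^sub>F l in sequentially. q l \<le> u"
      using q_bounds by auto
    have "(\<lambda>l. u - (1 / 2) ^ l) \<longlonglongrightarrow> u - 0"
      by (intro tendsto_diff tendsto_const LIMSEQ_realpow_zero) auto
    then show "(\<lambda>l. u - (1 / 2) ^ l) \<longlonglongrightarrow> u" by simp
  qed simp
  then have "(\<lambda>l. a + h * q l) \<longlonglongrightarrow> s"
    unfolding u(3) by (intro tendsto_intros)
  moreover have in_ivl: "a + h * q l \<in> {a..a + h}" for l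
  proof -
    have "q l \<le> 1" using q_bounds(1)[of l] u(2) by linarith
    then show ?thesis using q_bounds(3)[of l] h by simp
  qed
  ultimately have "(\<lambda>l. f (a + h * q l)) \<longlonglongrightarrow> f s"
    using cont s by (intro continuous_on_tendsto_compose[OF cont]) auto
  then have "(\<lambda>l. norm (f (a + h * q l) - f a)) \<longlonglongrightarrow> norm (f s - f a)"
    by (intro tendsto_intros)
  then show ?thesis
  proof (rule LIMSEQ_le_const2, intro exI allI impI)
    fix l
    have "q l \<le> 1" using q_bounds(1)[of l] u(2) by linarith
    then have "nat \<lfloor>u * 2 ^ l\<rfloor> \<le> 2 ^ l"
      by (simp add: q_def field_simps)
    from dyadic[OF this] show "norm (f (a + h * q l) - f a) \<le> R / (1 - \<rho>)"
      using geometric[of l] by (simp add: q_def)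
  qed
qed

text \<open>Level \<open>l\<close> increments have typical size 2^(-l/2); asking only for the decay
  2^(-l/4) leaves room for the maximum over 2^l of them. The power
  \<open>oscillation_ratio ^ (4 * n * l)\<close> is the reciprocal of the weight
  \<open>2 ^ (l * n)\<close> used for level \<open>l\<close>.\<close>

definition oscillation_ratio :: real where
  "oscillation_ratio = 2 powr (- 1 / 4)"

lemma oscillation_ratio: "0 < oscillation_ratio" "oscillation_ratio < 1"
  by (auto simp: oscillation_ratio_def powr_less_one)

lemma oscillation_ratio_power: "oscillation_ratio ^ (4 * n) = 1 / 2 ^ n"
proof -
  have "oscillation_ratio ^ 4 = 1 / 2"
    unfolding oscillation_ratio_def by (subst powr_power) (auto simp: powr_minus_divide)
  then show ?thesis by (simp only: power_mult power_one_over)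
qed

text \<open>The first factor is the chaining constant raised to the power \<open>4 * n\<close>, the
  2 sums a geometric series over the levels, and the rest is the Gaussian moment constant of order
  \<open>4 * n\<close>.\<close>

definition oscillation_const :: "'a::euclidean_space itself \<Rightarrow> nat \<Rightarrow> real" where
  "oscillation_const _ n = (1 / (1 - oscillation_ratio)) ^ (4 * n) *
     (2 * (fact (2 * n) * 4 ^ (2 * n) * sqrt 2 ^ DIM('a)))"

lemma oscillation_const_nonneg: "0 \<le> oscillation_const TYPE('a::euclidean_space) n"
  unfolding oscillation_const_def using oscillation_ratio by (intro mult_nonneg_nonneg) auto

context standard_brownian_motion
begin

text \<open>A measurable substitute for the oscillation over \<open>[a, a + h]\<close>. The weights \<open>2\<^bsup>l n\<^esup>\<close> force the level \<open>l\<close>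
  increments to decay geometrically in \<open>l\<close>, yet are small enough to keep the expectation finite.\<close>

definition dyadic_variation :: "nat \<Rightarrow> real \<Rightarrow> real \<Rightarrow> 'w \<Rightarrow> ennreal" where
  "dyadic_variation n a h \<omega> = (\<Sum>l. \<Sum>m<2 ^ l. ennreal (2 ^ (l * n) *
     norm (B (a + h * real (Suc m) / 2 ^ l) \<omega> - B (a + h * real m / 2 ^ l) \<omega>) ^ (4 * n)))"

lemma dyadic_times:
  assumes "0 \<le> a" "0 < h"
  shows "0 \<le> a + h * real m / 2 ^ l" "a + h * real m / 2 ^ l < a + h * real (Suc m) / 2 ^ l"
    "(a + h * real (Suc m) / 2 ^ l) - (a + h * real m / 2 ^ l) = h / 2 ^ l"
  using assms by (auto simp: field_simps)

lemma measurable_dyadic_variation [measurable]: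
  assumes "0 \<le> a" "0 < h"
  shows "dyadic_variation n a h \<in> borel_measurable M"
proof -
  note [measurable] = measurable_increment[OF dyadic_times(1,2)[OF assms]]
  show ?thesis unfolding dyadic_variation_def by measurable
qed

text \<open>Level \<open>l\<close> has \<open>2 ^ l\<close> increments, each of weighted moment
  \<open>2 ^ (l * n) * K * (h / 2 ^ l) ^ (2 * n)\<close>. The powers of 2 combine to 2^(l (1 - n)),
  at most 2^(-l) because \<open>n \<ge> 2\<close>.\<close>

lemma nn_integral_dyadic_variation_le:
  assumes "0 \<le> a" "0 < h" "2 \<le> n"
  shows "(\<integral>\<^sup>+\<omega>. dyadic_variation n a h \<omega> \<partial>M)
    \<le> ennreal (2 * (fact (2 * n) * 4 ^ (2 * n) * sqrt 2 ^ DIM('a)) * h ^ (2 * n))"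
proof -
  define K where "K = fact (2 * n) * 4 ^ (2 * n) * sqrt 2 ^ DIM('a)"
  have K: "K \<ge> 0" by (simp add: K_def)
  note [measurable] = measurable_increment[OF dyadic_times(1,2)[OF assms(1,2)]]
  have "(\<integral>\<^sup>+\<omega>. dyadic_variation n a h \<omega> \<partial>M) = (\<Sum>l. \<Sum>m<2 ^ l. (\<integral>\<^sup>+\<omega>. ennreal (2 ^ (l * n) *
     norm (B (a + h * real (Suc m) / 2 ^ l) \<omega> - B (a + h * real m / 2 ^ l) \<omega>) ^ (4 * n)) \<partial>M))"
    unfolding dyadic_variation_def by (simp add: nn_integral_suminf nn_integral_sum del: sum_ennreal of_nat_Suc)
  also have "\<dots> \<le> (\<Sum>l. ennreal (K * h ^ (2 * n) * (1 / 2) ^ l))"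
  proof (intro suminf_le summableI)
    fix l
    have "(\<Sum>m<2 ^ l. (\<integral>\<^sup>+\<omega>. ennreal (2 ^ (l * n) *
     norm (B (a + h * real (Suc m) / 2 ^ l) \<omega> - B (a + h * real m / 2 ^ l) \<omega>) ^ (4 * n)) \<partial>M))
     \<le> (\<Sum>m<(2::nat) ^ l. ennreal (2 ^ (l * n) * (K * (h / 2 ^ l) ^ (2 * n))))"
    proof (intro sum_mono)
      fix m
      have "(\<integral>\<^sup>+\<omega>. ennreal (2 ^ (l * n) *
          norm (B (a + h * real (Suc m) / 2 ^ l) \<omega> - B (a + h * real m / 2 ^ l) \<omega>) ^ (4 * n)) \<partial>M)
        = (\<integral>\<^sup>+x. ennreal (2 ^ (l * n) * norm (x :: 'a) ^ (4 * n)) \<partial>gauss (h / 2 ^ l))"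
        using nn_integral_increment[OF dyadic_times(1,2)[OF assms(1,2)],
            of "\<lambda>x. ennreal (2 ^ (l * n) * norm x ^ (4 * n))" m l]
        by (simp only: dyadic_times(3)[OF assms(1,2)]) measurable
      also have "\<dots> = ennreal (2 ^ (l * n)) * (\<integral>\<^sup>+x. ennreal (norm (x :: 'a) ^ (2 * (2 * n))) \<partial>gauss (h / 2 ^ l))"
        by (simp add: ennreal_mult nn_integral_cmult)
      also have "\<dots> \<le> ennreal (2 ^ (l * n)) * ennreal (K * (h / 2 ^ l) ^ (2 * n))"
        unfolding K_def using assms by (intro mult_left_mono nn_integral_norm_power_gauss_le) auto
      also have "\<dots> = ennreal (2 ^ (l * n) * (K * (h / 2 ^ l) ^ (2 * n)))"
        using K assms by (intro ennreal_mult[symmetric]) auto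
      finally show "(\<integral>\<^sup>+\<omega>. ennreal (2 ^ (l * n) *
          norm (B (a + h * real (Suc m) / 2 ^ l) \<omega> - B (a + h * real m / 2 ^ l) \<omega>) ^ (4 * n)) \<partial>M)
        \<le> ennreal (2 ^ (l * n) * (K * (h / 2 ^ l) ^ (2 * n)))" .
    qed
    also have "\<dots> = ennreal (2 ^ l * (2 ^ (l * n) * (K * (h / 2 ^ l) ^ (2 * n))))"
      using K assms by (simp add: ennreal_mult ennreal_of_nat_eq_real_of_nat)
    also have "\<dots> \<le> ennreal (K * h ^ (2 * n) * (1 / 2) ^ l)"
    proof (rule ennreal_leI)
      have "(2::real) ^ l * 2 ^ (l * n) * 2 ^ l \<le> 2 ^ (l * (2 * n))"
      proof -
        have "l + l * n + l \<le> l * (2 * n)"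
        proof -
          have "l * 2 \<le> l * n" using assms(3) by (rule mult_le_mono2)
          moreover have "l * (2 * n) = l * n + l * n" by simp
          ultimately show ?thesis by linarith
        qed
        then have "(2::real) ^ (l + l * n + l) \<le> 2 ^ (l * (2 * n))" by (intro power_increasing) auto
        then show ?thesis by (simp add: power_add)
      qed
      then have "2 ^ l * 2 ^ (l * n) / 2 ^ (l * (2 * n)) \<le> (1 / 2 :: real) ^ l"
        by (simp add: field_simps)
      then have "K * h ^ (2 * n) * (2 ^ l * 2 ^ (l * n) / 2 ^ (l * (2 * n))) \<le> K * h ^ (2 * n) * (1 / 2) ^ l"
        using K assms by (intro mult_left_mono) auto
      then show "2 ^ l * (2 ^ (l * n) * (K * (h / 2 ^ l) ^ (2 * n))) \<le> K * h ^ (2 * n) * (1 / 2) ^ l"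
        by (simp add: power_divide power_mult[symmetric] mult_ac)
    qed
    finally show "(\<Sum>m<2 ^ l. (\<integral>\<^sup>+\<omega>. ennreal (2 ^ (l * n) *
     norm (B (a + h * real (Suc m) / 2 ^ l) \<omega> - B (a + h * real m / 2 ^ l) \<omega>) ^ (4 * n)) \<partial>M))
      \<le> ennreal (K * h ^ (2 * n) * (1 / 2) ^ l)" .
  qed
  also have "\<dots> = ennreal (K * h ^ (2 * n) * 2)"
  proof (rule suminf_ennreal_eq)
    show "(\<lambda>l. K * h ^ (2 * n) * (1 / 2) ^ l) sums (K * h ^ (2 * n) * 2)"
      using geometric_sums[of "1 / 2 :: real"] by (intro sums_mult) simp
  qed (use K assms in auto)
  finally show ?thesis by (simp add: K_def mult_ac)
qed

text \<open>After taking a root of order \<open>4 * n\<close>, the weights of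
  \<open>dyadic_variation\<close> turn into geometric decay of the increments, so
  \<open>dyadic_chaining\<close> applies to almost every path. The result replaces an uncountable
  supremum by a measurable variable.\<close>

lemma oscillation_bound:
  assumes "0 \<le> a" "0 < h" "2 \<le> n"
  obtains X where "X \<in> borel_measurable M" "\<And>\<omega>. 0 \<le> X \<omega>"
    "AE \<omega> in M. \<forall>s\<in>{a..a + h}. norm (B s \<omega> - B a \<omega>) \<le> X \<omega>"
    "(\<integral>\<^sup>+\<omega>. ennreal (X \<omega> ^ (4 * n)) \<partial>M) \<le> ennreal (oscillation_const TYPE('a) n * h ^ (2 * n))"
proof
  define \<kappa> where "\<kappa> = 1 / (1 - oscillation_ratio)"
  have \<kappa>: "\<kappa> \<ge> 0" using oscillation_ratio by (simp add: \<kappa>_def)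
  \<comment> \<open>\<open>enn2real\<close> sends \<open>\<infinity>\<close> to 0, where the bound
    would be false; finite expectation confines this to a null set.\<close>
  define R where "R \<omega> = root (4 * n) (enn2real (dyadic_variation n a h \<omega>))" for \<omega>
  have n: "4 * n > 0" using assms by simp
  have R_nonneg: "0 \<le> R \<omega>" for \<omega> unfolding R_def using n by (intro real_root_ge_zero) auto
  have R_pow: "R \<omega> ^ (4 * n) = enn2real (dyadic_variation n a h \<omega>)" for \<omega>
    unfolding R_def using n by (intro real_root_pow_pos2) auto
  define X where "X \<omega> = \<kappa> * R \<omega>" for \<omega>
  note [measurable] = measurable_dyadic_variation[OF assms(1,2)]
  show "X \<in> borel_measurable M" unfolding X_def R_def by measurable
  show "0 \<le> X \<omega>" for \<omega> using \<kappa> R_nonneg by (simp add: X_def)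
  have int: "(\<integral>\<^sup>+\<omega>. dyadic_variation n a h \<omega> \<partial>M)
    \<le> ennreal (2 * (fact (2 * n) * 4 ^ (2 * n) * sqrt 2 ^ DIM('a)) * h ^ (2 * n))"
    by (rule nn_integral_dyadic_variation_le) fact+
  have "AE \<omega> in M. dyadic_variation n a h \<omega> \<noteq> \<infinity>"
    using int by (intro nn_integral_PInf_AE) (auto simp: top_unique)
  with continuous_paths show "AE \<omega> in M. \<forall>s\<in>{a..a + h}. norm (B s \<omega> - B a \<omega>) \<le> X \<omega>"
  proof eventually_elim
    case (elim \<omega>)
    show ?case
    proof
      fix s assume s: "s \<in> {a..a + h}"
      have "norm (B s \<omega> - B a \<omega>) \<le> R \<omega> / (1 - oscillation_ratio)"
      proof (rule dyadic_chaining[OF _ assms(2) oscillation_ratio R_nonneg _ s])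
        show "continuous_on {a..a + h} (\<lambda>s. B s \<omega>)"
          using elim(1) assms by (rule_tac continuous_on_subset) auto
        fix l m :: nat assume m: "m < 2 ^ l"
        define D where "D m = norm (B (a + h * real (Suc m) / 2 ^ l) \<omega> - B (a + h * real m / 2 ^ l) \<omega>)" for m
        have D: "0 \<le> D m" by (simp add: D_def)
        have "ennreal (2 ^ (l * n) * D m ^ (4 * n)) \<le> (\<Sum>m<2 ^ l. ennreal (2 ^ (l * n) * D m ^ (4 * n)))"
          using m by (intro member_le_sum) auto
        also have "\<dots> \<le> dyadic_variation n a h \<omega>"
          using sum_le_suminf[of "\<lambda>l. \<Sum>m<2 ^ l. ennreal (2 ^ (l * n) *
            norm (B (a + h * real (Suc m) / 2 ^ l) \<omega> - B (a + h * real m / 2 ^ l) \<omega>) ^ (4 * n))" "{l}"]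
          unfolding dyadic_variation_def D_def by simp
        also have "\<dots> = ennreal (R \<omega> ^ (4 * n))"
          unfolding R_pow using elim(2) by (simp add: ennreal_enn2real_if)
        finally have "2 ^ (l * n) * D m ^ (4 * n) \<le> R \<omega> ^ (4 * n)"
          using R_nonneg by (subst (asm) ennreal_le_iff) auto
        then have "D m ^ (4 * n) \<le> R \<omega> ^ (4 * n) * (1 / 2 ^ (l * n))" by (simp add: field_simps)
        also have "\<dots> = R \<omega> ^ (4 * n) * oscillation_ratio ^ (4 * n * l)"
          using oscillation_ratio_power[of "n * l"] by (simp add: mult_ac)
        also have "\<dots> = (R \<omega> * oscillation_ratio ^ l) ^ (4 * n)"
          by (simp add: power_mult_distrib power_mult[symmetric] mult_ac)
        finally have "D m \<le> R \<omega> * oscillation_ratio ^ l"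
          using n oscillation_ratio R_nonneg D by (subst (asm) power_mono_iff) auto
        then show "norm (B (a + h * real (Suc m) / 2 ^ l) \<omega> - B (a + h * real m / 2 ^ l) \<omega>)
          \<le> R \<omega> * oscillation_ratio ^ l" by (simp add: D_def)
      qed
      then show "norm (B s \<omega> - B a \<omega>) \<le> X \<omega>" by (simp add: X_def \<kappa>_def)
    qed
  qed
  have "(\<integral>\<^sup>+\<omega>. ennreal (X \<omega> ^ (4 * n)) \<partial>M) \<le> (\<integral>\<^sup>+\<omega>. ennreal (\<kappa> ^ (4 * n)) * dyadic_variation n a h \<omega> \<partial>M)"
  proof (intro nn_integral_mono)
    fix \<omega>
    have "ennreal (X \<omega> ^ (4 * n)) = ennreal (\<kappa> ^ (4 * n)) * ennreal (enn2real (dyadic_variation n a h \<omega>))"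
      using \<kappa> by (simp add: X_def power_mult_distrib R_pow ennreal_mult)
    also have "\<dots> \<le> ennreal (\<kappa> ^ (4 * n)) * dyadic_variation n a h \<omega>"
      by (intro mult_left_mono) (auto simp: ennreal_enn2real_if)
    finally show "ennreal (X \<omega> ^ (4 * n)) \<le> ennreal (\<kappa> ^ (4 * n)) * dyadic_variation n a h \<omega>" .
  qed
  also have "\<dots> \<le> ennreal (\<kappa> ^ (4 * n)) *
      ennreal (2 * (fact (2 * n) * 4 ^ (2 * n) * sqrt 2 ^ DIM('a)) * h ^ (2 * n))"
    using int by (subst nn_integral_cmult) (auto intro: mult_left_mono)
  also have "\<dots> = ennreal (oscillation_const TYPE('a) n * h ^ (2 * n))"
    using \<kappa> assms by (simp add: ennreal_mult[symmetric] oscillation_const_def \<kappa>_def mult_ac)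
  finally show "(\<integral>\<^sup>+\<omega>. ennreal (X \<omega> ^ (4 * n)) \<partial>M) \<le> ennreal (oscillation_const TYPE('a) n * h ^ (2 * n))" .
qed

end

section \<open>Second moment of the total interaction\<close>

context standard_brownian_motion
begin

definition interaction :: "real \<Rightarrow> nat \<Rightarrow> nat \<Rightarrow> 'w \<Rightarrow> real" where
  "interaction v i j \<omega> = cutoff_kernel v (B (real j * v) \<omega> - B (real i * v) \<omega>)"

lemma interaction_commute: "interaction v i j \<omega> = interaction v j i \<omega>"
  unfolding interaction_def by (rule cutoff_kernel_commute)

lemma interaction_nonneg: "v > 0 \<Longrightarrow> 0 \<le> interaction v i j \<omega>"
  unfolding interaction_def by (rule cutoff_kernel_nonneg)

lemma measurable_interaction [measurable]:
  assumes "v > 0"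
  shows "interaction v i j \<in> borel_measurable M"
proof -
  have [measurable]: "B (real k * v) \<in> borel_measurable M" for k
    using assms by (intro measurable) simp
  show ?thesis unfolding interaction_def by measurable
qed

text \<open>The estimate \<open>1 / (v + 2 * m * v)\<close> for \<open>m = j - i\<close> is weakened
  to a form that sums directly to harmonic numbers and agrees with the kernel value
  \<open>1 / v\<close> at \<open>m = 0\<close>.\<close>

lemma nn_integral_cutoff_kernel_gauss_steps_le:
  fixes y :: 'a
  assumes "DIM('a) = 4" and v: "v > 0" and "i < j"
  shows "(\<integral>\<^sup>+x. ennreal (cutoff_kernel v (y + x)) \<partial>gauss (real j * v - real i * v))
    \<le> ennreal (1 / (v * (real (j - i) + 1)))"
proof -
  have w: "real j * v - real i * v = real (j - i) * v"
    using assms by (simp add: of_nat_diff left_diff_distrib)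
  have "(\<integral>\<^sup>+x. ennreal (cutoff_kernel v (y + x)) \<partial>gauss (real j * v - real i * v))
    \<le> ennreal (1 / (v + 2 * (real (j - i) * v)))"
  proof -
    have "0 < real (j - i) * v" using v \<open>i < j\<close> by simp
    from nn_integral_cutoff_kernel_gauss_le[OF assms(1) v this, of y] show ?thesis unfolding w .
  qed
  also have "\<dots> \<le> ennreal (1 / (v * (real (j - i) + 1)))"
  proof (intro ennreal_leI divide_left_mono)
    have "0 \<le> v * real (j - i)" using v by simp
    then show "v * (real (j - i) + 1) \<le> v + 2 * (real (j - i) * v)" by (simp add: algebra_simps)
    show "0 < (v + 2 * (real (j - i) * v)) * (v * (real (j - i) + 1))"
      using v \<open>i < j\<close> by (intro mult_pos_pos add_pos_nonneg) auto
  qed auto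
  finally show ?thesis .
qed

lemma nn_integral_interaction_le:
  assumes d: "DIM('a) = 4" and v: "v > 0" and "i \<le> j"
  shows "(\<integral>\<^sup>+\<omega>. ennreal (interaction v i j \<omega>) \<partial>M) \<le> ennreal (1 / (v * (real (j - i) + 1)))"
proof (cases "i = j")
  case True
  then show ?thesis by (simp add: interaction_def cutoff_kernel_def emeasure_space_1)
next
  case False
  then have ij: "i < j" using assms by simp
  have "(\<integral>\<^sup>+\<omega>. ennreal (interaction v i j \<omega>) \<partial>M) =
    (\<integral>\<^sup>+x. ennreal (cutoff_kernel v (0 + x :: 'a)) \<partial>gauss (real j * v - real i * v))"
    unfolding interaction_def using v ij
    by (subst nn_integral_increment[where f = "\<lambda>x. ennreal (cutoff_kernel v x)"]) auto
  also have "\<dots> \<le> ennreal (1 / (v * (real (j - i) + 1)))"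
    using d v ij by (rule nn_integral_cutoff_kernel_gauss_steps_le)
  finally show ?thesis .
qed

text \<open>For distinct times the increment from \<open>j\<close> to \<open>k\<close> is integrated
  first, with a bound uniform in the increment from \<open>i\<close> to \<open>j\<close>; this is
  why \<open>k - j\<close> appears instead of \<open>k - i\<close>. Coinciding times are handled by
  the maximal kernel value \<open>1 / v\<close>.\<close>

lemma nn_integral_interaction_mult_le:
  assumes d: "DIM('a) = 4" and v: "v > 0" and ij: "i \<le> j" and jk: "j \<le> k"
  shows "(\<integral>\<^sup>+\<omega>. ennreal (interaction v i j \<omega> * interaction v i k \<omega>) \<partial>M)
    \<le> ennreal (1 / (v * (real (j - i) + 1)) * (1 / (v * (real (k - j) + 1))))"
proof -
  consider "i = j" | "j = k" | "i < j" "j < k" using ij jk by linarith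
  then show ?thesis
  proof cases
    case 1
    then have "(\<integral>\<^sup>+\<omega>. ennreal (interaction v i j \<omega> * interaction v i k \<omega>) \<partial>M)
      = ennreal (1 / v) * (\<integral>\<^sup>+\<omega>. ennreal (interaction v i k \<omega>) \<partial>M)"
    proof -
      have "interaction v i j \<omega> = 1 / v" for \<omega> using 1 by (simp add: interaction_def cutoff_kernel_def)
      then have "(\<integral>\<^sup>+\<omega>. ennreal (interaction v i j \<omega> * interaction v i k \<omega>) \<partial>M)
        = (\<integral>\<^sup>+\<omega>. ennreal (1 / v) * ennreal (interaction v i k \<omega>) \<partial>M)"
        using v interaction_nonneg[OF v] by (simp only: ennreal_mult zero_le_divide_1_iff less_imp_le)
      also have "\<dots> = ennreal (1 / v) * (\<integral>\<^sup>+\<omega>. ennreal (interaction v i k \<omega>) \<partial>M)"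
        using v by (intro nn_integral_cmult) simp
      finally show ?thesis .
    qed
    also have "\<dots> \<le> ennreal (1 / v) * ennreal (1 / (v * (real (k - i) + 1)))"
      using d v ij jk by (intro mult_left_mono nn_integral_interaction_le) auto
    finally show ?thesis using v 1 by (simp add: ennreal_mult[symmetric])
  next
    case 2
    have "(\<integral>\<^sup>+\<omega>. ennreal (interaction v i j \<omega> * interaction v i k \<omega>) \<partial>M)
      \<le> (\<integral>\<^sup>+\<omega>. ennreal (1 / v) * ennreal (interaction v i j \<omega>) \<partial>M)"
    proof (intro nn_integral_mono)
      fix \<omega>
      have "interaction v i j \<omega> * interaction v i k \<omega> \<le> 1 / v * interaction v i j \<omega>"
        unfolding 2 using v cutoff_kernel_le[OF v] interaction_nonneg[OF v]
        by (intro mult_right_mono) (auto simp: interaction_def)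
      then show "ennreal (interaction v i j \<omega> * interaction v i k \<omega>) \<le> ennreal (1 / v) * ennreal (interaction v i j \<omega>)"
        using v interaction_nonneg[OF v] by (simp add: ennreal_mult[symmetric] ennreal_leI)
    qed
    also have "\<dots> = ennreal (1 / v) * (\<integral>\<^sup>+\<omega>. ennreal (interaction v i j \<omega>) \<partial>M)"
      using v by (intro nn_integral_cmult) simp
    also have "\<dots> \<le> ennreal (1 / v) * ennreal (1 / (v * (real (j - i) + 1)))"
      using d v ij by (intro mult_left_mono nn_integral_interaction_le) auto
    finally show ?thesis using v 2 by (simp add: ennreal_mult[symmetric] mult.commute)
  next
    case 3
    let ?f = "\<lambda>x y. ennreal (cutoff_kernel v (x :: 'a) * cutoff_kernel v (x + y))"
    have times: "0 \<le> real i * v" "real i * v < real j * v" "real j * v < real k * v"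
      using v 3 by auto
    have "(\<integral>\<^sup>+\<omega>. ennreal (interaction v i j \<omega> * interaction v i k \<omega>) \<partial>M)
      = (\<integral>\<^sup>+\<omega>. ?f (B (real j * v) \<omega> - B (real i * v) \<omega>) (B (real k * v) \<omega> - B (real j * v) \<omega>) \<partial>M)"
      by (simp add: interaction_def)
    also have "\<dots> = (\<integral>\<^sup>+x. (\<integral>\<^sup>+y. ?f x y \<partial>gauss (real k * v - real j * v)) \<partial>gauss (real j * v - real i * v))"
      using times by (rule nn_integral_two_increments) measurable
    also have "\<dots> \<le> (\<integral>\<^sup>+x. ennreal (1 / (v * (real (k - j) + 1))) * ennreal (cutoff_kernel v (0 + x :: 'a))
        \<partial>gauss (real j * v - real i * v))"
    proof (intro nn_integral_mono)
      fix x :: 'a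
      have "(\<integral>\<^sup>+y. ?f x y \<partial>gauss (real k * v - real j * v))
        = ennreal (cutoff_kernel v x) * (\<integral>\<^sup>+y. ennreal (cutoff_kernel v (x + y)) \<partial>gauss (real k * v - real j * v))"
        using v by (simp add: ennreal_mult cutoff_kernel_nonneg nn_integral_cmult)
      also have "\<dots> \<le> ennreal (cutoff_kernel v x) * ennreal (1 / (v * (real (k - j) + 1)))"
        using d v 3 by (intro mult_left_mono nn_integral_cutoff_kernel_gauss_steps_le) auto
      finally show "(\<integral>\<^sup>+y. ?f x y \<partial>gauss (real k * v - real j * v))
        \<le> ennreal (1 / (v * (real (k - j) + 1))) * ennreal (cutoff_kernel v (0 + x))"
        by (simp add: mult.commute)
    qed
    also have "\<dots> = ennreal (1 / (v * (real (k - j) + 1))) *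
        (\<integral>\<^sup>+x. ennreal (cutoff_kernel v (0 + x :: 'a)) \<partial>gauss (real j * v - real i * v))"
      by (rule nn_integral_cmult) measurable
    also have "\<dots> \<le> ennreal (1 / (v * (real (k - j) + 1))) * ennreal (1 / (v * (real (j - i) + 1)))"
      using d v 3 by (intro mult_left_mono nn_integral_cutoff_kernel_gauss_steps_le) auto
    also have "\<dots> = ennreal (1 / (v * (real (k - j) + 1)) * (1 / (v * (real (j - i) + 1))))"
      using v by (intro ennreal_mult[symmetric]) auto
    finally show ?thesis by (simp only: mult.commute)
  qed
qed

lemma sum_inverse_from_le_harm:
  "(\<Sum>j\<in>{i..<n}. 1 / (real (j - i) + 1)) \<le> harm n"
proof -
  have "(\<Sum>j\<in>{i..<n}. 1 / (real (j - i) + 1)) = (\<Sum>m<n - i. inverse (real (Suc m)))"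
    by (rule sum.reindex_bij_witness[of _ "\<lambda>m. m + i" "\<lambda>j. j - i"]) (auto simp: inverse_eq_divide add.commute)
  also have "\<dots> = harm (n - i)" by (simp add: harm_altdef)
  also have "\<dots> \<le> harm n" by (intro harm_mono) simp
  finally show ?thesis .
qed

text \<open>\<open>b j k\<close> bounds a mixed moment with ordered times, and adding
  \<open>b k j\<close> covers the other order. Summing first over the later time and then over the
  earlier one gives one factor \<open>harm n / v\<close> each.\<close>

lemma nn_integral_future_interaction_square_le:
  assumes d: "DIM('a) = 4" and v: "v > 0"
  shows "(\<integral>\<^sup>+\<omega>. ennreal ((\<Sum>j\<in>{i..<n}. interaction v i j \<omega>)\<^sup>2) \<partial>M) \<le> ennreal (2 * (harm n)\<^sup>2 / v\<^sup>2)"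
proof -
  define a where "a m = 1 / (v * (real m + 1))" for m
  have a: "0 \<le> a m" for m using v by (simp add: a_def)
  have a_sum: "(\<Sum>j\<in>{i..<n}. a (j - i)) \<le> harm n / v" for i
  proof -
    have "(\<Sum>j\<in>{i..<n}. a (j - i)) = 1 / v * (\<Sum>j\<in>{i..<n}. 1 / (real (j - i) + 1))"
      by (simp add: a_def sum_distrib_left)
    also have "\<dots> \<le> 1 / v * harm n" using v by (intro mult_left_mono sum_inverse_from_le_harm) auto
    finally show ?thesis by simp
  qed
  define b where "b j k = (if j \<le> k then a (j - i) * a (k - j) else 0)" for j k
  have b: "0 \<le> b j k" for j k using a by (simp add: b_def)
  have b_sum: "(\<Sum>j\<in>{i..<n}. \<Sum>k\<in>{i..<n}. b j k) \<le> (harm n)\<^sup>2 / v\<^sup>2"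
  proof -
    have "(\<Sum>j\<in>{i..<n}. \<Sum>k\<in>{i..<n}. b j k) = (\<Sum>j\<in>{i..<n}. a (j - i) * (\<Sum>k\<in>{j..<n}. a (k - j)))"
    proof (intro sum.cong refl)
      fix j assume j: "j \<in> {i..<n}"
      have "(\<Sum>k\<in>{i..<n}. b j k) = (\<Sum>k\<in>{j..<n}. b j k)"
        using j by (intro sum.mono_neutral_right) (auto simp: b_def)
      then show "(\<Sum>k\<in>{i..<n}. b j k) = a (j - i) * (\<Sum>k\<in>{j..<n}. a (k - j))"
        by (simp add: b_def sum_distrib_left)
    qed
    also have "\<dots> \<le> (\<Sum>j\<in>{i..<n}. a (j - i) * (harm n / v))"
      using a a_sum by (intro sum_mono mult_left_mono)
    also have "\<dots> = (\<Sum>j\<in>{i..<n}. a (j - i)) * (harm n / v)" by (rule sum_distrib_right[symmetric])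
    also have "\<dots> \<le> harm n / v * (harm n / v)"
      using v a_sum by (intro mult_right_mono) (auto simp: harm_nonneg)
    finally show ?thesis by (simp add: power2_eq_square)
  qed
  have "(\<integral>\<^sup>+\<omega>. ennreal ((\<Sum>j\<in>{i..<n}. interaction v i j \<omega>)\<^sup>2) \<partial>M)
    = (\<integral>\<^sup>+\<omega>. (\<Sum>j\<in>{i..<n}. \<Sum>k\<in>{i..<n}. ennreal (interaction v i j \<omega> * interaction v i k \<omega>)) \<partial>M)"
    using v by (simp add: power2_eq_square sum_product sum_ennreal sum_nonneg interaction_nonneg)
  also have "\<dots> = (\<Sum>j\<in>{i..<n}. \<Sum>k\<in>{i..<n}. (\<integral>\<^sup>+\<omega>. ennreal (interaction v i j \<omega> * interaction v i k \<omega>) \<partial>M))"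
    using v by (simp add: nn_integral_sum del: sum_ennreal)
  also have "\<dots> \<le> (\<Sum>j\<in>{i..<n}. \<Sum>k\<in>{i..<n}. ennreal (b j k + b k j))"
  proof (intro sum_mono)
    fix j k assume jk: "j \<in> {i..<n}" "k \<in> {i..<n}"
    show "(\<integral>\<^sup>+\<omega>. ennreal (interaction v i j \<omega> * interaction v i k \<omega>) \<partial>M) \<le> ennreal (b j k + b k j)"
    proof (cases "j \<le> k")
      case True
      have "(\<integral>\<^sup>+\<omega>. ennreal (interaction v i j \<omega> * interaction v i k \<omega>) \<partial>M) \<le> ennreal (b j k)"
        using nn_integral_interaction_mult_le[OF d v, of i j k] jk True by (simp add: b_def a_def)
      also have "\<dots> \<le> ennreal (b j k + b k j)" using b by (intro ennreal_leI) simp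
      finally show ?thesis .
    next
      case False
      have "(\<integral>\<^sup>+\<omega>. ennreal (interaction v i j \<omega> * interaction v i k \<omega>) \<partial>M) \<le> ennreal (b k j)"
        using nn_integral_interaction_mult_le[OF d v, of i k j] jk False by (simp add: b_def a_def mult.commute)
      also have "\<dots> \<le> ennreal (b j k + b k j)" using b by (intro ennreal_leI) simp
      finally show ?thesis .
    qed
  qed
  also have "\<dots> = ennreal ((\<Sum>j\<in>{i..<n}. \<Sum>k\<in>{i..<n}. b j k) + (\<Sum>j\<in>{i..<n}. \<Sum>k\<in>{i..<n}. b k j))"
    using b by (simp add: sum_ennreal sum_nonneg sum.distrib)
  also have "(\<Sum>j\<in>{i..<n}. \<Sum>k\<in>{i..<n}. b k j) = (\<Sum>j\<in>{i..<n}. \<Sum>k\<in>{i..<n}. b j k)"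
    by (rule sum.swap)
  also have "ennreal ((\<Sum>j\<in>{i..<n}. \<Sum>k\<in>{i..<n}. b j k) + (\<Sum>j\<in>{i..<n}. \<Sum>k\<in>{i..<n}. b j k))
    \<le> ennreal (2 * (harm n)\<^sup>2 / v\<^sup>2)"
    using b_sum by (intro ennreal_leI) simp
  finally show ?thesis .
qed

text \<open>By symmetry the double sum is at most twice the sum of the interactions of each
  \<open>i\<close> with its future, so only ordered times occur. Cauchy--Schwarz over
  \<open>i\<close> gives \<open>4 * n\<close> times a sum of \<open>n\<close> squares, each of mean
  at most \<open>2 * (harm n)^2 / v^2\<close>.\<close>

lemma nn_integral_interaction_square_le:
  assumes d: "DIM('a) = 4" and v: "v > 0"
  shows "(\<integral>\<^sup>+\<omega>. ennreal ((\<Sum>i<n. \<Sum>j<n. interaction v i j \<omega>)\<^sup>2) \<partial>M)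
    \<le> ennreal (8 * (real n)\<^sup>2 * (harm n)\<^sup>2 / v\<^sup>2)"
proof -
  define V where "V i \<omega> = (\<Sum>j\<in>{i..<n}. interaction v i j \<omega>)" for i \<omega>
  have V: "0 \<le> V i \<omega>" for i \<omega> using v by (simp add: V_def sum_nonneg interaction_nonneg)
  have [measurable]: "V i \<in> borel_measurable M" for i
    unfolding V_def using v by measurable
  have le: "(\<Sum>i<n. \<Sum>j<n. interaction v i j \<omega>)\<^sup>2 \<le> 4 * real n * (\<Sum>i<n. (V i \<omega>)\<^sup>2)" for \<omega>
  proof -
    define f where "f i j = (if i \<le> j then interaction v i j \<omega> else 0)" for i j
    have f: "(\<Sum>j<n. f i j) = V i \<omega>" if "i < n" for i
    proof -
      have "(\<Sum>j<n. f i j) = (\<Sum>j\<in>{i..<n}. f i j)"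
        by (intro sum.mono_neutral_right) (auto simp: f_def)
      then show ?thesis by (simp add: f_def V_def)
    qed
    have "(\<Sum>i<n. \<Sum>j<n. interaction v i j \<omega>) \<le> (\<Sum>i<n. \<Sum>j<n. f i j + f j i)"
      using interaction_nonneg[OF v] interaction_commute[of v]
      by (intro sum_mono) (auto simp: f_def)
    also have "\<dots> = (\<Sum>i<n. \<Sum>j<n. f i j) + (\<Sum>i<n. \<Sum>j<n. f j i)" by (simp add: sum.distrib)
    also have "(\<Sum>i<n. \<Sum>j<n. f j i) = (\<Sum>i<n. \<Sum>j<n. f i j)" by (rule sum.swap)
    also have "(\<Sum>i<n. \<Sum>j<n. f i j) + (\<Sum>i<n. \<Sum>j<n. f i j) = 2 * (\<Sum>i<n. V i \<omega>)"
      using f by simp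
    finally have "(\<Sum>i<n. \<Sum>j<n. interaction v i j \<omega>)\<^sup>2 \<le> (2 * (\<Sum>i<n. V i \<omega>))\<^sup>2"
      using v by (intro power_mono sum_nonneg interaction_nonneg)
    also have "\<dots> = 4 * (\<Sum>i<n. V i \<omega>)\<^sup>2" by (simp add: power_mult_distrib)
    also have "(\<Sum>i<n. V i \<omega>)\<^sup>2 \<le> (\<Sum>i<n. (V i \<omega>)\<^sup>2) * card {..<n}"
      by (rule sum_squared_le_sum_of_squares)
    finally show ?thesis by (simp add: mult_ac)
  qed
  have "(\<integral>\<^sup>+\<omega>. ennreal ((\<Sum>i<n. \<Sum>j<n. interaction v i j \<omega>)\<^sup>2) \<partial>M)
    \<le> (\<integral>\<^sup>+\<omega>. ennreal (4 * real n) * (\<Sum>i<n. ennreal ((V i \<omega>)\<^sup>2)) \<partial>M)"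
    using le by (intro nn_integral_mono) (simp add: ennreal_mult[symmetric] sum_nonneg ennreal_leI)
  also have "\<dots> = ennreal (4 * real n) * (\<Sum>i<n. (\<integral>\<^sup>+\<omega>. ennreal ((V i \<omega>)\<^sup>2) \<partial>M))"
    by (simp add: nn_integral_cmult nn_integral_sum del: sum_ennreal)
  also have "\<dots> \<le> ennreal (4 * real n) * (\<Sum>i<n. ennreal (2 * (harm n)\<^sup>2 / v\<^sup>2))"
    unfolding V_def using d v
    by (intro mult_left_mono sum_mono nn_integral_future_interaction_square_le) auto
  also have "\<dots> = ennreal (4 * real n * (real n * (2 * (harm n)\<^sup>2 / v\<^sup>2)))"
    by (simp add: ennreal_mult[symmetric] ennreal_of_nat_eq_real_of_nat)
  finally show ?thesis by (simp add: power2_eq_square mult_ac)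
qed

end

section \<open>Capacity of the sausage\<close>

lemma open_wiener_sausage: "open (wiener_sausage w r t)"
  unfolding wiener_sausage_def by auto

lemma wiener_sausage_subset:
  fixes w :: "real \<Rightarrow> 'a::euclidean_space"
  assumes v: "v > 0" and N: "t < real N * v"
    and X: "\<And>i s. i < N \<Longrightarrow> s \<in> {real i * v..real i * v + v} \<Longrightarrow> norm (w s - w (real i * v)) \<le> X i"
  shows "wiener_sausage w r t \<subseteq> (\<Union>i<N. ball (w (real i * v)) (r + X i))"
proof
  fix x assume "x \<in> wiener_sausage w r t"
  then obtain s where s: "0 \<le> s" "s \<le> t" "dist (w s) x < r"
    by (auto simp: wiener_sausage_def)
  define i where "i = nat \<lfloor>s / v\<rfloor>"
  have "real i = of_int \<lfloor>s / v\<rfloor>" using s v by (simp add: i_def)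
  then have "real i \<le> s / v" "s / v < real i + 1" by linarith+
  then have i: "real i * v \<le> s" "s < real i * v + v" using v by (auto simp: field_simps)
  have "real i * v < real N * v" using i s N by linarith
  then have "i < N" using v by simp
  have "dist (w (real i * v)) x \<le> dist (w (real i * v)) (w s) + dist (w s) x" by (rule dist_triangle)
  also have "\<dots> < X i + r"
    using X[OF \<open>i < N\<close>, of s] i s by (intro add_le_less_mono) (auto simp: dist_norm norm_minus_commute)
  finally have "x \<in> ball (w (real i * v)) (r + X i)" by simp
  then show "x \<in> (\<Union>i<N. ball (w (real i * v)) (r + X i))" using \<open>i < N\<close> by blast
qed

lemma power_add_le:
  fixes a b :: real
  assumes "0 \<le> a" "0 \<le> b"
  shows "(a + b) ^ n \<le> 2 ^ n * (a ^ n + b ^ n)"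
proof -
  have "(a + b) ^ n \<le> (2 * max a b) ^ n" using assms by (intro power_mono) auto
  also have "\<dots> = 2 ^ n * max (a ^ n) (b ^ n)"
    using assms by (auto simp: power_mult_distrib max_def power_mono intro: antisym)
  also have "\<dots> \<le> 2 ^ n * (a ^ n + b ^ n)" using assms by (intro mult_left_mono) auto
  finally show ?thesis .
qed

text \<open>AM-GM with \<open>c\<close> as the expected size of \<open>x\<close>: it raises the
  power of the oscillation to the one whose moment is known, without spoiling the order.\<close>

lemma power_mean_le:
  fixes x c :: real
  assumes "c > 0"
  shows "2 * x \<le> c + x\<^sup>2 / c"
proof -
  have "0 \<le> (x - c)\<^sup>2 / c" using assms by simp
  also have "(x - c)\<^sup>2 / c = x\<^sup>2 / c + c - 2 * x"
    using assms by (simp add: power2_eq_square field_simps)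
  finally show ?thesis by simp
qed

lemma newton_capacity_square_le:
  assumes "capacity_bound A c" "A \<in> sets borel"
  shows "(newton_capacity A)\<^sup>2 \<le> ennreal (c\<^sup>2)"
proof -
  have "(newton_capacity A)\<^sup>2 \<le> (ennreal c)\<^sup>2"
    by (intro power_mono newton_capacity_le[OF assms]) auto
  then show ?thesis using assms(1) by (simp add: capacity_bound_def ennreal_power)
qed

lemma number_of_steps:
  assumes "0 < v" "v \<le> t"
  obtains N where "t < real N * v" "real N * v \<le> 2 * t" "N > 0"
proof
  define N where "N = Suc (nat \<lfloor>t / v\<rfloor>)"
  have "real N = of_int \<lfloor>t / v\<rfloor> + 1" using assms by (simp add: N_def)
  then have N: "t / v < real N" "real N \<le> t / v + 1" by linarith+
  show "t < real N * v" using N(1) assms by (simp add: field_simps)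
  have "real N * v \<le> (t / v + 1) * v" using N(2) assms by (intro mult_right_mono) auto
  also have "\<dots> = t + v" using assms by (simp add: distrib_right)
  finally show "real N * v \<le> 2 * t" using assms by simp
  show "N > 0" by (simp add: N_def)
qed

context standard_brownian_motion
begin

lemma oscillation_family:
  assumes v: "0 < v" and "2 \<le> n"
  obtains X where "\<And>i. X i \<in> borel_measurable M" "\<And>i \<omega>. 0 \<le> X i \<omega>"
    "AE \<omega> in M. \<forall>i. \<forall>s\<in>{real i * v..real i * v + v}. norm (B s \<omega> - B (real i * v) \<omega>) \<le> X i \<omega>"
    "\<And>i. (\<integral>\<^sup>+\<omega>. ennreal (X i \<omega> ^ (4 * n)) \<partial>M) \<le> ennreal (oscillation_const TYPE('a) n * v ^ (2 * n))"
proof -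
  define P where "P i Y \<longleftrightarrow> Y \<in> borel_measurable M \<and> (\<forall>\<omega>. 0 \<le> Y \<omega>) \<and>
    (AE \<omega> in M. \<forall>s\<in>{real i * v..real i * v + v}. norm (B s \<omega> - B (real i * v) \<omega>) \<le> Y \<omega>) \<and>
    (\<integral>\<^sup>+\<omega>. ennreal (Y \<omega> ^ (4 * n)) \<partial>M) \<le> ennreal (oscillation_const TYPE('a) n * v ^ (2 * n))"
    for i :: nat and Y :: "'w \<Rightarrow> real"
  have "\<forall>i. \<exists>Y. P i Y"
  proof
    fix i
    have "0 \<le> real i * v" using v by simp
    from this v assms(2) show "\<exists>Y. P i Y"
      by (rule oscillation_bound) (auto simp: P_def)
  qed
  then obtain X where X: "\<forall>i. P i (X i)" by (rule choice[THEN exE])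
  show thesis
  proof (rule that[of X])
    show "X i \<in> borel_measurable M" "0 \<le> X i \<omega>"
      "(\<integral>\<^sup>+\<omega>. ennreal (X i \<omega> ^ (4 * n)) \<partial>M) \<le> ennreal (oscillation_const TYPE('a) n * v ^ (2 * n))" for i \<omega>
      using X unfolding P_def by blast+
    show "AE \<omega> in M. \<forall>i. \<forall>s\<in>{real i * v..real i * v + v}. norm (B s \<omega> - B (real i * v) \<omega>) \<le> X i \<omega>"
      unfolding AE_all_countable using X unfolding P_def by blast
  qed
qed

text \<open>The square of a sum of \<open>N\<close> ball bounds is at most \<open>N\<close> times
  the sum of their squares, and each square has mean of order \<open>v ^ n\<close> with
  \<open>n = d - 2\<close>. The total is of order
  \<open>N ^ 2 * v ^ n = (N * v) ^ 2 * v ^ (n - 2)\<close>.\<close>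

lemma nn_integral_capacity_square_le:
  defines "d \<equiv> DIM('a)"
  assumes d: "4 \<le> d" and r: "0 < r" "r\<^sup>2 \<le> t"
  shows "(\<integral>\<^sup>+\<omega>. (newton_capacity (wiener_sausage (\<lambda>s. B s \<omega>) r t))\<^sup>2 \<partial>M)
    \<le> ennreal (4 * 2 ^ (6 * (d - 2)) * (1 + oscillation_const TYPE('a) (d - 2)) / (newton_const TYPE('a))\<^sup>2
        * (t\<^sup>2 * r ^ (2 * (d - 4))))"
proof -
  define n where "n = d - 2"
  define v where "v = r\<^sup>2"
  define c where "c = newton_const TYPE('a)"
  define K where "K = oscillation_const TYPE('a) n"
  have n: "2 \<le> n" using d by (simp add: n_def)
  have v: "v > 0" using r by (simp add: v_def)
  have c: "c > 0" unfolding c_def using d by (intro newton_const_pos) (simp add: d_def)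
  have K: "K \<ge> 0" unfolding K_def by (rule oscillation_const_nonneg)
  obtain N where N: "t < real N * v" "real N * v \<le> 2 * t" "N > 0"
    using number_of_steps[of v t] v r by (auto simp: v_def)
  obtain X where X [measurable]: "\<And>i. X i \<in> borel_measurable M" and X_nonneg: "\<And>i \<omega>. 0 \<le> X i \<omega>"
    and X_AE: "AE \<omega> in M. \<forall>i. \<forall>s\<in>{real i * v..real i * v + v}. norm (B s \<omega> - B (real i * v) \<omega>) \<le> X i \<omega>"
    and X_int: "\<And>i. (\<integral>\<^sup>+\<omega>. ennreal (X i \<omega> ^ (4 * n)) \<partial>M) \<le> ennreal (K * v ^ (2 * n))"
    by (rule oscillation_family[OF v n, folded K_def], rule that)
  define D where "D = real N * 2 ^ (6 * n) / c\<^sup>2"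
  have D: "D \<ge> 0" by (simp add: D_def)
  have "(\<integral>\<^sup>+\<omega>. (newton_capacity (wiener_sausage (\<lambda>s. B s \<omega>) r t))\<^sup>2 \<partial>M)
    \<le> (\<integral>\<^sup>+\<omega>. (\<Sum>i<N. ennreal (D * v ^ n) + ennreal (D / v ^ n) * ennreal (X i \<omega> ^ (4 * n))) \<partial>M)"
  proof (rule nn_integral_mono_AE, use X_AE in eventually_elim)
    case (elim \<omega>)
    let ?W = "wiener_sausage (\<lambda>s. B s \<omega>) r t"
    let ?c = "\<lambda>i. (2 * (r + X i \<omega>)) ^ n / c"
    have "capacity_bound (\<Union>i<N. ball (B (real i * v) \<omega>) (r + X i \<omega>)) (\<Sum>i<N. ?c i)"
      unfolding c_def n_def d_def using d r X_nonneg
      by (intro capacity_bound_UN capacity_bound_ball) (auto simp: d_def add_pos_nonneg)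
    moreover have "?W \<subseteq> (\<Union>i<N. ball (B (real i * v) \<omega>) (r + X i \<omega>))"
      using elim by (intro wiener_sausage_subset v N) auto
    ultimately have "capacity_bound ?W (\<Sum>i<N. ?c i)" by (rule capacity_bound_subset)
    then have "(newton_capacity ?W)\<^sup>2 \<le> ennreal ((\<Sum>i<N. ?c i)\<^sup>2)"
      by (rule newton_capacity_square_le) (simp add: open_wiener_sausage borel_open)
    also have "\<dots> \<le> ennreal (\<Sum>i<N. D * v ^ n + D / v ^ n * X i \<omega> ^ (4 * n))"
    proof (rule ennreal_leI)
      have "(\<Sum>i<N. ?c i)\<^sup>2 \<le> (\<Sum>i<N. (?c i)\<^sup>2) * card {..<N}" by (rule sum_squared_le_sum_of_squares)
      also have "\<dots> = (\<Sum>i<N. real N * (?c i)\<^sup>2)"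
        by (subst mult.commute) (simp only: card_lessThan sum_distrib_left)
      also have "\<dots> \<le> (\<Sum>i<N. D * v ^ n + D / v ^ n * X i \<omega> ^ (4 * n))"
      proof (intro sum_mono)
        fix i
        define y where "y = (r + X i \<omega>) ^ (2 * n)"
        have y2: "y\<^sup>2 = (r + X i \<omega>) ^ (4 * n)" by (simp add: y_def power_mult[symmetric] mult.commute)
        \<comment> \<open>\<open>v ^ n = r ^ (2 * n)\<close> is the typical size of
          \<open>y\<close>; the square turns the power \<open>2 * n\<close> of the radius into
          \<open>4 * n\<close>, where \<open>X_int\<close> applies.\<close>
        have "y \<le> (v ^ n + y\<^sup>2 / v ^ n) / 2"
          using power_mean_le[of "v ^ n" y] v by simp
        also have "y\<^sup>2 \<le> 2 ^ (4 * n) * (r ^ (4 * n) + X i \<omega> ^ (4 * n))"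
          unfolding y2 using r X_nonneg by (intro power_add_le) auto
        also have "r ^ (4 * n) = v ^ n * v ^ n"
          by (simp add: v_def power_mult[symmetric] power_add[symmetric])
        finally have "y \<le> (v ^ n + 2 ^ (4 * n) * (v ^ n * v ^ n + X i \<omega> ^ (4 * n)) / v ^ n) / 2"
          using v by (simp add: divide_right_mono)
        also have "\<dots> = (v ^ n + 2 ^ (4 * n) * (v ^ n + X i \<omega> ^ (4 * n) / v ^ n)) / 2"
          using v by (simp add: add_divide_distrib distrib_left)
        also have "\<dots> \<le> 2 ^ (4 * n) * (v ^ n + X i \<omega> ^ (4 * n) / v ^ n)"
        proof -
          define z where "z = v ^ n + X i \<omega> ^ (4 * n) / v ^ n"
          have "v ^ n \<le> z" using v X_nonneg by (simp add: z_def)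
          moreover have "1 * z \<le> 2 ^ (4 * n) * z"
            using v X_nonneg by (intro mult_right_mono) (auto simp: z_def)
          ultimately have "v ^ n \<le> 2 ^ (4 * n) * z" by simp
          moreover have "(a + b) / 2 \<le> b" if "a \<le> b" for a b :: real using that by simp
          ultimately show ?thesis unfolding z_def[symmetric] by blast
        qed
        finally have y: "y \<le> 2 ^ (4 * n) * (v ^ n + X i \<omega> ^ (4 * n) / v ^ n)" .
        have "real N * (?c i)\<^sup>2 = real N * 2 ^ (2 * n) / c\<^sup>2 * y"
        proof -
          have "((2 * (r + X i \<omega>)) ^ n)\<^sup>2 = 2 ^ (2 * n) * (r + X i \<omega>) ^ (2 * n)"
            by (simp only: power_mult_distrib power_mult[symmetric] mult.commute[of n 2])
          then show ?thesis unfolding y_def power_divide by simp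
        qed
        also have "\<dots> \<le> real N * 2 ^ (2 * n) / c\<^sup>2 * (2 ^ (4 * n) * (v ^ n + X i \<omega> ^ (4 * n) / v ^ n))"
          using y by (intro mult_left_mono) auto
        also have "\<dots> = D * (v ^ n + X i \<omega> ^ (4 * n) / v ^ n)"
        proof -
          have "(2::real) ^ (6 * n) = 2 ^ (2 * n) * 2 ^ (4 * n)" by (simp add: power_add[symmetric])
          then show ?thesis by (simp add: D_def)
        qed
        finally show "real N * (?c i)\<^sup>2 \<le> D * v ^ n + D / v ^ n * X i \<omega> ^ (4 * n)"
          by (simp add: distrib_left)
      qed
      finally show "(\<Sum>i<N. ?c i)\<^sup>2 \<le> (\<Sum>i<N. D * v ^ n + D / v ^ n * X i \<omega> ^ (4 * n))" .
    qed
    also have "\<dots> = (\<Sum>i<N. ennreal (D * v ^ n) + ennreal (D / v ^ n) * ennreal (X i \<omega> ^ (4 * n)))"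
      using D v X_nonneg
      by (simp add: sum_ennreal[symmetric] ennreal_plus[symmetric] ennreal_mult[symmetric] del: sum_ennreal ennreal_plus)
    finally show ?case .
  qed
  also have "\<dots> = (\<Sum>i<N. ennreal (D * v ^ n) + ennreal (D / v ^ n) * (\<integral>\<^sup>+\<omega>. ennreal (X i \<omega> ^ (4 * n)) \<partial>M))"
    by (simp add: nn_integral_sum nn_integral_add nn_integral_cmult emeasure_space_1)
  also have "\<dots> \<le> (\<Sum>i<N. ennreal (D * v ^ n) + ennreal (D / v ^ n) * ennreal (K * v ^ (2 * n)))"
    by (intro sum_mono add_left_mono mult_left_mono X_int) auto
  also have "\<dots> = ennreal (real N * (D * v ^ n + D / v ^ n * (K * v ^ (2 * n))))"
    using D v K by (simp add: ennreal_mult[symmetric] ennreal_plus[symmetric] ennreal_of_nat_eq_real_of_nat del: ennreal_plus)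
  also have "real N * (D * v ^ n + D / v ^ n * (K * v ^ (2 * n))) = (real N * v)\<^sup>2 * (2 ^ (6 * n) * (1 + K) / c\<^sup>2 * v ^ (n - 2))"
  proof -
    have "v ^ n = v\<^sup>2 * v ^ (n - 2)"
      using power_add[of v 2 "n - 2"] n by (simp only: le_add_diff_inverse)
    moreover have "v ^ (2 * n) = v ^ n * v ^ n" by (simp only: power_add mult_2)
    ultimately show ?thesis using v by (simp add: D_def power2_eq_square algebra_simps add_divide_distrib)
  qed
  also have "ennreal \<dots> \<le> ennreal ((2 * t)\<^sup>2 * (2 ^ (6 * n) * (1 + K) / c\<^sup>2 * v ^ (n - 2)))"
    using N v K by (intro ennreal_leI mult_right_mono power_mono) auto
  also have "v ^ (n - 2) = r ^ (2 * (d - 4))"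
    by (simp add: v_def n_def power_mult[symmetric])
  finally show ?thesis by (simp add: K_def c_def n_def power_mult_distrib mult_ac)
qed

end

section \<open>Dimension four: potential along the path and exceptional pieces\<close>

lemma sum_inverse_squares_le: "(\<Sum>m=1..n. 1 / (real m)\<^sup>2) \<le> 2"
proof -
  have "(\<Sum>m=1..Suc n. 1 / (real m)\<^sup>2) \<le> 2 - 1 / real (Suc n)" for n
  proof (induction n)
    case (Suc n)
    have "1 / (real (Suc (Suc n)))\<^sup>2 \<le> 1 / (real (Suc n) * real (Suc (Suc n)))"
      by (intro divide_left_mono) (auto simp: power2_eq_square)
    also have "\<dots> = 1 / real (Suc n) - 1 / real (Suc (Suc n))" by (simp add: field_simps)
    finally show ?case using Suc.IH by simp
  qed simp
  from this[of "n - 1"] show ?thesis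
    by (cases n) (auto intro: order_trans)
qed

lemma harm_double_le: "harm (2 * n) \<le> 2 * (harm n :: real)"
proof (induction n)
  case (Suc n)
  have "inverse (real (Suc (2 * n))) \<le> inverse (real (Suc n))"
    "inverse (real (Suc (Suc (2 * n)))) \<le> inverse (real (Suc n))"
    by (intro le_imp_inverse_le; simp)+
  moreover have "harm (2 * Suc n) = harm (2 * n) + inverse (real (Suc (2 * n))) + inverse (real (Suc (Suc (2 * n))))"
    by (simp add: harm_Suc del: of_nat_Suc)
  moreover have "harm (Suc n) = harm n + inverse (real (Suc n))" by (rule harm_Suc)
  ultimately show ?case using Suc.IH by linarith
qed (simp add: harm_def)

lemma harm_ge_1: "n > 0 \<Longrightarrow> 1 \<le> (harm n :: real)"
  using harm_mono[of 1 n, where 'a=real] by (simp add: harm_def)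

text \<open>Only the future of the path contributes here; the weights \<open>1 / m\<close> in the Cauchy--Schwarz
  inequality make every time scale count equally.\<close>

lemma potential_lower_bound:
  fixes p :: "nat \<Rightarrow> 'a::euclidean_space"
  assumes r: "r > 0" and v: "v = r\<^sup>2" and N: "N > 0" and iN: "i < N" and X: "0 \<le> X" "X\<^sup>2 \<le> v * harm N"
    and T: "(\<Sum>m=1..N. (norm (p (i + m) - p i))\<^sup>2 / (real m)\<^sup>2) \<le> 48 * v * harm N"
    and x: "norm (x - p i) < r + X"
  shows "harm N / (114 * v) \<le> (\<Sum>j<2 * N. 1 / (v + (norm (x - p j))\<^sup>2))"
proof -
  define H where "H = (harm N :: real)"
  have H: "H \<ge> 1" unfolding H_def using N by (rule harm_ge_1)
  have v_pos: "v > 0" using r v by simp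
  define q where "q m = v + (norm (x - p (i + m)))\<^sup>2" for m
  have q: "q m > 0" for m using v_pos by (simp add: q_def add_pos_nonneg)
  have two: "(a + b)\<^sup>2 \<le> 2 * a\<^sup>2 + 2 * b\<^sup>2" for a b :: real
    using zero_le_power2[of "a - b"] by (simp add: power2_eq_square algebra_simps)
  have xi: "(norm (x - p i))\<^sup>2 \<le> 2 * v + 2 * (v * H)"
  proof -
    have "(norm (x - p i))\<^sup>2 \<le> (r + X)\<^sup>2" using x by (intro power_mono) auto
    also have "\<dots> \<le> 2 * r\<^sup>2 + 2 * X\<^sup>2" by (rule two)
    finally show ?thesis using X v by (simp add: H_def)
  qed
  \<comment> \<open>The 9 is 1 + 4 + 4, using \<open>v \<le> v * H\<close>.\<close>
  have q_le: "q m \<le> 9 * v * H + 2 * (norm (p (i + m) - p i))\<^sup>2" for m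
  proof -
    have "norm (x - p (i + m)) \<le> norm (x - p i) + norm (p (i + m) - p i)"
      using norm_triangle_ineq4[of "x - p i" "p (i + m) - p i"] by simp
    then have "(norm (x - p (i + m)))\<^sup>2 \<le> (norm (x - p i) + norm (p (i + m) - p i))\<^sup>2"
      by (intro power_mono) auto
    also have "\<dots> \<le> 2 * (norm (x - p i))\<^sup>2 + 2 * (norm (p (i + m) - p i))\<^sup>2" by (rule two)
    finally have "q m \<le> v + 2 * (2 * v + 2 * (v * H)) + 2 * (norm (p (i + m) - p i))\<^sup>2"
      using xi by (simp add: q_def)
    moreover have "v \<le> v * H" using v_pos H by simp
    ultimately show ?thesis by simp
  qed
  define P where "P = (\<Sum>m=1..N. 1 / q m)"
  have "H\<^sup>2 = (\<Sum>m=1..N. (sqrt (q m) / real m) * (1 / sqrt (q m)))\<^sup>2"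
    using q by (simp add: H_def harm_eq_sum_real less_imp_neq[THEN not_sym])
  also have "\<dots> \<le> (\<Sum>m=1..N. (sqrt (q m) / real m)\<^sup>2) * (\<Sum>m=1..N. (1 / sqrt (q m))\<^sup>2)"
    by (rule Cauchy_Schwarz_ineq_sum)
  also have "\<dots> = (\<Sum>m=1..N. q m / (real m)\<^sup>2) * P"
    using q by (simp add: power_divide less_imp_le P_def)
  \<comment> \<open>Here 114 = 9 * 2 + 2 * 48, from the bound 2 on the sum of inverse squares and
    the hypothesis on the displacements.\<close>
  also have "\<dots> \<le> 114 * v * H * P"
  proof (rule mult_right_mono)
    have "(\<Sum>m=1..N. q m / (real m)\<^sup>2) \<le> (\<Sum>m=1..N. (9 * v * H + 2 * (norm (p (i + m) - p i))\<^sup>2) / (real m)\<^sup>2)"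
      using q_le by (intro sum_mono divide_right_mono) auto
    also have "\<dots> = 9 * v * H * (\<Sum>m=1..N. 1 / (real m)\<^sup>2)
        + 2 * (\<Sum>m=1..N. (norm (p (i + m) - p i))\<^sup>2 / (real m)\<^sup>2)"
      by (simp add: add_divide_distrib sum.distrib sum_distrib_left)
    also have "\<dots> \<le> 9 * v * H * 2 + 2 * (48 * v * H)"
      using T v_pos H sum_inverse_squares_le[of N] by (intro add_mono mult_left_mono) (auto simp: H_def)
    finally show "(\<Sum>m=1..N. q m / (real m)\<^sup>2) \<le> 114 * v * H" by (simp add: mult_ac)
    show "0 \<le> P" using q by (simp add: P_def sum_nonneg less_imp_le)
  qed
  finally have "H * H \<le> H * (114 * v * P)" by (simp add: power2_eq_square mult_ac)
  then have "H \<le> 114 * v * P" using H by (simp add: mult_le_cancel_left)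
  then have "H / (114 * v) \<le> P" using v_pos by (simp add: field_simps)
  also have "P = (\<Sum>j\<in>(\<lambda>m. i + m) ` {1..N}. 1 / (v + (norm (x - p j))\<^sup>2))"
    by (subst sum.reindex) (auto simp: P_def q_def)
  \<comment> \<open>As \<open>i < N\<close> and \<open>m \<le> N\<close>, the index
    \<open>i + m\<close> stays below \<open>2 * N\<close>: continuing the path to twice the number
    of steps gives even the last piece a future of \<open>N\<close> steps.\<close>
  also have "\<dots> \<le> (\<Sum>j<2 * N. 1 / (v + (norm (x - p j))\<^sup>2))"
    using iN v_pos by (intro sum_mono2) (auto intro!: divide_nonneg_nonneg add_nonneg_nonneg)
  finally show ?thesis by (simp add: H_def)
qed

lemma power4_le_exp:
  fixes x :: real
  assumes "0 \<le> x"
  shows "x ^ 4 \<le> 24 * exp x"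
proof -
  have "(\<Sum>n\<in>{4}. x ^ n /\<^sub>R fact n) \<le> (\<Sum>n. x ^ n /\<^sub>R fact n)"
    using assms by (intro sum_le_suminf summable_exp_generic) auto
  then have "x ^ 4 / fact 4 \<le> exp x" by (simp add: exp_def divide_inverse mult.commute)
  then show ?thesis by (simp add: fact_numeral)
qed

text \<open>By the AM-GM inequality, as \<open>X\<^sup>8 / (v\<^sup>2 H\<^sup>2)\<close> or the exponential term is at least \<open>v\<^sup>2 H\<^sup>2\<close>.\<close>

lemma bad_piece_le:
  fixes r v H X T :: real
  assumes r: "r > 0" and v: "v = r\<^sup>2" and H: "H \<ge> 1" and X: "0 \<le> X"
    and bad: "v * H < X\<^sup>2 \<or> 48 * v * H < T"
  shows "(r + X) ^ 4 \<le> 128 * v\<^sup>2 / H\<^sup>2 + 129 / (v\<^sup>2 * H\<^sup>2) * X ^ 8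
    + v\<^sup>2 * H\<^sup>2 * exp (- 3 * H) * exp (T / (16 * v))"
proof -
  have v_pos: "v > 0" using r v by simp
  have vH: "v\<^sup>2 * H\<^sup>2 > 0" using v_pos H by simp
  have "((r + X) ^ 4)\<^sup>2 = (r + X) ^ 8" by (simp flip: power_mult)
  also have "\<dots> \<le> 2 ^ 8 * (r ^ 8 + X ^ 8)" using r X by (intro power_add_le) auto
  also have "r ^ 8 = v\<^sup>2 * v\<^sup>2" by (simp add: v flip: power_mult power_add)
  finally have sq: "((r + X) ^ 4)\<^sup>2 / (v\<^sup>2 * H\<^sup>2) \<le> 2 ^ 8 * (v\<^sup>2 * v\<^sup>2 + X ^ 8) / (v\<^sup>2 * H\<^sup>2)"
    using vH by (intro divide_right_mono) auto
  have "2 ^ 8 * (v\<^sup>2 * v\<^sup>2 + X ^ 8) / (v\<^sup>2 * H\<^sup>2) = 256 * v\<^sup>2 / H\<^sup>2 + 256 / (v\<^sup>2 * H\<^sup>2) * X ^ 8"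
  proof -
    have "2 ^ 8 * (w * w + Y) / (w * h) = 256 * w / h + 256 / (w * h) * Y"
      if "w > 0" "h > 0" for w h Y :: real
      using that by (simp add: field_simps)
    from this[of "v\<^sup>2" "H\<^sup>2" "X ^ 8"] show ?thesis using v_pos H by simp
  qed
  with sq have sq': "((r + X) ^ 4)\<^sup>2 / (v\<^sup>2 * H\<^sup>2) \<le> 256 * v\<^sup>2 / H\<^sup>2 + 256 / (v\<^sup>2 * H\<^sup>2) * X ^ 8"
    by simp
  have big: "v\<^sup>2 * H\<^sup>2 \<le> 1 / (v\<^sup>2 * H\<^sup>2) * X ^ 8 + v\<^sup>2 * H\<^sup>2 * exp (- 3 * H) * exp (T / (16 * v))"
    using bad
  proof
    assume "v * H < X\<^sup>2"
    then have "(v * H) ^ 4 \<le> (X\<^sup>2) ^ 4" using v_pos H by (intro power_mono) auto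
    then have "(v\<^sup>2 * H\<^sup>2) * (v\<^sup>2 * H\<^sup>2) \<le> X ^ 8"
      by (simp add: power_mult_distrib power_mult[symmetric] power_add[symmetric] mult_ac flip: power_add)
    then have "v\<^sup>2 * H\<^sup>2 \<le> X ^ 8 / (v\<^sup>2 * H\<^sup>2)" using vH by (subst pos_le_divide_eq) auto
    then have "v\<^sup>2 * H\<^sup>2 \<le> 1 / (v\<^sup>2 * H\<^sup>2) * X ^ 8" by simp
    moreover have "0 \<le> v\<^sup>2 * H\<^sup>2 * exp (- 3 * H) * exp (T / (16 * v))" using vH by simp
    ultimately show ?thesis by linarith
  next
    assume "48 * v * H < T"
    \<comment> \<open>The threshold is 48 = 3 * 16, so exceeding it outweighs the factor
      \<open>exp (- 3 * H)\<close>.\<close>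
    then have "3 * H \<le> T / (16 * v)" using v_pos by (simp add: field_simps)
    then have "1 \<le> exp (- 3 * H + T / (16 * v))" by simp
    then have "1 \<le> exp (- 3 * H) * exp (T / (16 * v))" by (simp only: exp_add)
    then have "v\<^sup>2 * H\<^sup>2 * 1 \<le> v\<^sup>2 * H\<^sup>2 * (exp (- 3 * H) * exp (T / (16 * v)))"
      using vH by (intro mult_left_mono) auto
    moreover have "0 \<le> 1 / (v\<^sup>2 * H\<^sup>2) * X ^ 8" using vH X by simp
    ultimately show ?thesis by (simp only: mult.assoc mult_1_right)
  qed
  have "2 * (r + X) ^ 4 \<le> v\<^sup>2 * H\<^sup>2 + ((r + X) ^ 4)\<^sup>2 / (v\<^sup>2 * H\<^sup>2)"
    using vH by (rule power_mean_le)
  moreover have "0 \<le> 1 / (v\<^sup>2 * H\<^sup>2) * X ^ 8" using vH X by simp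
  moreover have "0 \<le> v\<^sup>2 * H\<^sup>2 * exp (- 3 * H) * exp (T / (16 * v))" using vH by simp
  moreover have "((r + X) ^ 4)\<^sup>2 / (v\<^sup>2 * H\<^sup>2) \<le> 256 * (v\<^sup>2 / H\<^sup>2) + 256 * (1 / (v\<^sup>2 * H\<^sup>2) * X ^ 8)"
    using sq' by simp
  \<comment> \<open>Halving gives 128 = 256 / 2 for \<open>a\<close> and 128 + 1 / 2 for
    \<open>b\<close>, rounded up to 129.\<close>
  moreover have "z \<le> 128 * a + 129 * b + e"
    if "2 * z \<le> w + s" "0 \<le> b" "0 \<le> e" "s \<le> 256 * a + 256 * b" "w \<le> b + e" for z w s a b e :: real
    using that by linarith
  ultimately have "(r + X) ^ 4 \<le> 128 * (v\<^sup>2 / H\<^sup>2) + 129 * (1 / (v\<^sup>2 * H\<^sup>2) * X ^ 8)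
      + v\<^sup>2 * H\<^sup>2 * exp (- 3 * H) * exp (T / (16 * v))"
    using big by blast
  then show ?thesis by simp
qed

context standard_brownian_motion
begin

text \<open>A statement about one fixed path: \<open>A1\<close> collects the good pieces and is
  bounded through the potential, the bad ones in \<open>A2\<close> are bounded ball by ball. Since
  the bound of \<open>bad_piece_le\<close> is nonnegative, it may be charged to every piece; this
  removes the event of being bad before expectations are taken.\<close>

lemma newton_capacity_sausage_le_dim4:
  assumes d: "DIM('a) = 4" and r: "0 < r" and v: "v = r\<^sup>2" and N: "t < real N * v" "N > 0"
    and X: "\<And>i. 0 \<le> X i"
      "\<And>i s. s \<in> {real i * v..real i * v + v} \<Longrightarrow> norm (B s \<omega> - B (real i * v) \<omega>) \<le> X i"
  defines "c \<equiv> newton_const TYPE('a)" and "\<Gamma> \<equiv> \<Sum>i<2 * N. \<Sum>j<2 * N. interaction v i j \<omega>"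
    and "H \<equiv> harm N :: real"
  shows "(newton_capacity (wiener_sausage (\<lambda>s. B s \<omega>) r t))\<^sup>2 \<le>
    ennreal (2 * 114 ^ 4 * v ^ 4 / (c\<^sup>2 * H ^ 4) * \<Gamma>\<^sup>2 + 32 * real N / c\<^sup>2 *
      (\<Sum>i<N. 128 * v\<^sup>2 / H\<^sup>2 + 129 / (v\<^sup>2 * H\<^sup>2) * X i ^ 8
         + v\<^sup>2 * H\<^sup>2 * exp (- 3 * H) * exp (walk_energy v i N \<omega> / (16 * v))))"
proof -
  let ?W = "wiener_sausage (\<lambda>s. B s \<omega>) r t"
  define p where "p i = B (real i * v) \<omega>" for i
  have v_pos: "v > 0" using r v by simp
  have c: "c > 0" unfolding c_def using d by (intro newton_const_pos) simp
  have H: "H \<ge> 1" unfolding H_def using N(2) by (rule harm_ge_1)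
  define bad where "bad i \<longleftrightarrow> v * H < (X i)\<^sup>2 \<or> 48 * v * H < walk_energy v i N \<omega>" for i
  define A1 where "A1 = (\<Union>i\<in>{i. i < N \<and> \<not> bad i}. ball (p i) (r + X i))"
  define A2 where "A2 i = (if bad i then ball (p i) (r + X i) else {})" for i
  define c2 where "c2 i = (if bad i then (2 * (r + X i))\<^sup>2 / c else 0)" for i
  define u where "u = H / (114 * v)"
  have u: "u > 0" using H v_pos by (simp add: u_def)
  have A1: "capacity_bound A1 (\<Gamma> / (c * u\<^sup>2))"
    unfolding \<Gamma>_def interaction_def c_def
  proof (subst cutoff_kernel_commute, rule capacity_bound_potential[OF d v_pos u, of "2 * N" A1 p, unfolded p_def])
    fix x assume "x \<in> A1"
    then obtain i where i: "i < N" "\<not> bad i" "norm (x - p i) < r + X i"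
      by (auto simp: A1_def dist_norm norm_minus_commute)
    then show "u \<le> (\<Sum>j<2 * N. 1 / (v + (norm (x - B (real j * v) \<omega>))\<^sup>2))"
      unfolding u_def H_def p_def[symmetric] using r v N(2) X(1)
      by (intro potential_lower_bound[where i = i and X = "X i"])
         (auto simp: bad_def walk_energy_def p_def H_def not_less)
  qed (use N in simp)
  have A2: "capacity_bound (\<Union>i<N. A2 i) (\<Sum>i<N. c2 i)"
  proof (rule capacity_bound_UN)
    fix i
    have "capacity_bound (ball (p i) (r + X i)) ((2 * (r + X i))\<^sup>2 / c)"
      using capacity_bound_ball[of "r + X i" "p i"] d r X(1)[of i] by (simp add: c_def add_pos_nonneg)
    then show "capacity_bound (A2 i) (c2 i)"
      by (simp add: A2_def c2_def capacity_bound_empty)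
  qed (simp add: A2_def)
  have "?W \<subseteq> (\<Union>i<N. ball (p i) (r + X i))"
    unfolding p_def using X(2) by (intro wiener_sausage_subset[OF v_pos N(1)]) auto
  also have "\<dots> \<subseteq> A1 \<union> (\<Union>i<N. A2 i)" by (auto simp: A1_def A2_def)
  finally have cover: "?W \<subseteq> A1 \<union> (\<Union>i<N. A2 i)" .
  have "A1 \<in> sets borel" unfolding A1_def by (intro borel_open open_UN) auto
  moreover have "(\<Union>i<N. A2 i) \<in> sets borel" by (intro borel_open open_UN) (auto simp: A2_def)
  ultimately have "capacity_bound (A1 \<union> (\<Union>i<N. A2 i)) (\<Gamma> / (c * u\<^sup>2) + (\<Sum>i<N. c2 i))"
    by (rule capacity_bound_Un[OF A1 A2])
  then have "capacity_bound ?W (\<Gamma> / (c * u\<^sup>2) + (\<Sum>i<N. c2 i))"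
    using cover by (rule capacity_bound_subset)
  then have "(newton_capacity ?W)\<^sup>2 \<le> ennreal ((\<Gamma> / (c * u\<^sup>2) + (\<Sum>i<N. c2 i))\<^sup>2)"
    by (rule newton_capacity_square_le) (simp add: open_wiener_sausage borel_open)
  also have "\<dots> \<le> ennreal (2 * 114 ^ 4 * v ^ 4 / (c\<^sup>2 * H ^ 4) * \<Gamma>\<^sup>2 + 32 * real N / c\<^sup>2 *
      (\<Sum>i<N. 128 * v\<^sup>2 / H\<^sup>2 + 129 / (v\<^sup>2 * H\<^sup>2) * X i ^ 8
         + v\<^sup>2 * H\<^sup>2 * exp (- 3 * H) * exp (walk_energy v i N \<omega> / (16 * v))))"
  proof (rule ennreal_leI)
    have two: "(a + b)\<^sup>2 \<le> 2 * a\<^sup>2 + 2 * b\<^sup>2" for a b :: real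
      using zero_le_power2[of "a - b"] by (simp add: power2_eq_square algebra_simps)
    have "(\<Gamma> / (c * u\<^sup>2) + (\<Sum>i<N. c2 i))\<^sup>2 \<le> 2 * (\<Gamma> / (c * u\<^sup>2))\<^sup>2 + 2 * (\<Sum>i<N. c2 i)\<^sup>2"
      by (rule two)
    also have "2 * (\<Gamma> / (c * u\<^sup>2))\<^sup>2 = 2 * 114 ^ 4 * v ^ 4 / (c\<^sup>2 * H ^ 4) * \<Gamma>\<^sup>2"
      by (simp add: u_def power_divide power_mult_distrib flip: power_mult)
    also have "(\<Sum>i<N. c2 i)\<^sup>2 \<le> (\<Sum>i<N. (c2 i)\<^sup>2) * card {..<N}"
      by (rule sum_squared_le_sum_of_squares)
    also have "(\<Sum>i<N. (c2 i)\<^sup>2) \<le> (\<Sum>i<N. 16 / c\<^sup>2 * (128 * v\<^sup>2 / H\<^sup>2 + 129 / (v\<^sup>2 * H\<^sup>2) * X i ^ 8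
         + v\<^sup>2 * H\<^sup>2 * exp (- 3 * H) * exp (walk_energy v i N \<omega> / (16 * v))))"
    proof (intro sum_mono)
      fix i
      show "(c2 i)\<^sup>2 \<le> 16 / c\<^sup>2 * (128 * v\<^sup>2 / H\<^sup>2 + 129 / (v\<^sup>2 * H\<^sup>2) * X i ^ 8
         + v\<^sup>2 * H\<^sup>2 * exp (- 3 * H) * exp (walk_energy v i N \<omega> / (16 * v)))"
      proof (cases "bad i")
        case True
        have "(c2 i)\<^sup>2 = 16 / c\<^sup>2 * (r + X i) ^ 4"
        proof -
          have "((2 * (r + X i))\<^sup>2)\<^sup>2 = 2 ^ 4 * (r + X i) ^ 4"
            by (simp only: power_mult_distrib power_mult[symmetric]) simp
          then show ?thesis using True unfolding c2_def by (simp only: if_True power_divide) simp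
        qed
        also have "\<dots> \<le> 16 / c\<^sup>2 * (128 * v\<^sup>2 / H\<^sup>2 + 129 / (v\<^sup>2 * H\<^sup>2) * X i ^ 8
         + v\<^sup>2 * H\<^sup>2 * exp (- 3 * H) * exp (walk_energy v i N \<omega> / (16 * v)))"
          using True r v H X(1)[of i] by (intro mult_left_mono bad_piece_le) (auto simp: bad_def)
        finally show ?thesis .
      next
        case False
        have "0 \<le> 128 * v\<^sup>2 / H\<^sup>2 + 129 / (v\<^sup>2 * H\<^sup>2) * X i ^ 8
         + v\<^sup>2 * H\<^sup>2 * exp (- 3 * H) * exp (walk_energy v i N \<omega> / (16 * v))"
          using X(1)[of i] by (intro add_nonneg_nonneg mult_nonneg_nonneg) auto
        then show ?thesis using False by (simp add: c2_def)
      qed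
    qed
    finally show "(\<Gamma> / (c * u\<^sup>2) + (\<Sum>i<N. c2 i))\<^sup>2 \<le>
      2 * 114 ^ 4 * v ^ 4 / (c\<^sup>2 * H ^ 4) * \<Gamma>\<^sup>2 + 32 * real N / c\<^sup>2 *
      (\<Sum>i<N. 128 * v\<^sup>2 / H\<^sup>2 + 129 / (v\<^sup>2 * H\<^sup>2) * X i ^ 8
         + v\<^sup>2 * H\<^sup>2 * exp (- 3 * H) * exp (walk_energy v i N \<omega> / (16 * v)))"
      by (simp add: sum_distrib_left sum_distrib_right mult_ac mult_right_mono)
  qed
  finally show ?thesis .
qed

text \<open>Both contributions have order \<open>(N * v) ^ 2 / H ^ 2\<close>:
  \<open>v ^ 4 / H ^ 4\<close> times the second moment \<open>N ^ 2 * H ^ 2 / v ^ 2\<close> of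
  \<open>\<Gamma>\<close>, and \<open>N\<close> times a sum of \<open>N\<close> terms of order
  \<open>v ^ 2 / H ^ 2\<close>. Then \<open>N * v \<le> 2 * t\<close> and
  \<open>H \<ge> ln (t / v)\<close> finish.\<close>

lemma nn_integral_capacity_square_le_dim4:
  assumes d: "DIM('a) = 4" and r: "0 < r" "r\<^sup>2 < t"
  shows "(\<integral>\<^sup>+\<omega>. (newton_capacity (wiener_sausage (\<lambda>s. B s \<omega>) r t))\<^sup>2 \<partial>M)
    \<le> ennreal (4 * (256 * 114 ^ 4 + 32 * (152 + 129 * oscillation_const TYPE('a) 2)) / (newton_const TYPE('a))\<^sup>2
        * (t / ln (t / r\<^sup>2))\<^sup>2)"
proof -
  define v where "v = r\<^sup>2"
  define c where "c = newton_const TYPE('a)"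
  define K where "K = oscillation_const TYPE('a) 2"
  have v: "v > 0" "v < t" using r by (auto simp: v_def)
  have c: "c > 0" unfolding c_def using d by (intro newton_const_pos) simp
  have K: "K \<ge> 0" unfolding K_def by (rule oscillation_const_nonneg)
  obtain N where N: "t < real N * v" "real N * v \<le> 2 * t" "N > 0"
    using number_of_steps[of v t] v by auto
  define H where "H = (harm N :: real)"
  have H: "H \<ge> 1" unfolding H_def using N(3) by (rule harm_ge_1)
  have ln_H: "0 < ln (t / v)" "ln (t / v) \<le> H"
  proof -
    show "0 < ln (t / v)" using v by simp
    have "t / v \<le> real N + 1" using N(1) v by (simp add: field_simps)
    then have "ln (t / v) \<le> ln (real N + 1)" using v by (subst ln_le_cancel_iff) auto
    also have "\<dots> \<le> H" unfolding H_def by (rule ln_le_harm)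
    finally show "ln (t / v) \<le> H" .
  qed
  obtain X where X [measurable]: "\<And>i. X i \<in> borel_measurable M" and X_nonneg: "\<And>i \<omega>. 0 \<le> X i \<omega>"
    and X_AE: "AE \<omega> in M. \<forall>i. \<forall>s\<in>{real i * v..real i * v + v}. norm (B s \<omega> - B (real i * v) \<omega>) \<le> X i \<omega>"
    and X_int': "\<And>i. (\<integral>\<^sup>+\<omega>. ennreal (X i \<omega> ^ (4 * 2)) \<partial>M) \<le> ennreal (K * v ^ (2 * 2))"
    by (rule oscillation_family[OF v(1) order_refl, folded K_def], rule that)
  have X_int: "(\<integral>\<^sup>+\<omega>. ennreal (X i \<omega> ^ 8) \<partial>M) \<le> ennreal (K * v ^ 4)" for i
    using X_int'[of i] by simp
  define \<Gamma> where "\<Gamma> \<omega> = (\<Sum>i<2 * N. \<Sum>j<2 * N. interaction v i j \<omega>)" for \<omega>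
  have [measurable]: "\<Gamma> \<in> borel_measurable M"
    unfolding \<Gamma>_def using v(1) by measurable
  have [measurable]: "walk_energy v i N \<in> borel_measurable M" for i
    using v(1) by (rule measurable_walk_energy)
  define a1 where "a1 = 2 * 114 ^ 4 * v ^ 4 / (c\<^sup>2 * H ^ 4)"
  define a2 where "a2 = 32 * real N / c\<^sup>2"
  define b1 where "b1 = 128 * v\<^sup>2 / H\<^sup>2"
  define b2 where "b2 = 129 / (v\<^sup>2 * H\<^sup>2)"
  define b3 where "b3 = v\<^sup>2 * H\<^sup>2 * exp (- 3 * H)"
  have nonneg: "0 \<le> a1" "0 \<le> a2" "0 \<le> b1" "0 \<le> b2" "0 \<le> b3"
    using v H by (auto simp: a1_def a2_def b1_def b2_def b3_def)
  have "(\<integral>\<^sup>+\<omega>. (newton_capacity (wiener_sausage (\<lambda>s. B s \<omega>) r t))\<^sup>2 \<partial>M)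
    \<le> (\<integral>\<^sup>+\<omega>. ennreal a1 * ennreal ((\<Gamma> \<omega>)\<^sup>2) + ennreal a2 *
        (\<Sum>i<N. ennreal b1 + ennreal b2 * ennreal (X i \<omega> ^ 8)
          + ennreal b3 * ennreal (exp (walk_energy v i N \<omega> / (16 * v)))) \<partial>M)"
  proof (rule nn_integral_mono_AE, use X_AE in eventually_elim)
    case (elim \<omega>)
    have "(newton_capacity (wiener_sausage (\<lambda>s. B s \<omega>) r t))\<^sup>2 \<le>
      ennreal (a1 * (\<Gamma> \<omega>)\<^sup>2 + a2 *
        (\<Sum>i<N. b1 + b2 * X i \<omega> ^ 8 + b3 * exp (walk_energy v i N \<omega> / (16 * v))))"
      unfolding a1_def a2_def b1_def b2_def b3_def \<Gamma>_def c_def H_def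
      using d r N elim X_nonneg by (intro newton_capacity_sausage_le_dim4) (auto simp: v_def)
    also have "\<dots> = ennreal a1 * ennreal ((\<Gamma> \<omega>)\<^sup>2) + ennreal a2 *
        (\<Sum>i<N. ennreal b1 + ennreal b2 * ennreal (X i \<omega> ^ 8)
          + ennreal b3 * ennreal (exp (walk_energy v i N \<omega> / (16 * v))))"
      using nonneg X_nonneg
      by (simp add: sum_nonneg ennreal_mult[symmetric] ennreal_plus[symmetric] del: ennreal_plus)
    finally show ?case .
  qed
  also have "\<dots> = ennreal a1 * (\<integral>\<^sup>+\<omega>. ennreal ((\<Gamma> \<omega>)\<^sup>2) \<partial>M) + ennreal a2 *
        (\<Sum>i<N. ennreal b1 + ennreal b2 * (\<integral>\<^sup>+\<omega>. ennreal (X i \<omega> ^ 8) \<partial>M)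
          + ennreal b3 * (\<integral>\<^sup>+\<omega>. ennreal (exp (walk_energy v i N \<omega> / (16 * v))) \<partial>M))"
    by (simp add: nn_integral_sum nn_integral_add nn_integral_cmult emeasure_space_1 del: sum_ennreal)
  also have "\<dots> \<le> ennreal a1 * ennreal (128 * (real N)\<^sup>2 * H\<^sup>2 / v\<^sup>2) + ennreal a2 *
        (\<Sum>i<N. ennreal b1 + ennreal b2 * ennreal (K * v ^ 4) + ennreal b3 * ennreal (exp (2 * H)))"
  proof (intro add_mono mult_left_mono sum_mono X_int order_refl)
    \<comment> \<open>There are \<open>2 * N\<close> points and
      \<open>harm (2 * N) \<le> 2 * harm N\<close>, whence 128 = 8 * 4 * 4.\<close>
    have "(\<integral>\<^sup>+\<omega>. ennreal ((\<Gamma> \<omega>)\<^sup>2) \<partial>M) \<le> ennreal (8 * (real (2 * N))\<^sup>2 * (harm (2 * N))\<^sup>2 / v\<^sup>2)"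
      unfolding \<Gamma>_def using d v(1) by (rule nn_integral_interaction_square_le)
    also have "\<dots> \<le> ennreal (8 * (real (2 * N))\<^sup>2 * (2 * H)\<^sup>2 / v\<^sup>2)"
      unfolding H_def using harm_double_le[of N]
      by (intro ennreal_leI divide_right_mono mult_left_mono power_mono) (auto simp: harm_nonneg)
    finally show "(\<integral>\<^sup>+\<omega>. ennreal ((\<Gamma> \<omega>)\<^sup>2) \<partial>M) \<le> ennreal (128 * (real N)\<^sup>2 * H\<^sup>2 / v\<^sup>2)"
      by (simp add: power_mult_distrib mult.assoc)
    show "(\<integral>\<^sup>+\<omega>. ennreal (exp (walk_energy v i N \<omega> / (16 * v))) \<partial>M) \<le> ennreal (exp (2 * H))" for i
      using nn_integral_exp_walk_energy_le[OF v(1) N(3), of i] d by (simp add: H_def)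
  qed auto
  also have "\<dots> = ennreal (a1 * (128 * (real N)\<^sup>2 * H\<^sup>2 / v\<^sup>2) + a2 * (real N * (b1 + b2 * (K * v ^ 4) + b3 * exp (2 * H))))"
    using nonneg K v H
    by (simp add: ennreal_mult[symmetric] ennreal_plus[symmetric] ennreal_of_nat_eq_real_of_nat del: ennreal_plus)
  also have "\<dots> \<le> ennreal ((256 * 114 ^ 4 + 32 * (152 + 129 * K)) / c\<^sup>2 * ((real N * v)\<^sup>2 / H\<^sup>2))"
  proof (rule ennreal_leI)
    have 1: "a1 * (128 * (real N)\<^sup>2 * H\<^sup>2 / v\<^sup>2) = 256 * 114 ^ 4 / c\<^sup>2 * ((real N * v)\<^sup>2 / H\<^sup>2)"
      using v H c by (simp add: a1_def field_simps power2_eq_square power4_eq_xxxx)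
    have 2: "b2 * (K * v ^ 4) = 129 * K * (v\<^sup>2 / H\<^sup>2)"
      using v H by (simp add: b2_def field_simps power2_eq_square power4_eq_xxxx)
    \<comment> \<open>The moment \<open>exp (2 * H)\<close>, where 2 is half the dimension, against
      \<open>exp (- 3 * H)\<close> leaves \<open>H ^ 4 * exp (- H)\<close> relative to
      \<open>v ^ 2 / H ^ 2\<close>.\<close>
    have 3: "b3 * exp (2 * H) \<le> 24 * (v\<^sup>2 / H\<^sup>2)"
    proof -
      have "H ^ 4 \<le> 24 * exp H" using H by (intro power4_le_exp) simp
      then have "H ^ 4 * exp (- H) \<le> 24" by (simp add: exp_minus field_simps)
      then have "v\<^sup>2 / H\<^sup>2 * (H ^ 4 * exp (- H)) \<le> v\<^sup>2 / H\<^sup>2 * 24" by (intro mult_left_mono) auto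
      also have "\<dots> = 24 * (v\<^sup>2 / H\<^sup>2)" by (rule mult.commute)
      finally have "v\<^sup>2 / H\<^sup>2 * (H ^ 4 * exp (- H)) \<le> 24 * (v\<^sup>2 / H\<^sup>2)" .
      moreover have "b3 * exp (2 * H) = v\<^sup>2 / H\<^sup>2 * (H ^ 4 * exp (- H))"
      proof -
        have "exp (- 3 * H) * exp (2 * H) = exp (- H)" by (simp flip: exp_add)
        then show ?thesis using H by (simp add: b3_def power2_eq_square power4_eq_xxxx)
      qed
      ultimately show ?thesis by (simp only:)
    qed
    have "a2 * (real N * (b1 + b2 * (K * v ^ 4) + b3 * exp (2 * H)))
      \<le> a2 * (real N * (128 * (v\<^sup>2 / H\<^sup>2) + 129 * K * (v\<^sup>2 / H\<^sup>2) + 24 * (v\<^sup>2 / H\<^sup>2)))"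
      using 3 nonneg unfolding 2 by (intro mult_left_mono) (auto simp: b1_def)
    also have "\<dots> = 32 * (152 + 129 * K) / c\<^sup>2 * ((real N * v)\<^sup>2 / H\<^sup>2)"
      by (simp add: a2_def power2_eq_square algebra_simps add_divide_distrib)
    finally show "a1 * (128 * (real N)\<^sup>2 * H\<^sup>2 / v\<^sup>2) + a2 * (real N * (b1 + b2 * (K * v ^ 4) + b3 * exp (2 * H)))
      \<le> (256 * 114 ^ 4 + 32 * (152 + 129 * K)) / c\<^sup>2 * ((real N * v)\<^sup>2 / H\<^sup>2)"
      unfolding 1 by (simp add: add_divide_distrib distrib_right)
  qed
  also have "\<dots> \<le> ennreal ((256 * 114 ^ 4 + 32 * (152 + 129 * K)) / c\<^sup>2 * (4 * (t / ln (t / v))\<^sup>2))"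
  proof (intro ennreal_leI mult_left_mono)
    have "real N * v / H \<le> 2 * t / ln (t / v)"
      using N v ln_H by (intro frac_le) auto
    then have "(real N * v / H)\<^sup>2 \<le> (2 * t / ln (t / v))\<^sup>2"
      using v H by (intro power_mono) auto
    then show "(real N * v)\<^sup>2 / H\<^sup>2 \<le> 4 * (t / ln (t / v))\<^sup>2" by (simp add: power_divide power_mult_distrib)
  qed (use K in auto)
  finally show ?thesis
    by (simp only: K_def c_def v_def times_divide_eq_left times_divide_eq_right mult_ac)
qed

end

theorem lemma4p3:
  fixes t0 r0 :: real
  assumes "CARD('n::finite) \<ge> 4" and "t0 > 1" and "0 < r0" and "r0 < 1"
  shows "\<exists>C>0. \<forall>(M :: 'w measure) (B :: real \<Rightarrow> 'w \<Rightarrow> real ^ 'n).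
    standard_brownian_motion M B \<longrightarrow>
    (\<forall>t r. t0 \<le> t \<and> 0 < r \<and> r < r0 \<longrightarrow>
      (\<integral>\<^sup>+\<omega>. (newton_capacity (wiener_sausage (\<lambda>s. B s \<omega>) r t))\<^sup>2 \<partial>M)
        \<le> ennreal (C * (if CARD('n) \<ge> 5 then t\<^sup>2 * r ^ (2 * (CARD('n) - 4))
                        else (t / ln (t / r\<^sup>2))\<^sup>2)))"
proof -
  define d where "d = CARD('n)"
  define c where "c = newton_const TYPE(real ^ 'n)"
  \<comment> \<open>Fixed before \<open>M\<close> and \<open>B\<close>, so it is uniform over all
    Brownian motions; the second branch is the case \<open>d = 4\<close>.\<close>
  define C where "C = (if d \<ge> 5
    then 4 * 2 ^ (6 * (d - 2)) * (1 + oscillation_const TYPE(real ^ 'n) (d - 2)) / c\<^sup>2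
    else 4 * (256 * 114 ^ 4 + 32 * (152 + 129 * oscillation_const TYPE(real ^ 'n) 2)) / c\<^sup>2)"
  have dim: "DIM(real ^ 'n) = d" by (simp add: d_def)
  have d: "d \<ge> 4" using assms by (simp add: d_def)
  have c: "c > 0" unfolding c_def using d by (intro newton_const_pos) (simp add: d_def)
  show ?thesis
  proof (intro exI[of _ C] conjI allI impI)
    show "C > 0"
      using c oscillation_const_nonneg[where 'a="real ^ 'n"]
      by (auto simp: C_def intro!: divide_pos_pos mult_pos_pos add_pos_nonneg)
    fix M :: "'w measure" and B :: "real \<Rightarrow> 'w \<Rightarrow> real ^ 'n" and t r :: real
    assume "standard_brownian_motion M B" and tr: "t0 \<le> t \<and> 0 < r \<and> r < r0"
    then interpret standard_brownian_motion M B by simp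
    \<comment> \<open>From \<open>r < r0 < 1 < t0 \<le> t\<close>: a step of length
      \<open>r ^ 2\<close> fits into the time interval, and the logarithm of
      \<open>t / r ^ 2\<close> is positive.\<close>
    have "r\<^sup>2 < 1" using tr assms by (simp add: power_less_one_iff)
    then have "r\<^sup>2 < t" using tr assms by linarith
    then show "(\<integral>\<^sup>+\<omega>. (newton_capacity (wiener_sausage (\<lambda>s. B s \<omega>) r t))\<^sup>2 \<partial>M)
        \<le> ennreal (C * (if CARD('n) \<ge> 5 then t\<^sup>2 * r ^ (2 * (CARD('n) - 4))
                        else (t / ln (t / r\<^sup>2))\<^sup>2))"
      using nn_integral_capacity_square_le[of r t] nn_integral_capacity_square_le_dim4[of r t] d tr
      unfolding dim d_def[symmetric] C_def c_def by auto
  qed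
qed

end
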